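(* Let $A$ and $B$ be finitely generated groups with $B$ infinite, and let $G=A\wr B$ be their standard wreath product. Then the following are equivalent: (i) $G$ has hereditary Property (FA); (ii) $B$ has hereditary Property (FA) and $A$ has finite abelianisation.
   Context: A group $G$ has Property (FA) if every isometric action of $G$ on a (nonempty) simplicial tree has a fixed point (in the geometric realization); equivalently, every action of $G$ by automorphisms without inversions on a simplicial tree fixes a vertex. A group $G$ has hereditary Property (FA) if $G$ and all its finite index subgroups have Property (FA). The standard wreath product is $A\wr B := A^{(B)}\rtimes B$, where $A^{(B)}=\bigoplus_{b\in B}A_b$ is the direct sum (finitely supported functions) of copies of $A$ indexed by $B$, and $B$ acts by permuting the copies via left multiplication on the index set $B$. The abelianisation of $A$ is $A/[A,A]$. *)

theory Defs
  imports "HOL-Algebra.Algebra" "HOL-Algebra.Group_Action"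
    "HOL-Algebra.Generated_Groups" "HOL-Algebra.Product_Groups"
begin

definition finitely_generated_group :: "('a, 'c) monoid_scheme \<Rightarrow> bool" where
  "finitely_generated_group G \<longleftrightarrow>
     group G \<and> (\<exists>S. finite S \<and> S \<subseteq> carrier G \<and> generate G S = carrier G)"

definition abelianisation :: "('a, 'c) monoid_scheme \<Rightarrow> 'a set monoid" where
  "abelianisation G = G Mod derived G (carrier G)"

text \<open>
  A simplicial tree is given by its vertices \<open>V\<close> and its edges \<open>E\<close>, which are
  unordered pairs of distinct vertices. It may be infinite and need not be locally finite.
  The AFP predicate for trees in digraphs is not used: it only forbids
  directed cycles.
\<close>

definition graph_cycle :: "'v set set \<Rightarrow> 'v list \<Rightarrow> bool" where
  "graph_cycle E xs \<longleftrightarrow> 3 \<le> length xs \<and> distinct xs \<and>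
     (\<forall>i < length xs. {xs ! i, xs ! ((i + 1) mod length xs)} \<in> E)"

definition simplicial_tree :: "'v set \<Rightarrow> 'v set set \<Rightarrow> bool" where
  "simplicial_tree V E \<longleftrightarrow>
     V \<noteq> {} \<and>
     E \<subseteq> {{u, v} | u v. u \<in> V \<and> v \<in> V \<and> u \<noteq> v} \<and>
     (\<forall>u \<in> V. \<forall>v \<in> V. (u, v) \<in> {(x, y). {x, y} \<in> E}\<^sup>*) \<and>
     (\<nexists>xs. graph_cycle E xs)"

definition tree_action ::
    "('a, 'c) monoid_scheme \<Rightarrow> 'v set \<Rightarrow> 'v set set \<Rightarrow> ('a \<Rightarrow> 'v \<Rightarrow> 'v) \<Rightarrow> bool" where
  "tree_action G V E \<phi> \<longleftrightarrow>
     group_action G V \<phi> \<and>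
     (\<forall>g \<in> carrier G. \<forall>u \<in> V. \<forall>v \<in> V. {\<phi> g u, \<phi> g v} \<in> E \<longleftrightarrow> {u, v} \<in> E)"

definition without_inversions ::
    "('a, 'c) monoid_scheme \<Rightarrow> 'v set set \<Rightarrow> ('a \<Rightarrow> 'v \<Rightarrow> 'v) \<Rightarrow> bool" where
  "without_inversions G E \<phi> \<longleftrightarrow>
     \<not> (\<exists>g \<in> carrier G. \<exists>u v. {u, v} \<in> E \<and> \<phi> g u = v \<and> \<phi> g v = u)"

text \<open>
  A formula cannot quantify over all types, so Property (FA) takes as a parameter the type
  \<open>'v\<close> from which the vertices of the trees are drawn; the property proper is the
  conjunction over all \<open>'v\<close>. For finite \<open>'v\<close> it holds for every
  group, as an action without inversions on a finite tree fixes a vertex. For infinite \<open>'v\<close>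
  and a countable group it does not depend on \<open>'v\<close>: the orbit of any vertex spans a countable
  invariant subtree, which can be copied into \<open>'v\<close>.
\<close>

definition property_FA :: "'v itself \<Rightarrow> ('a, 'c) monoid_scheme \<Rightarrow> bool" where
  "property_FA T G \<longleftrightarrow>
     (\<forall>(V :: 'v set) E \<phi>.
        simplicial_tree V E \<and> tree_action G V E \<phi> \<and> without_inversions G E \<phi> \<longrightarrow>
        (\<exists>v \<in> V. \<forall>g \<in> carrier G. \<phi> g v = v))"

definition hereditary_FA :: "'v itself \<Rightarrow> ('a, 'c) monoid_scheme \<Rightarrow> bool" where
  "hereditary_FA T G \<longleftrightarrow>
     property_FA T G \<and>
     (\<forall>H. subgroup H G \<and> finite (rcosets\<^bsub>G\<^esub> H) \<longrightarrow> property_FA T (G\<lparr>carrier := H\<rparr>))"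

text \<open>
  Left multiplication by \<open>b\<close> moves the copy of \<open>A\<close> at \<open>x\<close> to the copy at \<open>b x\<close>;
  on functions this is precomposition with left multiplication by the inverse of \<open>b\<close>.
\<close>

definition shift :: "('b, 'd) monoid_scheme \<Rightarrow> 'b \<Rightarrow> ('b \<Rightarrow> 'a) \<Rightarrow> 'b \<Rightarrow> 'a" where
  "shift B b f = (\<lambda>x \<in> carrier B. f (inv\<^bsub>B\<^esub> b \<otimes>\<^bsub>B\<^esub> x))"

definition wreath_product ::
    "('a, 'c) monoid_scheme \<Rightarrow> ('b, 'd) monoid_scheme \<Rightarrow> (('b \<Rightarrow> 'a) \<times> 'b) monoid" where
  "wreath_product A B =
     (let N = sum_group (carrier B) (\<lambda>_. A) in
      \<lparr>carrier = carrier N \<times> carrier B,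
       monoid.mult = (\<lambda>(f, b) (f', b'). (f \<otimes>\<^bsub>N\<^esub> shift B b f', b \<otimes>\<^bsub>B\<^esub> b')),
       one = (\<one>\<^bsub>N\<^esub>, \<one>\<^bsub>B\<^esub>)\<rparr>)"

lemma shift_closed:
  assumes "group B" "b \<in> carrier B" "group A"
    and "f \<in> carrier (sum_group (carrier B) (\<lambda>_. A))"
  shows "shift B b f \<in> carrier (sum_group (carrier B) (\<lambda>_. A))"
proof -
  interpret B: group B by fact
  have f: "f \<in> (\<Pi>\<^sub>E i\<in>carrier B. carrier A)" "finite {i \<in> carrier B. f i \<noteq> \<one>\<^bsub>A\<^esub>}"
    using assms by (auto simp: carrier_sum_group)
  have "{i \<in> carrier B. shift B b f i \<noteq> \<one>\<^bsub>A\<^esub>}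
      \<subseteq> (\<lambda>y. b \<otimes>\<^bsub>B\<^esub> y) ` {i \<in> carrier B. f i \<noteq> \<one>\<^bsub>A\<^esub>}"
  proof
    fix i assume i: "i \<in> {i \<in> carrier B. shift B b f i \<noteq> \<one>\<^bsub>A\<^esub>}"
    have "i = b \<otimes>\<^bsub>B\<^esub> (inv\<^bsub>B\<^esub> b \<otimes>\<^bsub>B\<^esub> i)"
      using i assms(2) by (simp add: B.m_assoc [symmetric])
    then show "i \<in> (\<lambda>y. b \<otimes>\<^bsub>B\<^esub> y) ` {i \<in> carrier B. f i \<noteq> \<one>\<^bsub>A\<^esub>}"
      using i assms(2) by (auto simp: shift_def)
  qed
  then have "finite {i \<in> carrier B. shift B b f i \<noteq> \<one>\<^bsub>A\<^esub>}"
    using f(2) finite_surj by blast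
  moreover have "shift B b f \<in> (\<Pi>\<^sub>E i\<in>carrier B. carrier A)"
    using f(1) assms(2) by (auto simp: shift_def)
  ultimately show ?thesis
    using assms by (simp add: carrier_sum_group)
qed

lemma group_wreath_product:
  assumes "group A" "group B"
  shows "group (wreath_product A B)"
proof -
  interpret A: group A by fact
  interpret B: group B by fact
  define N where "N = sum_group (carrier B) (\<lambda>_. A)"
  interpret N: group N
    unfolding N_def using assms by (intro sum_group) auto
  have multN: "f \<otimes>\<^bsub>N\<^esub> f' = (\<lambda>x\<in>carrier B. f x \<otimes>\<^bsub>A\<^esub> f' x)" for f f'
    by (simp add: N_def)
  have oneN: "\<one>\<^bsub>N\<^esub> = (\<lambda>x\<in>carrier B. \<one>\<^bsub>A\<^esub>)"
    by (simp add: N_def)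
  have memN: "f x \<in> carrier A" if "f \<in> carrier N" "x \<in> carrier B" for f x
    using that assms by (auto simp: N_def carrier_sum_group)
  have extN: "f \<in> extensional (carrier B)" if "f \<in> carrier N" for f
    using that assms by (auto simp: N_def carrier_sum_group PiE_def)
  have shN: "shift B b f \<in> carrier N" if "b \<in> carrier B" "f \<in> carrier N" for b f
    using that shift_closed assms N_def by metis
  have sh_mult: "shift B b (f \<otimes>\<^bsub>N\<^esub> f') = shift B b f \<otimes>\<^bsub>N\<^esub> shift B b f'" if "b \<in> carrier B" for b f f'
    using that by (auto simp: multN shift_def fun_eq_iff)
  have sh_sh: "shift B b (shift B c f) = shift B (b \<otimes>\<^bsub>B\<^esub> c) f"
    if "b \<in> carrier B" "c \<in> carrier B" for b c f
    using that by (auto simp: shift_def fun_eq_iff B.inv_mult_group B.m_assoc)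
  have sh_one: "shift B \<one>\<^bsub>B\<^esub> f = f" if "f \<in> carrier N" for f
    using extN[OF that] by (auto simp: shift_def fun_eq_iff extensional_def)
  have sh_N1: "shift B b \<one>\<^bsub>N\<^esub> = \<one>\<^bsub>N\<^esub>" if "b \<in> carrier B" for b
    using that by (auto simp: shift_def oneN fun_eq_iff)
  have W: "wreath_product A B = \<lparr>carrier = carrier N \<times> carrier B,
       monoid.mult = (\<lambda>(f, b) (f', b'). (f \<otimes>\<^bsub>N\<^esub> shift B b f', b \<otimes>\<^bsub>B\<^esub> b')),
       one = (\<one>\<^bsub>N\<^esub>, \<one>\<^bsub>B\<^esub>)\<rparr>"
    by (simp add: wreath_product_def N_def Let_def)
  show ?thesis
    unfolding W
  proof (rule groupI, goal_cases)
    case (3 x y z)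
    then show ?case
      by (auto simp: sh_mult sh_sh shN N.m_assoc B.m_assoc split: prod.splits)
  next
    case (5 x)
    then obtain f b where x: "x = (f, b)" "f \<in> carrier N" "b \<in> carrier B" by auto
    let ?y = "(shift B (inv\<^bsub>B\<^esub> b) (inv\<^bsub>N\<^esub> f), inv\<^bsub>B\<^esub> b)"
    show ?case
      by (rule bexI[of _ ?y])
         (use x in \<open>auto simp: shN sh_mult [symmetric] sh_N1\<close>)
  qed (auto simp: shN sh_one)
qed

end

theory Submission
  imports Defs
begin

text \<open>
  If \<open>W = A \<wr> B\<close> has hereditary Property (FA), so has its quotient \<open>B\<close>, and a nonzero
  homomorphism \<open>A \<rightarrow> \<int>\<close> would extend to \<open>W\<close> by summing over the coordinates and make
  \<open>W\<close> translate a line.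

  Conversely let a finite-index subgroup \<open>H\<close> of \<open>W\<close> act on a tree. It contains a finitely
  generated subgroup \<open>K'\<close> of finite index generated by \<open>B\<^sub>0\<close>, of finite index in \<open>B\<close>, and
  by a group \<open>Q\<close> of functions supported in a finite set \<open>S\<close>. An element of \<open>B\<^sub>0\<close> that moves \<open>S\<close>
  off itself conjugates \<open>Q\<close> into its centralizer. A hyperbolic \<open>h \<in> Q\<close> is impossible, since
  its centralizer translates its axis and, \<open>A\<close> having finite abelianisation, a conjugate of \<open>h\<close>
  in that centralizer would have translation length zero. So \<open>Q\<close> fixes a vertex. Let \<open>v\<close> be fixed
  by \<open>B\<^sub>0\<close> and let \<open>p\<close> be the projection of \<open>v\<close> to the subtree fixed by \<open>Q\<close>. For displacing
  \<open>b \<in> B\<^sub>0\<close> the subtrees fixed by \<open>Q\<close> and \<open>b Q b\<^sup>-\<^sup>1\<close> meet and are equally far from \<open>v\<close>, so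
  the projections \<open>p\<close> and \<open>b p\<close> coincide. Displacing elements generate \<open>B\<^sub>0\<close>, so \<open>K'\<close> fixes \<open>p\<close>.
  Hence every element of \<open>H\<close> is elliptic, and \<open>H\<close>, being finitely generated, fixes a vertex.
\<close>

section \<open>Medians and the four-point inequality in simplicial trees\<close>

text \<open>Property (FA) of \<open>B\<close> yields a vertex fixed by \<open>B0\<close> and Serre's
  criterion one fixed by \<open>Q\<close>, but nothing makes them agree; the projection
  \<open>p\<close> bridges this gap. If \<open>w\<close> is fixed by \<open>Q\<close> and by its
  displaced conjugate, both projections lie on the geodesic from \<open>v\<close> to
  \<open>w\<close> at the same distance from \<open>v\<close>, so they are equal. \<open>Q\<close>
  must be finitely generated, since an infinitely generated group of elliptic isometries may fix
  only an end. Schreier generators of \<open>K'\<close> provide this, together with a finite support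
  \<open>S\<close> common to all of \<open>Q\<close>. The normal core is taken because normality
  forces the product of \<open>single y e\<close> and the inverse of a displaced copy of it into the
  subgroup, although \<open>single y e\<close> itself may lie outside. That \<open>B\<close> is
  infinite supplies displacing elements: only finitely many elements fail to move a finite set off
  itself. The geometry of isometries rests on integer distances, medians and the four-point
  inequality; paths and cycles serve to establish these. Excluding inversions keeps every fixed
  point at a vertex.\<close>

definition graph_dist :: "'v set set \<Rightarrow> 'v \<Rightarrow> 'v \<Rightarrow> nat" where
  "graph_dist E x y = (LEAST n. (x, y) \<in> {(u, v). {u, v} \<in> E} ^^ n)"

lemma graph_cycleI:
  assumes "distinct xs" "3 \<le> length xs" "successively (\<lambda>u v. {u, v} \<in> E) xs"
    and "{last xs, hd xs} \<in> E"
  shows "graph_cycle E xs"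
  unfolding graph_cycle_def
proof (intro conjI allI impI)
  fix i assume i: "i < length xs"
  have ne: "xs \<noteq> []" using assms(2) by auto
  show "{xs ! i, xs ! ((i + 1) mod length xs)} \<in> E"
  proof (cases "i + 1 = length xs")
    case True
    then have "i = length xs - 1" by simp
    then show ?thesis using assms(4) ne True by (simp add: last_conv_nth hd_conv_nth)
  next
    case False
    then show ?thesis using i assms(3) by (simp add: successively_conv_nth)
  qed
qed (use assms in auto)

text \<open>Model for the distance to a fixed vertex along a geodesic of a tree. With unit steps and
  no peak, a sequence that has begun to rise can never fall again, so it has slope 1 on either side
  of its minimum, attained at \<open>m\<close>.\<close>

lemma unimodal_int_seq:
  fixes L :: "nat \<Rightarrow> int"
  assumes step: "\<And>i. i < n \<Longrightarrow> \<bar>L (Suc i) - L i\<bar> = 1"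
    and nopeak: "\<And>i. Suc i < n \<Longrightarrow> \<not> (L i < L (Suc i) \<and> L (Suc (Suc i)) < L (Suc i))"
  shows "\<exists>m\<le>n. \<forall>i\<le>n. L i = L m + \<bar>int i - int m\<bar>"
proof -
  obtain m where m: "m \<le> n" "\<And>i. i \<le> n \<Longrightarrow> L m \<le> L i"
  proof -
    have "Min (L ` {..n}) \<in> L ` {..n}" by (rule Min_in) auto
    then obtain m where "m \<le> n" "L m = Min (L ` {..n})" by (metis atMost_iff imageE)
    then show thesis by (intro that[of m]) simp_all
  qed
  \<comment> \<open>Strong induction, because the absence of a peak involves three consecutive
    terms. The step next to \<open>m\<close> goes up since \<open>L m\<close> is minimal;
    \<open>down\<close> is the mirror image.\<close>
  have up: "m + j \<le> n \<Longrightarrow> L (m + j) = L m + int j" for j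
  proof (induction j rule: less_induct)
    case (less j)
    show ?case
    proof (cases j)
      case (Suc k)
      have k: "L (m + k) = L m + int k" using less Suc by simp
      have s: "\<bar>L (Suc (m + k)) - L (m + k)\<bar> = 1" using less Suc by (intro step) simp
      show ?thesis
      proof (cases k)
        case 0
        then show ?thesis using s k m(2)[of "m + j"] Suc less.prems by simp
      next
        case (Suc l)
        have "L (m + l) = L m + int l" using less Suc \<open>j = Suc k\<close> by simp
        then show ?thesis using nopeak[of "m + l"] s k Suc \<open>j = Suc k\<close> less.prems by simp
      qed
    qed simp
  qed
  have down: "j \<le> m \<Longrightarrow> L (m - j) = L m + int j" for j
  proof (induction j rule: less_induct)
    case (less j)
    show ?case
    proof (cases j)
      case (Suc k)
      have k: "L (m - k) = L m + int k" using less Suc by simp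
      have e: "Suc (m - j) = m - k" using Suc less.prems by simp
      have s: "\<bar>L (m - k) - L (m - j)\<bar> = 1" using step[of "m - j"] less Suc m(1) e by simp
      show ?thesis
      proof (cases k)
        case 0
        then show ?thesis using s k m(2)[of "m - j"] m(1) Suc less.prems by simp
      next
        case (Suc l)
        have "L (m - l) = L m + int l" using less Suc \<open>j = Suc k\<close> by simp
        moreover have "Suc (m - k) = m - l" using Suc \<open>j = Suc k\<close> less.prems by simp
        moreover have "\<not> (L (m - j) < L (m - k) \<and> L (m - l) < L (m - k))"
          using nopeak[of "m - j"] e \<open>Suc (m - k) = m - l\<close> m(1) Suc \<open>j = Suc k\<close> less.prems by simp
        ultimately show ?thesis using s k Suc \<open>j = Suc k\<close> by (simp add: abs_if split: if_splits)
      qed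
    qed simp
  qed
  show ?thesis
  proof (intro exI[of _ m] conjI allI impI m(1))
    fix i assume "i \<le> n"
    then show "L i = L m + \<bar>int i - int m\<bar>"
      using up[of "i - m"] down[of "m - i"] by (cases "m \<le> i") auto
  qed
qed

locale simplicial_tree_locale =
  fixes V :: "'v set" and E :: "'v set set"
  assumes tree: "simplicial_tree V E"
begin

abbreviation R where "R \<equiv> {(u, v). {u, v} \<in> E}"
abbreviation dist where "dist x y \<equiv> int (graph_dist E x y)"

lemma edgeD:
  assumes "{u, v} \<in> E"
  shows "u \<in> V \<and> v \<in> V \<and> u \<noteq> v"
proof -
  have "E \<subseteq> {{u, v} | u v. u \<in> V \<and> v \<in> V \<and> u \<noteq> v}"
    using tree by (simp add: simplicial_tree_def)
  then obtain x y where "{u, v} = {x, y}" "x \<in> V" "y \<in> V" "x \<noteq> y"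
    using assms by blast
  then show ?thesis by (auto simp: doubleton_eq_iff)
qed

lemma no_cycle: "\<not> graph_cycle E xs"
  using tree by (auto simp: simplicial_tree_def)

lemma relpow_dist:
  assumes "x \<in> V" "y \<in> V"
  shows "(x, y) \<in> R ^^ graph_dist E x y"
proof -
  have "(x, y) \<in> R\<^sup>*" using tree assms by (simp add: simplicial_tree_def)
  then obtain n where "(x, y) \<in> R ^^ n" by (meson rtrancl_imp_relpow)
  then show ?thesis unfolding graph_dist_def by (rule LeastI)
qed

lemma dist_le: "(x, y) \<in> R ^^ n \<Longrightarrow> dist x y \<le> int n"
  unfolding graph_dist_def by (simp add: Least_le)

lemma dist_self [simp]: "graph_dist E x x = 0"
  using dist_le[of x x 0] by simp

lemma dist_0D: "x \<in> V \<Longrightarrow> y \<in> V \<Longrightarrow> dist x y = 0 \<Longrightarrow> x = y"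
  using relpow_dist[of x y] by auto

lemma sym_relpow: "(x, y) \<in> R ^^ n \<Longrightarrow> (y, x) \<in> R ^^ n"
proof (induction n arbitrary: x y)
  case (Suc n)
  then obtain z where "(x, z) \<in> R ^^ n" "(z, y) \<in> R" by (meson relpow_Suc_E)
  then have "(z, x) \<in> R ^^ n" "(y, z) \<in> R" using Suc.IH by (auto simp: insert_commute)
  then show ?case by (intro relpow_Suc_I2)
qed simp

lemma dist_sym: "dist x y = dist y x"
  unfolding graph_dist_def using sym_relpow by metis

lemma dist_triangle:
  assumes "x \<in> V" "y \<in> V" "z \<in> V"
  shows "dist x z \<le> dist x y + dist y z"
proof -
  have "(x, z) \<in> R ^^ (graph_dist E x y + graph_dist E y z)"
    unfolding relpow_add using relpow_dist[of x y] relpow_dist[of y z] assms by (intro relcompI)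
  then show ?thesis using dist_le by fastforce
qed

lemma dist_edge: "{x, y} \<in> E \<Longrightarrow> dist x y = 1"
proof -
  assume e: "{x, y} \<in> E"
  have "dist x y \<le> 1" using dist_le[of x y 1] e by simp
  moreover have "dist x y \<noteq> 0" using e dist_0D edgeD by blast
  ultimately show ?thesis by linarith
qed

lemma edge_dist: "x \<in> V \<Longrightarrow> y \<in> V \<Longrightarrow> dist x y = 1 \<Longrightarrow> {x, y} \<in> E"
  using relpow_dist[of x y] by simp

text \<open>A shortcut between two vertices of a walk of minimal length would shorten the whole
  walk; hence distances along it are index differences.\<close>

lemma geodesic:
  assumes "x \<in> V" "y \<in> V"
  obtains f where "f 0 = x" "f (graph_dist E x y) = y"
    "\<And>i. i \<le> graph_dist E x y \<Longrightarrow> f i \<in> V"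
    "\<And>i. i < graph_dist E x y \<Longrightarrow> {f i, f (Suc i)} \<in> E"
    "\<And>i j. i \<le> graph_dist E x y \<Longrightarrow> j \<le> graph_dist E x y \<Longrightarrow>
       dist (f i) (f j) = \<bar>int i - int j\<bar>"
proof -
  define n where "n = graph_dist E x y"
  obtain f where f: "f 0 = x" "f n = y" "\<And>i. i < n \<Longrightarrow> {f i, f (Suc i)} \<in> E"
    using relpow_dist[OF assms] by (auto simp: relpow_fun_conv n_def)
  have V: "f i \<in> V" if "i \<le> n" for i
  proof (cases "i = n")
    case False
    then have "{f i, f (Suc i)} \<in> E" using that f by simp
    then show ?thesis using edgeD by blast
  qed (use f assms in simp)
  have ub: "i + k \<le> n \<Longrightarrow> dist (f i) (f (i + k)) \<le> int k" for i k
  proof (induction k)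
    case (Suc k)
    have "dist (f i) (f (i + Suc k)) \<le> dist (f i) (f (i + k)) + dist (f (i + k)) (f (Suc (i + k)))"
      using Suc.prems V by (auto intro!: dist_triangle)
    then show ?case using Suc dist_edge[OF f(3)[of "i + k"]] by simp
  qed simp
  have le: "dist (f i) (f j) = int j - int i" if "i \<le> j" "j \<le> n" for i j
  proof -
    have "int n \<le> dist x (f i) + dist (f i) y"
      using dist_triangle[of x "f i" y] assms V that by (simp add: n_def)
    also have "dist (f i) y \<le> dist (f i) (f j) + dist (f j) y"
      using assms V that by (auto intro!: dist_triangle)
    finally show ?thesis
      using ub[of 0 i] ub[of i "j - i"] ub[of j "n - j"] that f by simp
  qed
  have "dist (f i) (f j) = \<bar>int i - int j\<bar>" if "i \<le> n" "j \<le> n" for i j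
    using le[of i j] le[of j i] that dist_sym[of "f i" "f j"] by (cases "i \<le> j") auto
  then show thesis using that f V by (auto simp: n_def)
qed

lemma unit_step:
  assumes "x \<in> V" "y \<in> V" "x \<noteq> y"
  shows "\<exists>z\<in>V. dist x z = 1 \<and> dist z y = dist x y - 1"
proof -
  have n: "graph_dist E x y \<noteq> 0" using assms dist_0D by force
  obtain f where f: "f 0 = x" "f (graph_dist E x y) = y"
    "\<And>i. i \<le> graph_dist E x y \<Longrightarrow> f i \<in> V"
    "\<And>i j. i \<le> graph_dist E x y \<Longrightarrow> j \<le> graph_dist E x y \<Longrightarrow>
       dist (f i) (f j) = \<bar>int i - int j\<bar>"
    using geodesic[OF assms(1,2)] by metis
  then show ?thesis
    using n f(4)[of 0 1] f(4)[of 1 "graph_dist E x y"] by (intro bexI[of _ "f 1"]) auto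
qed

text \<open>Descend from \<open>u\<close> and from \<open>v\<close> towards \<open>z\<close> until
  the two descents merge. The bound on the distances keeps the path simple when a new outer layer is
  added, and keeps it away from any vertex farther from \<open>z\<close>.\<close>

lemma simple_path_below:
  assumes "u \<in> V" "v \<in> V" "z \<in> V" "u \<noteq> v" "dist u z = int k" "dist v z = int k"
  shows "\<exists>xs. distinct xs \<and> 3 \<le> length xs \<and> successively (\<lambda>u v. {u, v} \<in> E) xs \<and>
    hd xs = u \<and> last xs = v \<and> (\<forall>w\<in>set xs. dist w z \<le> int k)"
  using assms
proof (induction k arbitrary: u v)
  case 0
  then show ?case using dist_0D by (metis of_nat_0)
next
  case (Suc k)
  obtain u1 where u1: "u1 \<in> V" "dist u u1 = 1" "dist u1 z = int k"
    using unit_step[of u z] Suc.prems by fastforce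
  obtain v1 where v1: "v1 \<in> V" "dist v v1 = 1" "dist v1 z = int k"
    using unit_step[of v z] Suc.prems by fastforce
  have e: "{u, u1} \<in> E" "{v1, v} \<in> E"
    using u1 v1 Suc.prems edge_dist dist_sym[of v v1] by auto
  show ?case
  proof (cases "u1 = v1")
    case True
    moreover have "u \<noteq> u1" "v1 \<noteq> v" using edgeD e by blast+
    ultimately show ?thesis
      using e Suc.prems u1(3) by (intro exI[of _ "[u, u1, v]"]) simp
  next
    case False
    then obtain xs where xs: "distinct xs" "3 \<le> length xs" "successively (\<lambda>u v. {u, v} \<in> E) xs"
      "hd xs = u1" "last xs = v1" "\<forall>w\<in>set xs. dist w z \<le> int k"
      using Suc.IH[of u1 v1] Suc.prems u1 v1 by auto
    have ne: "xs \<noteq> []" using xs(2) by auto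
    have "u \<notin> set xs" "v \<notin> set xs" using xs(6) Suc.prems(5,6) by auto
    then have "distinct (u # xs @ [v])" using xs(1) Suc.prems(4) by simp
    moreover have "successively (\<lambda>u v. {u, v} \<in> E) (u # xs @ [v])"
      using xs(3-5) e ne by (simp add: successively_Cons successively_append_iff)
    moreover have "\<forall>w\<in>set (u # xs @ [v]). dist w z \<le> int (Suc k)"
      using xs(6) Suc.prems(5,6) by fastforce
    moreover have "3 \<le> length (u # xs @ [v])" "hd (u # xs @ [v]) = u" "last (u # xs @ [v]) = v"
      using xs(2) by simp_all
    ultimately show ?thesis by (intro exI[of _ "u # xs @ [v]"] conjI)
  qed
qed

text \<open>Bipartiteness of a tree: an edge with both ends equally far from \<open>z\<close> would
  close the path of \<open>simple_path_below\<close> to a cycle.\<close>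

lemma dist_edge_neq:
  assumes "{u, v} \<in> E" "z \<in> V"
  shows "dist u z \<noteq> dist v z"
proof
  assume "dist u z = dist v z"
  then obtain xs where "distinct xs" "3 \<le> length xs" "successively (\<lambda>u v. {u, v} \<in> E) xs"
      "hd xs = u" "last xs = v"
    using simple_path_below[of u v z] edgeD[OF assms(1)] assms(2) by blast
  then show False using no_cycle graph_cycleI[of xs E] assms(1) by (simp add: insert_commute)
qed

text \<open>Two different neighbours of \<open>u\<close> nearer to \<open>z\<close> are equally far
  from \<open>z\<close>, so a simple path joins them without getting as far from \<open>z\<close> as
  \<open>u\<close>; through \<open>u\<close> it closes to a cycle.\<close>

lemma predecessor_unique:
  assumes "{u, v} \<in> E" "{u, w} \<in> E" "z \<in> V" "dist v z < dist u z" "dist w z < dist u z"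
  shows "v = w"
proof (rule ccontr)
  assume ne: "v \<noteq> w"
  have V: "u \<in> V" "v \<in> V" "w \<in> V" using assms edgeD by auto
  have "dist u z \<le> dist v z + 1" "dist u z \<le> dist w z + 1"
    using dist_triangle[of u v z] dist_triangle[of u w z] assms V dist_edge by simp_all
  then have "dist v z = dist w z" using assms by linarith
  then obtain xs where xs: "distinct xs" "3 \<le> length xs" "successively (\<lambda>u v. {u, v} \<in> E) xs"
      "hd xs = v" "last xs = w" "\<forall>x\<in>set xs. dist x z \<le> dist v z"
    using simple_path_below[of v w z] V ne assms(3) by metis
  then have "graph_cycle E (u # xs)"
    using assms by (intro graph_cycleI) (auto simp: successively_Cons insert_commute)
  then show False using no_cycle by blast
qed

text \<open>The index \<open>m\<close> is the foot of \<open>w\<close> on the geodesic. Along the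
  geodesic the distance to \<open>w\<close> never stalls, by \<open>dist_edge_neq\<close>, and never
  peaks, by \<open>predecessor_unique\<close>.\<close>

lemma geodesic_projection:
  assumes "w \<in> V" and V: "\<And>i. i \<le> n \<Longrightarrow> f i \<in> V"
    and e: "\<And>i. i < n \<Longrightarrow> {f i, f (Suc i)} \<in> E"
    and d: "\<And>i j. i \<le> n \<Longrightarrow> j \<le> n \<Longrightarrow> dist (f i) (f j) = \<bar>int i - int j\<bar>"
  shows "\<exists>m\<le>n. \<forall>i\<le>n. dist (f i) w = dist (f m) w + \<bar>int i - int m\<bar>"
proof (rule unimodal_int_seq)
  fix i assume i: "i < n"
  have "dist (f i) w \<noteq> dist (f (Suc i)) w" using dist_edge_neq e i assms(1) by blast
  moreover have "dist (f i) w \<le> 1 + dist (f (Suc i)) w"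
    using dist_triangle[of "f i" "f (Suc i)" w] dist_edge[OF e[OF i]] i V assms(1) by simp
  moreover have "dist (f (Suc i)) w \<le> 1 + dist (f i) w"
    using dist_triangle[of "f (Suc i)" "f i" w] dist_edge[OF e[OF i]] i V assms(1)
      dist_sym[of "f i" "f (Suc i)"] by simp
  ultimately show "\<bar>dist (f (Suc i)) w - dist (f i) w\<bar> = 1" by linarith
next
  fix i assume i: "Suc i < n"
  have "f i \<noteq> f (Suc (Suc i))" using d[of i "Suc (Suc i)"] i by auto
  then show "\<not> (dist (f i) w < dist (f (Suc i)) w \<and> dist (f (Suc (Suc i))) w < dist (f (Suc i)) w)"
    using predecessor_unique[of "f (Suc i)" "f i" "f (Suc (Suc i))" w] e[of i] e[of "Suc i"] i assms(1)
    by (auto simp: insert_commute)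
qed

text \<open>The median is the foot of \<open>z\<close> on a geodesic from \<open>x\<close> to
  \<open>y\<close>.\<close>

lemma median:
  assumes "x \<in> V" "y \<in> V" "z \<in> V"
  shows "\<exists>m\<in>V. dist x y = dist x m + dist m y \<and> dist y z = dist y m + dist m z \<and>
    dist x z = dist x m + dist m z"
proof -
  obtain f where f: "f 0 = x" "f (graph_dist E x y) = y"
    "\<And>i. i \<le> graph_dist E x y \<Longrightarrow> f i \<in> V"
    "\<And>i. i < graph_dist E x y \<Longrightarrow> {f i, f (Suc i)} \<in> E"
    "\<And>i j. i \<le> graph_dist E x y \<Longrightarrow> j \<le> graph_dist E x y \<Longrightarrow>
       dist (f i) (f j) = \<bar>int i - int j\<bar>"
    using geodesic[OF assms(1,2)] by metis
  obtain m where m: "m \<le> graph_dist E x y"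
    "\<forall>i\<le>graph_dist E x y. dist (f i) z = dist (f m) z + \<bar>int i - int m\<bar>"
    using geodesic_projection[of z "graph_dist E x y" f] f assms by blast
  show ?thesis
    using m(2)[rule_format, of 0] m(2)[rule_format, of "graph_dist E x y"] f(5)[of 0 m] m(1)
      f(5)[of m "graph_dist E x y"] f(1-3) dist_sym[of y "f m"]
    by (intro bexI[of _ "f m"]) auto
qed

text \<open>A vertex \<open>u\<close> between \<open>x\<close> and \<open>y\<close> separates them,
  so at least one of them reaches \<open>w\<close> only through \<open>u\<close>. Which one depends
  on the side of \<open>u\<close> on which the foot of \<open>w\<close> lies.\<close>

lemma cut_point:
  assumes "x \<in> V" "y \<in> V" "u \<in> V" "w \<in> V" "dist x y = dist x u + dist u y"
  shows "dist x w = dist x u + dist u w \<or> dist y w = dist y u + dist u w"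
proof -
  obtain f where f: "f 0 = x" "f (graph_dist E x y) = y"
    "\<And>i. i \<le> graph_dist E x y \<Longrightarrow> f i \<in> V"
    "\<And>i. i < graph_dist E x y \<Longrightarrow> {f i, f (Suc i)} \<in> E"
    "\<And>i j. i \<le> graph_dist E x y \<Longrightarrow> j \<le> graph_dist E x y \<Longrightarrow>
       dist (f i) (f j) = \<bar>int i - int j\<bar>"
    using geodesic[OF assms(1,2)] by metis
  define n where "n = graph_dist E x y"
  note f = f[folded n_def]
  obtain k where k: "k \<le> n" "\<forall>i\<le>n. dist (f i) u = dist (f k) u + \<bar>int i - int k\<bar>"
    using geodesic_projection[of u n f] f assms by blast
  have "dist (f k) u = 0"
    using k(2)[rule_format, of 0] k(2)[rule_format, of n] f(1,2) assms(5) k(1) dist_sym[of u y]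
    by (simp add: n_def)
  then have u: "u = f k" using dist_0D f(3) k(1) assms(3) by metis
  obtain m where m: "m \<le> n" "\<forall>i\<le>n. dist (f i) w = dist (f m) w + \<bar>int i - int m\<bar>"
    using geodesic_projection[of w n f] f assms by blast
  show ?thesis
    using m(2)[rule_format, of 0] m(2)[rule_format, of k] m(2)[rule_format, of n]
      f(5)[of 0 k] f(5)[of n k] f(1,2) k(1) m(1) u by (cases "k \<le> m") auto
qed

text \<open>This is 0-hyperbolicity. By \<open>cut_point\<close>, at most one of the geodesics from
  \<open>x\<close>, \<open>y\<close>, \<open>z\<close> to \<open>w\<close> avoids the median
  \<open>m\<close> of \<open>x\<close>, \<open>y\<close>, \<open>z\<close>; in each case the
  distances through \<open>m\<close> give the bound.\<close>

lemma four_point: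
  assumes "x \<in> V" "y \<in> V" "z \<in> V" "w \<in> V"
  shows "dist x y + dist z w \<le> max (dist x z + dist y w) (dist x w + dist y z)"
proof -
  obtain m where m: "m \<in> V" "dist x y = dist x m + dist m y" "dist y z = dist y m + dist m z"
    "dist x z = dist x m + dist m z"
    using median[OF assms(1-3)] by blast
  have "dist z w \<le> dist z m + dist m w" "dist x w \<le> dist x m + dist m w"
    "dist y w \<le> dist y m + dist m w"
    using dist_triangle assms m(1) by blast+
  moreover have "dist x w = dist x m + dist m w \<or> dist y w = dist y m + dist m w"
    "dist x w = dist x m + dist m w \<or> dist z w = dist z m + dist m w"
    "dist y w = dist y m + dist m w \<or> dist z w = dist z m + dist m w"
    using cut_point assms m by blast+
  ultimately show ?thesis
    using m dist_sym[of m y] dist_sym[of m z] by linarith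
qed

end

section \<open>Isometries of trees\<close>

lemma antimono_int_eventually_constant:
  fixes f :: "nat \<Rightarrow> int"
  assumes dec: "\<And>n. f (Suc n) \<le> f n" and bound: "\<And>n. b \<le> f n"
  shows "\<exists>c N. \<forall>n\<ge>N. f n = c"
proof -
  obtain N where N: "\<And>n. nat (f N - b) \<le> nat (f n - b)"
    using ex_min_if_finite arg_min_nat_lemma[of "\<lambda>_. True" _ "\<lambda>n. nat (f n - b)"] by blast
  have "f N \<le> f n" for n using N[of n] bound[of n] bound[of N] by linarith
  moreover have "f n \<le> f N" if "N \<le> n" for n
    using lift_Suc_antimono_le[of f N n] dec that by blast
  ultimately show ?thesis by (meson order_antisym)
qed

text \<open>Interface between graphs and isometries: with these facts about the distance alone,
  arguments on group actions need no paths.\<close>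

locale tree_metric =
  fixes V :: "'v set" and d :: "'v \<Rightarrow> 'v \<Rightarrow> int"
  assumes nonempty: "V \<noteq> {}"
    and d_self [simp]: "d x x = 0"
    and d_0D: "x \<in> V \<Longrightarrow> y \<in> V \<Longrightarrow> d x y = 0 \<Longrightarrow> x = y"
    and d_sym: "d x y = d y x"
    and d_triangle: "x \<in> V \<Longrightarrow> y \<in> V \<Longrightarrow> z \<in> V \<Longrightarrow> d x z \<le> d x y + d y z"
    and d_step: "x \<in> V \<Longrightarrow> y \<in> V \<Longrightarrow> x \<noteq> y \<Longrightarrow> \<exists>z\<in>V. d x z = 1 \<and> d z y = d x y - 1"
    and d_median: "x \<in> V \<Longrightarrow> y \<in> V \<Longrightarrow> z \<in> V \<Longrightarrow>
      \<exists>m\<in>V. d x y = d x m + d m y \<and> d y z = d y m + d m z \<and> d x z = d x m + d m z"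
    and d_four_point: "x \<in> V \<Longrightarrow> y \<in> V \<Longrightarrow> z \<in> V \<Longrightarrow> w \<in> V \<Longrightarrow>
      d x y + d z w \<le> max (d x z + d y w) (d x w + d y z)"
begin

lemma d_nonneg: "x \<in> V \<Longrightarrow> y \<in> V \<Longrightarrow> 0 \<le> d x y"
  using d_triangle[of x y x] d_sym[of x y] by simp

text \<open>The perimeter is twice the sum of the distances to the median. In
  \<open>hyperbolic_axis\<close> this parity improves a strict inequality by a further unit.\<close>

lemma d_even_perimeter:
  assumes "x \<in> V" "y \<in> V" "z \<in> V"
  shows "even (d x y + d y z + d x z)"
proof -
  obtain m where "d x y = d x m + d m y" "d y z = d y m + d m z" "d x z = d x m + d m z"
    using d_median[OF assms] by blast
  then have "d x y + d y z + d x z = 2 * (d x m + d m y + d m z)" using d_sym[of y m] by simp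
  then show ?thesis by simp
qed

text \<open>The usual way below to show that an isometry fixes a vertex: a position on a geodesic is
  determined by the distance to one end. The four-point inequality for \<open>a\<close>,
  \<open>b\<close> against \<open>p\<close>, \<open>q\<close> leaves no room for a positive
  \<open>d p q\<close>.\<close>

lemma between_unique:
  assumes "a \<in> V" "b \<in> V" "p \<in> V" "q \<in> V"
    and "d a b = d a p + d p b" "d a b = d a q + d q b" "d a p = d a q"
  shows "p = q"
proof -
  have "d a b + d p q \<le> max (d a p + d b q) (d a q + d b p)"
    using d_four_point assms by blast
  then have "d p q \<le> 0" using assms d_sym[of b q] d_sym[of b p] by simp
  then show ?thesis using d_nonneg[of p q] d_0D assms by force
qed

definition convex :: "'v set \<Rightarrow> bool" where
  "convex C \<longleftrightarrow> C \<subseteq> V \<and> (\<forall>x\<in>C. \<forall>y\<in>C. \<forall>z\<in>V. d x y = d x z + d z y \<longrightarrow> z \<in> C)"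

lemma convexD: "convex C \<Longrightarrow> x \<in> C \<Longrightarrow> y \<in> C \<Longrightarrow> z \<in> V \<Longrightarrow> d x y = d x z + d z y \<Longrightarrow> z \<in> C"
  unfolding convex_def by blast

lemma convex_Int: "convex C \<Longrightarrow> convex D \<Longrightarrow> convex (C \<inter> D)"
  unfolding convex_def by blast

text \<open>Let \<open>p\<close> be a point of \<open>C\<close> nearest to \<open>v\<close>. The
  median of \<open>v\<close>, \<open>p\<close> and \<open>w\<close> lies in \<open>C\<close> by
  convexity and is no farther from \<open>v\<close> than \<open>p\<close>, so it is
  \<open>p\<close>.\<close>

lemma gate_exists:
  assumes "convex C" "C \<noteq> {}" "v \<in> V"
  obtains p where "p \<in> C" "\<And>w. w \<in> C \<Longrightarrow> d v w = d v p + d p w"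
proof -
  have CV: "C \<subseteq> V" using assms by (simp add: convex_def)
  obtain c where "c \<in> C" using assms by blast
  then obtain p where p: "p \<in> C" "\<And>w. w \<in> C \<Longrightarrow> nat (d v p) \<le> nat (d v w)"
    using arg_min_nat_lemma[of "\<lambda>w. w \<in> C" c "\<lambda>w. nat (d v w)"] by blast
  have "d v w = d v p + d p w" if w: "w \<in> C" for w
  proof -
    obtain m where m: "m \<in> V" "d v p = d v m + d m p" "d p w = d p m + d m w" "d v w = d v m + d m w"
      using d_median[of v p w] assms p(1) w CV by blast
    have mC: "m \<in> C" using convexD[OF assms(1) p(1) w m(1) m(3)] .
    then have "d v p \<le> d v m"
      using p(2)[OF mC] d_nonneg[of v p] d_nonneg[of v m] assms(3) p(1) m(1) CV by auto
    then have "d m p = 0" using m d_nonneg[of m p] p(1) CV by auto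
    then show ?thesis using d_0D[of m p] m p(1) CV by auto
  qed
  then show thesis using that p(1) by blast
qed

text \<open>The median of one point from each pairwise intersection lies between two points of each
  of the three sets.\<close>

lemma Helly3:
  assumes "convex A" "convex B" "convex C" "A \<inter> B \<noteq> {}" "A \<inter> C \<noteq> {}" "B \<inter> C \<noteq> {}"
  shows "A \<inter> B \<inter> C \<noteq> {}"
proof -
  obtain x y z where x: "x \<in> A" "x \<in> B" and y: "y \<in> A" "y \<in> C" and z: "z \<in> B" "z \<in> C"
    using assms by blast
  then have "x \<in> V" "y \<in> V" "z \<in> V" using assms(1,2) unfolding convex_def by blast+
  then obtain m where "m \<in> V" "d x y = d x m + d m y" "d y z = d y m + d m z" "d x z = d x m + d m z"
    using d_median by blast
  then have "m \<in> A" "m \<in> B" "m \<in> C" using x y z assms convexD by metis+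
  then show ?thesis by blast
qed

text \<open>Intersecting all sets with one of them keeps pairwise intersections nonempty, by
  \<open>Helly3\<close>; this drives the induction.\<close>

lemma Helly:
  assumes "finite I" "I \<noteq> {}" "\<And>i. i \<in> I \<Longrightarrow> convex (C i)"
    and "\<And>i j. i \<in> I \<Longrightarrow> j \<in> I \<Longrightarrow> C i \<inter> C j \<noteq> {}"
  shows "(\<Inter>i\<in>I. C i) \<noteq> {}"
  using assms
proof (induction I arbitrary: C rule: finite_ne_induct)
  case (insert i I)
  have "(\<Inter>j\<in>I. C j \<inter> C i) \<noteq> {}"
  proof (rule insert.IH)
    fix j k assume "j \<in> I" "k \<in> I"
    then have "C j \<inter> C k \<inter> C i \<noteq> {}" using insert.prems by (intro Helly3) simp_all
    then show "C j \<inter> C i \<inter> (C k \<inter> C i) \<noteq> {}" by blast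
  qed (use insert.prems convex_Int in auto)
  then show ?case using insert.hyps(2) by auto
qed auto

end

context group
begin

lemma commutes_pow:
  assumes "p \<in> carrier G" "h \<in> carrier G" "p \<otimes> h = h \<otimes> p"
  shows "p \<otimes> h [^] (n::nat) = h [^] n \<otimes> p"
proof (induction n)
  case (Suc n)
  have "p \<otimes> h [^] Suc n = h [^] n \<otimes> (p \<otimes> h)"
    using Suc assms(1,2) by (simp add: m_assoc [symmetric])
  also have "\<dots> = h [^] Suc n \<otimes> p" unfolding assms(3) using assms(1,2) by (simp add: m_assoc)
  finally show ?case .
qed (use assms in simp)

lemma subgroup_centralizer:
  assumes "subgroup H G" "h \<in> carrier G"
  shows "subgroup {p \<in> H. p \<otimes> h = h \<otimes> p} G"
proof (rule subgroupI)
  show "{p \<in> H. p \<otimes> h = h \<otimes> p} \<subseteq> carrier G" using subgroup.subset[OF assms(1)] by blast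
  show "{p \<in> H. p \<otimes> h = h \<otimes> p} \<noteq> {}"
    using subgroup.one_closed[OF assms(1)] assms(2) by force
next
  fix p assume "p \<in> {p \<in> H. p \<otimes> h = h \<otimes> p}"
  then have p: "p \<in> H" "p \<in> carrier G" "p \<otimes> h = h \<otimes> p"
    using subgroup.mem_carrier[OF assms(1)] by auto
  have "inv p \<otimes> h \<otimes> p = h \<otimes> inv p \<otimes> p"
    using p(2) assms(2) by (simp add: m_assoc p(3) [symmetric])
      (simp add: m_assoc [symmetric])
  then have "inv p \<otimes> h = h \<otimes> inv p" using p(2) assms(2) by simp
  then show "inv p \<in> {p \<in> H. p \<otimes> h = h \<otimes> p}"
    using p(1) subgroup.m_inv_closed[OF assms(1)] by simp
next
  fix p q assume "p \<in> {p \<in> H. p \<otimes> h = h \<otimes> p}" "q \<in> {p \<in> H. p \<otimes> h = h \<otimes> p}"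
  then have p: "p \<in> H" "p \<in> carrier G" "p \<otimes> h = h \<otimes> p"
    and q: "q \<in> H" "q \<in> carrier G" "q \<otimes> h = h \<otimes> q"
    using subgroup.mem_carrier[OF assms(1)] by auto
  have "p \<otimes> q \<otimes> h = p \<otimes> (q \<otimes> h)" using p(2) q(2) assms(2) by (simp add: m_assoc)
  also have "\<dots> = p \<otimes> h \<otimes> q" unfolding q(3) using p(2) q(2) assms(2) by (simp add: m_assoc)
  also have "\<dots> = h \<otimes> (p \<otimes> q)" unfolding p(3) using p(2) q(2) assms(2) by (simp add: m_assoc)
  finally show "p \<otimes> q \<in> {p \<in> H. p \<otimes> h = h \<otimes> p}"
    using p(1) q(1) subgroup.m_closed[OF assms(1)] by simp
qed

end

text \<open>The acting group is a subset \<open>H\<close> of an ambient group, so that its subgroups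
  act through the same \<open>\<phi>\<close> with the same operations. Nothing is assumed about
  \<open>\<phi>\<close> outside \<open>H\<close> and \<open>V\<close>.\<close>

locale tree_isometries = tree_metric V d + group G
  for V :: "'v set" and d :: "'v \<Rightarrow> 'v \<Rightarrow> int" and G (structure) +
  fixes H :: "'a set" and \<phi> :: "'a \<Rightarrow> 'v \<Rightarrow> 'v"
  assumes subgroup: "subgroup H G"
    and act_closed [simp]: "g \<in> H \<Longrightarrow> x \<in> V \<Longrightarrow> \<phi> g x \<in> V"
    and act_mult: "g \<in> H \<Longrightarrow> h \<in> H \<Longrightarrow> x \<in> V \<Longrightarrow> \<phi> (g \<otimes> h) x = \<phi> g (\<phi> h x)"
    and act_one [simp]: "x \<in> V \<Longrightarrow> \<phi> \<one> x = x"
    and act_isometry: "g \<in> H \<Longrightarrow> x \<in> V \<Longrightarrow> y \<in> V \<Longrightarrow> d (\<phi> g x) (\<phi> g y) = d x y"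
    and no_inversion: "g \<in> H \<Longrightarrow> x \<in> V \<Longrightarrow> y \<in> V \<Longrightarrow> d x y = 1 \<Longrightarrow> \<phi> g x = y \<Longrightarrow> \<phi> g y \<noteq> x"
begin

lemma H_carrier: "g \<in> H \<Longrightarrow> g \<in> carrier G"
  using subgroup subgroup.mem_carrier by metis

lemma H_mult [simp]: "g \<in> H \<Longrightarrow> h \<in> H \<Longrightarrow> g \<otimes> h \<in> H"
  using subgroup subgroup.m_closed by metis

lemma H_inv [simp]: "g \<in> H \<Longrightarrow> inv g \<in> H"
  using subgroup subgroup.m_inv_closed by metis

lemma H_one [simp]: "\<one> \<in> H"
  using subgroup subgroup.one_closed by metis

lemma H_pow [simp]: "g \<in> H \<Longrightarrow> g [^] (n::nat) \<in> H"
  by (induction n) simp_all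

lemma act_inv [simp]: "g \<in> H \<Longrightarrow> x \<in> V \<Longrightarrow> \<phi> (inv g) (\<phi> g x) = x"
  using act_mult[of "inv g" g x] H_carrier by simp

lemma act_inv' [simp]: "g \<in> H \<Longrightarrow> x \<in> V \<Longrightarrow> \<phi> g (\<phi> (inv g) x) = x"
  using act_mult[of g "inv g" x] H_carrier by simp

definition fixset :: "'a set \<Rightarrow> 'v set" where
  "fixset S = {x \<in> V. \<forall>g\<in>S. \<phi> g x = x}"

text \<open>An isometry fixing both ends of a geodesic fixes its vertices, by
  \<open>between_unique\<close>.\<close>

lemma fixset_convex: "S \<subseteq> H \<Longrightarrow> convex (fixset S)"
  unfolding convex_def
proof (intro conjI ballI impI)
  fix x y z assume S: "S \<subseteq> H" and x: "x \<in> fixset S" and y: "y \<in> fixset S" and z: "z \<in> V"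
    and e: "d x y = d x z + d z y"
  have "\<phi> g z = z" if g: "g \<in> S" for g
  proof (rule between_unique[of x y])
    have gH: "g \<in> H" using g S by blast
    have xy: "x \<in> V" "y \<in> V" "\<phi> g x = x" "\<phi> g y = y" using x y g by (auto simp: fixset_def)
    show "d x (\<phi> g z) = d x z" "d x y = d x (\<phi> g z) + d (\<phi> g z) y"
      using act_isometry[OF gH, of x z] act_isometry[OF gH, of z y] xy z e by simp_all
    show "x \<in> V" "y \<in> V" "\<phi> g z \<in> V" using xy gH z by simp_all
  qed fact+
  then show "z \<in> fixset S" using z by (simp add: fixset_def)
qed (auto simp: fixset_def)

lemma fixset_generate:
  assumes "S \<subseteq> H"
  shows "fixset (generate G S) = fixset S"
proof
  show "fixset (generate G S) \<subseteq> fixset S" by (auto simp: fixset_def generate.incl)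
  show "fixset S \<subseteq> fixset (generate G S)"
  proof
    fix x assume x: "x \<in> fixset S"
    have "g \<in> H \<and> \<phi> g x = x" if "g \<in> generate G S" for g
      using that
    proof induction
      case (inv h)
      then have "h \<in> H" "\<phi> h x = x" "x \<in> V" using x assms by (auto simp: fixset_def)
      then show ?case using act_inv[of h x] by simp
    qed (use x assms act_mult in \<open>auto simp: fixset_def\<close>)
    then show "x \<in> fixset (generate G S)" using x by (simp add: fixset_def)
  qed
qed

text \<open>If \<open>a b\<close> fixes \<open>z\<close>, the midpoint of \<open>z\<close> and \<open>b z\<close> is a vertex fixed by both
  \<open>a\<close> and \<open>b\<close>: it is the median of these two points with any fixed vertex of \<open>a\<close> or \<open>b\<close>.\<close>

lemma common_fixed_point_of_two:
  assumes "a \<in> H" "b \<in> H" and "fixset {a} \<noteq> {}" "fixset {b} \<noteq> {}" "fixset {a \<otimes> b} \<noteq> {}"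
  shows "fixset {a} \<inter> fixset {b} \<noteq> {}"
proof -
  obtain p q z where p: "p \<in> V" "\<phi> a p = p" and q: "q \<in> V" "\<phi> b q = q"
    and z: "z \<in> V" "\<phi> (a \<otimes> b) z = z"
    using assms by (auto simp: fixset_def)
  define z' where "z' = \<phi> b z"
  have z': "z' \<in> V" "\<phi> a z' = z" using z assms by (simp_all add: z'_def act_mult)
  have dp: "d z p = d z' p" using act_isometry[of a z' p] assms z' p by simp
  have dq: "d z q = d z' q" using act_isometry[of b z q] assms z q z'_def by simp
  obtain m where m: "m \<in> V" "d z z' = d z m + d m z'" "d z' q = d z' m + d m q" "d z q = d z m + d m q"
    using d_median z z' q by blast
  obtain m' where m': "m' \<in> V" "d z z' = d z m' + d m' z'" "d z' p = d z' m' + d m' p"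
    "d z p = d z m' + d m' p"
    using d_median z z' p by blast
  have "m = m'"
    using dp dq m m' d_sym[of m z'] d_sym[of m' z'] by (intro between_unique[of z z']) (use z z' in auto)
  note m' = m'[folded this]
  \<comment> \<open>The element \<open>b\<close> maps the geodesic from \<open>q\<close> to
    \<open>z\<close> to the one from \<open>q\<close> to \<open>z'\<close>; the vertex
    \<open>m\<close> lies on both, equally far from \<open>q\<close>.\<close>
  have "\<phi> b m = m"
  proof (rule between_unique[of q z'])
    show "d q z' = d q (\<phi> b m) + d (\<phi> b m) z'" "d q z' = d q m + d m z'" "d q (\<phi> b m) = d q m"
      using act_isometry[of b q m] act_isometry[of b m z] m assms q z dp dq
        d_sym[of q m] d_sym[of q z'] d_sym[of z' m] d_sym[of z m] by (simp_all add: z'_def)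
  qed (use q z' m assms in auto)
  moreover have "\<phi> a m = m"
  proof (rule between_unique[of p z])
    show "d p z = d p (\<phi> a m) + d (\<phi> a m) z" "d p z = d p m + d m z" "d p (\<phi> a m) = d p m"
      using act_isometry[of a p m] act_isometry[of a m z'] m' assms p z' dp dq
        d_sym[of p m] d_sym[of p z] d_sym[of z' m] d_sym[of z m] by simp_all
  qed (use p z m assms in auto)
  ultimately show ?thesis using m(1) by (auto simp: fixset_def)
qed

text \<open>Serre's criterion. Generators and their pairwise products are elliptic, so any two
  generators share a fixed vertex, and the Helly property of the finitely many fixed subtrees gives
  one common to all.\<close>

lemma fixed_point_of_elliptic_fg:
  assumes "finite S" "S \<subseteq> H" and ell: "\<And>g. g \<in> generate G S \<Longrightarrow> fixset {g} \<noteq> {}"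
  shows "fixset (generate G S) \<noteq> {}"
proof (cases "S = {}")
  case True
  then show ?thesis using nonempty by (simp add: fixset_generate) (simp add: fixset_def)
next
  case False
  have "(\<Inter>g\<in>S. fixset {g}) \<noteq> {}"
  proof (rule Helly)
    fix g h assume "g \<in> S" "h \<in> S"
    then show "fixset {g} \<inter> fixset {h} \<noteq> {}"
      using assms(2) by (intro common_fixed_point_of_two ell) (auto intro: generate.intros)
  qed (use assms False fixset_convex in auto)
  moreover have "(\<Inter>g\<in>S. fixset {g}) = fixset S" using False by (auto simp: fixset_def)
  ultimately show ?thesis using assms(2) fixset_generate by simp
qed

text \<open>Elements of \<open>P\<close> preserve the subtree fixed by \<open>Q\<close>, because
  they commute with \<open>Q\<close>. Hence they fix the projection to it of any vertex
  \<open>w\<close> that they fix.\<close>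

lemma commuting_fixed_points:
  assumes "Q \<subseteq> H" "P \<subseteq> H" "fixset Q \<noteq> {}" "fixset P \<noteq> {}"
    and comm: "\<And>q p. q \<in> Q \<Longrightarrow> p \<in> P \<Longrightarrow> q \<otimes> p = p \<otimes> q"
  shows "fixset Q \<inter> fixset P \<noteq> {}"
proof -
  obtain w where w: "w \<in> V" "\<And>p. p \<in> P \<Longrightarrow> \<phi> p w = w" using assms by (auto simp: fixset_def)
  obtain c where c: "c \<in> fixset Q" and gate: "\<And>x. x \<in> fixset Q \<Longrightarrow> d w x = d w c + d c x"
    using gate_exists[OF fixset_convex[OF assms(1)] assms(3) w(1)] by blast
  have cV: "c \<in> V" using c by (simp add: fixset_def)
  have "\<phi> p c = c" if p: "p \<in> P" for p
  proof -
    have pH: "p \<in> H" using p assms by blast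
    have "\<phi> q (\<phi> p c) = \<phi> p c" if q: "q \<in> Q" for q
    proof -
      have "q \<in> H" "\<phi> q c = c" using q assms c by (auto simp: fixset_def)
      then show ?thesis
        using act_mult[of q p c] act_mult[of p q c] comm[OF q p] pH cV by simp
    qed
    then have "\<phi> p c \<in> fixset Q" using cV pH by (simp add: fixset_def)
    then have "d w (\<phi> p c) = d w c + d c (\<phi> p c)" by (rule gate)
    moreover have "d w (\<phi> p c) = d w c" using act_isometry[of p w c] w p pH cV by simp
    ultimately show ?thesis using d_0D[of c "\<phi> p c"] cV pH by simp
  qed
  then show ?thesis using c cV by (auto simp: fixset_def)
qed

lemma gate_fixed_by_displacing:
  assumes "Q \<subseteq> H" "b \<in> H" "v \<in> V" "\<phi> b v = v" "p \<in> fixset Q"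
    and gate: "\<And>w. w \<in> fixset Q \<Longrightarrow> d v w = d v p + d p w"
    and comm: "\<And>q r. q \<in> Q \<Longrightarrow> r \<in> Q \<Longrightarrow> (b \<otimes> q \<otimes> inv b) \<otimes> r = r \<otimes> (b \<otimes> q \<otimes> inv b)"
  shows "\<phi> b p = p"
proof -
  let ?P = "(\<lambda>q. b \<otimes> q \<otimes> inv b) ` Q"
  have pV: "p \<in> V" using assms by (simp add: fixset_def)
  have "\<phi> (b \<otimes> q \<otimes> inv b) (\<phi> b p) = \<phi> b p" if "q \<in> Q" for q
    using that assms pV by (auto simp: act_mult fixset_def)
  then have "\<phi> b p \<in> fixset ?P" using pV assms(2) by (auto simp: fixset_def)
  then obtain w where w: "w \<in> fixset Q" "w \<in> fixset ?P"
    using commuting_fixed_points[of Q ?P] assms comm by fastforce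
  have wV: "w \<in> V" using w by (simp add: fixset_def)
  \<comment> \<open>Pulling \<open>w\<close> back by \<open>b\<close> gives a vertex of
    \<open>fixset Q\<close>. The gate property of \<open>p\<close> applied there and moved forward
    by \<open>b\<close> puts \<open>\<phi> b p\<close> between \<open>v\<close> and
    \<open>w\<close>.\<close>
  have "\<phi> q (\<phi> (inv b) w) = \<phi> (inv b) w" if q: "q \<in> Q" for q
  proof -
    have qH: "q \<in> H" using q assms by blast
    have "\<phi> (b \<otimes> q \<otimes> inv b) w = w" using w q by (auto simp: fixset_def)
    then have "\<phi> (inv b) (\<phi> b (\<phi> q (\<phi> (inv b) w))) = \<phi> (inv b) w"
      using qH assms(2) wV by (simp add: act_mult)
    then show ?thesis using qH assms(2) wV by simp
  qed
  then have "\<phi> (inv b) w \<in> fixset Q" using wV assms by (simp add: fixset_def)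
  then have e: "d v (\<phi> (inv b) w) = d v p + d p (\<phi> (inv b) w)" by (rule gate)
  have shift: "d x (\<phi> (inv b) w) = d (\<phi> b x) w" if "x \<in> V" for x
    using act_isometry[of b x "\<phi> (inv b) w"] that wV assms(2) by simp
  show ?thesis
  proof (rule between_unique[of v w])
    show "d v w = d v (\<phi> b p) + d (\<phi> b p) w" "d v (\<phi> b p) = d v p"
      using e shift assms(3,4) pV act_isometry[of b v p] assms(2) by simp_all
    show "d v w = d v p + d p w" using gate w by blast
  qed (use assms pV wV in auto)
qed

lemma act_pow_Suc:
  assumes "h \<in> H" "x \<in> V"
  shows "\<phi> (h [^] Suc n) x = \<phi> h (\<phi> (h [^] n) x)"
  using assms act_mult[of h "h [^] n" x] H_carrier nat_pow_Suc2[of h n] by simp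

text \<open>A vertex of minimal displacement lies on the axis. The exclusion of inversions is needed
  when the minimum is \<open>1\<close>.\<close>

lemma hyperbolic_axis:
  assumes h: "h \<in> H" and nofix: "fixset {h} = {}"
  obtains x l where "x \<in> V" "0 < l" "\<And>n. d x (\<phi> (h [^] (n::nat)) x) = int n * l"
proof -
  obtain x0 where "x0 \<in> V" using nonempty by blast
  then obtain x where x: "x \<in> V" and x_min: "\<And>y. y \<in> V \<Longrightarrow> nat (d x (\<phi> h x)) \<le> nat (d y (\<phi> h y))"
    using arg_min_nat_lemma[of "\<lambda>w. w \<in> V" x0 "\<lambda>w. nat (d w (\<phi> h w))"] by blast
  then have min: "d x (\<phi> h x) \<le> d y (\<phi> h y)" if "y \<in> V" for y
  proof -
    have "nat (d x (\<phi> h x)) \<le> nat (d y (\<phi> h y))" using that by (rule x_min)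
    then show ?thesis using d_nonneg[of y "\<phi> h y"] that h by simp
  qed
  define l where "l = d x (\<phi> h x)"
  define x1 where "x1 = \<phi> h x"
  define x2 where "x2 = \<phi> h x1"
  have V12: "x1 \<in> V" "x2 \<in> V" using x h by (simp_all add: x1_def x2_def)
  have ne: "\<phi> h y \<noteq> y" if "y \<in> V" for y using nofix that by (auto simp: fixset_def)
  have nex: "x1 \<noteq> x" using ne[OF x] by (simp add: x1_def)
  have "l \<noteq> 0" using d_0D[of x x1] ne[OF x] x V12 by (auto simp: l_def x1_def)
  then have l: "0 < l" using d_nonneg[of x x1] x V12 by (simp add: l_def x1_def)
  have l12: "d x1 x2 = l" using act_isometry[of h x x1] h x V12 by (simp add: x2_def l_def x1_def)
  have l01: "d x x1 = l" by (simp add: l_def x1_def)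
  \<comment> \<open>No backtracking at \<open>x1\<close>. Otherwise the geodesics from
    \<open>x1\<close> to \<open>x\<close> and to \<open>x2\<close> share their first edge;
    \<open>y\<close> and \<open>y'\<close> are the neighbours of \<open>x\<close> and
    \<open>x1\<close> on the segment between them, and \<open>h\<close> would carry \<open>y\<close>
    to \<open>y'\<close>.\<close>
  have two: "d x x2 = 2 * l"
  proof (rule ccontr)
    assume "d x x2 \<noteq> 2 * l"
    then have "d x x2 < 2 * l" using d_triangle[of x x1 x2] x V12 l12 l01 by simp
    moreover have "even (l + l + d x x2)" using d_even_perimeter[of x x1 x2] x V12 l01 l12 by simp
    ultimately have small: "d x x2 \<le> 2 * l - 2" by presburger
    obtain y where y: "y \<in> V" "d x y = 1" "d y x1 = l - 1"
      using d_step[of x x1] x V12 nex l01 by auto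
    obtain y' where y': "y' \<in> V" "d x1 y' = 1" "d y' x = l - 1"
      using d_step[of x1 x] x V12 nex l01 d_sym[of x x1] by auto
    have hy: "d x1 (\<phi> h y) = 1" "d (\<phi> h y) x2 = l - 1"
      using act_isometry[of h x y] act_isometry[of h y x1] x y h V12 by (simp_all add: x1_def x2_def)
    \<comment> \<open>The shared segment from \<open>x1\<close> to \<open>m\<close> has length at
      least 1. Both \<open>y'\<close> and \<open>\<phi> h y\<close> are the vertex at distance 1
      from \<open>x1\<close> on it; the auxiliary claim shows this for the first step towards any
      \<open>z\<close> beyond \<open>m\<close>.\<close>
    have eq: "\<phi> h y = y'"
    proof -
      obtain m where m: "m \<in> V" "d x1 x = d x1 m + d m x" "d x x2 = d x m + d m x2" "d x1 x2 = d x1 m + d m x2"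
        using d_median[of x1 x x2] x V12 by blast
      have m1: "1 \<le> d x1 m" using m small l01 l12 d_sym[of x1 x] d_sym[of m x] by linarith
      have *: "d x1 m = 1 + d u m" if u: "u \<in> V" "d x1 u = 1" "d u z = l - 1" 
        and z: "z \<in> V" "d x1 z = l" "d x1 z = d x1 m + d m z" for u z
      proof -
        have "d x1 z + d u m \<le> max (d x1 u + d z m) (d x1 m + d z u)"
          using d_four_point V12 u z m(1) by blast
        moreover have "d x1 m \<le> d x1 u + d u m" using d_triangle V12 u m(1) by blast
        ultimately show ?thesis using u z m1 d_sym[of z m] d_sym[of z u] by linarith
      qed
      have "d x1 m = 1 + d y' m" using *[of y' x] y' x l01 d_sym[of x1 x] m by simp
      moreover have "d x1 m = 1 + d (\<phi> h y) m" using *[of "\<phi> h y" x2] y hy h V12 l12 m by simp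
      ultimately show ?thesis
        using y h y' V12 m hy by (intro between_unique[of x1 m]) simp_all
    qed
    show False
    \<comment> \<open>For \<open>l = 1\<close> the element \<open>h\<close> would swap
      \<open>x\<close> and \<open>x1\<close>, an inversion. For larger \<open>l\<close> the
      displacement of \<open>y\<close> would be at most \<open>l - 2\<close>, against
      minimality.\<close>
    proof (cases "l = 1")
      case True
      have "d x x2 = 0" using small True d_nonneg[of x x2] x V12 by simp
      then have "x2 = x" using d_0D[of x x2] x V12 by simp
      moreover have "\<phi> h x1 \<noteq> x"
        using l01 True by (intro no_inversion[OF h x V12(1)]) (simp_all only: x1_def)
      ultimately show False by (simp add: x2_def)
    next
      case False
      have "d x x1 + d y y' \<le> max (d x y + d x1 y') (d x y' + d x1 y)"
        using d_four_point x V12 y y' by blast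
      moreover have "l \<le> d y y'" using min[OF y(1)] eq by (simp add: l_def)
      ultimately show False
        using l False l01 y(2,3) y'(2,3) d_sym[of x y'] d_sym[of x1 y] by linarith
    qed
  qed
  define s where "s n = \<phi> (h [^] n) x" for n :: nat
  have sV: "s n \<in> V" for n using h x by (simp add: s_def)
  have s_Suc: "s (Suc n) = \<phi> h (s n)" for n
    unfolding s_def by (rule act_pow_Suc[OF h x])
  have shift: "d (s (Suc i)) (s (Suc j)) = d (s i) (s j)" for i j
    by (simp add: s_Suc act_isometry h sV)
  have s012: "s 0 = x" "s 1 = x1" "s 2 = x2"
    using h x H_carrier by (simp_all add: s_def x1_def x2_def act_mult numeral_2_eq_2)
  have step: "d (s n) (s (Suc n)) = l \<and> d (s n) (s (Suc (Suc n))) = 2 * l" for n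
    by (induction n) (use shift s012 l01 two in \<open>auto simp: numeral_2_eq_2\<close>)
  \<comment> \<open>Local straightness implies global straightness: the four-point inequality
    extends the segment from \<open>x\<close> through the last two orbit points by one more step of
    length \<open>l\<close>. Hence two consecutive values are carried along.\<close>
  have "d x (s n) = int n * l \<and> d x (s (Suc n)) = int (Suc n) * l" for n
  proof (induction n)
    case 0
    then show ?case using s012 l01 by simp
  next
    case (Suc n)
    have "d x (s (Suc n)) + d (s n) (s (Suc (Suc n)))
        \<le> max (d x (s n) + d (s (Suc n)) (s (Suc (Suc n)))) (d x (s (Suc (Suc n))) + d (s (Suc n)) (s n))"
      using d_four_point x sV by blast
    moreover have "d x (s (Suc (Suc n))) \<le> d x (s (Suc n)) + d (s (Suc n)) (s (Suc (Suc n)))"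
      using d_triangle x sV by blast
    ultimately show ?case using Suc step[of n] step[of "Suc n"] l d_sym[of "s (Suc n)" "s n"]
      by (simp add: algebra_simps)
  qed
  then show thesis using that[of x l] x l by (simp add: s_def)
qed

text \<open>A fixed vertex \<open>z\<close> of \<open>g [^] m\<close> bounds the displacement of
  \<open>x\<close> under all powers of \<open>g [^] m\<close> by \<open>2 * d x z\<close>, whereas
  the powers of a hyperbolic element move a vertex of its axis arbitrarily far.\<close>

lemma elliptic_if_power_elliptic:
  assumes "g \<in> H" "0 < (m::nat)" "fixset {g [^] m} \<noteq> {}"
  shows "fixset {g} \<noteq> {}"
proof
  assume "fixset {g} = {}"
  then obtain x l where x: "x \<in> V" "0 < l" "\<And>n. d x (\<phi> (g [^] (n::nat)) x) = int n * l"
    using hyperbolic_axis assms(1) by blast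
  obtain z where z: "z \<in> V" "\<phi> (g [^] m) z = z" using assms by (auto simp: fixset_def)
  have fix_n: "\<phi> ((g [^] m) [^] (n::nat)) z = z" for n
  proof (induction n)
    case (Suc n)
    show ?case using act_pow_Suc[of "g [^] m" z n] Suc z assms(1) by simp
  qed (use z in simp)
  define n where "n = nat (2 * d x z) + 1"
  let ?k = "(g [^] m) [^] n"
  have k: "?k \<in> H" using assms by simp
  have "d x (\<phi> ?k x) \<le> d x z + d z (\<phi> ?k x)" using d_triangle x z k act_closed by blast
  also have "d z (\<phi> ?k x) = d x z" using act_isometry[OF k z(1) x(1)] fix_n d_sym[of x z] by simp
  finally have "int (m * n) * l \<le> 2 * d x z"
    using x(3)[of "m * n"] nat_pow_pow[of g m n] H_carrier[OF assms(1)] by simp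
  moreover have "int n \<le> int (m * n) * l"
  proof -
    have "n \<le> m * n" using assms(2) by simp
    then have "int n \<le> int (m * n) * 1" by linarith
    moreover have "int (m * n) * 1 \<le> int (m * n) * l" using x(2) by (intro mult_left_mono) auto
    ultimately show ?thesis by linarith
  qed
  ultimately show False using d_nonneg[of x z] x z by (simp add: n_def)
qed

text \<open>\<open>\<tau> p\<close> is the eventual value of \<open>d x (h\<^sup>n p x) - d x (h\<^sup>n x)\<close>, a Busemann
  function for the end of the axis of \<open>h\<close>, which the centralizer of \<open>h\<close> fixes.\<close>

lemma translation_hom:
  assumes h: "h \<in> H" and nofix: "fixset {h} = {}"
  defines "C \<equiv> {p \<in> H. p \<otimes> h = h \<otimes> p}"
  obtains x and \<tau> :: "'a \<Rightarrow> int" where "x \<in> V"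
    "\<And>p q. p \<in> C \<Longrightarrow> q \<in> C \<Longrightarrow> \<tau> (p \<otimes> q) = \<tau> p + \<tau> q"
    "\<And>p. p \<in> C \<Longrightarrow> \<tau> p = 0 \<Longrightarrow> \<phi> p x = x"
proof -
  obtain x l where x: "x \<in> V" and l: "0 < l" and ax: "\<And>n. d x (\<phi> (h [^] (n::nat)) x) = int n * l"
    using hyperbolic_axis h nofix by blast
  have CH: "p \<in> H" "p \<in> carrier G" if "p \<in> C" for p using that H_carrier by (auto simp: C_def)
  have hc: "h \<in> carrier G" using h H_carrier by blast
  have comm: "p \<otimes> h [^] n = h [^] n \<otimes> p" if p: "p \<in> C" for p and n :: nat
    using p by (intro commutes_pow CH hc) (auto simp: C_def)
  have C: "subgroup C G" unfolding C_def by (rule subgroup_centralizer[OF subgroup hc])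
  note Cmult = subgroup.m_closed[OF C] and Cone = subgroup.one_closed[OF C]
    and Cinv = subgroup.m_inv_closed[OF C]
  define f where "f p n = d x (\<phi> (h [^] n) (\<phi> p x)) - int n * l" for p and n :: nat
  have "\<exists>c N. \<forall>n\<ge>N. f p n = c" if p: "p \<in> C" for p
  proof (rule antimono_int_eventually_constant)
    have pV: "\<phi> p x \<in> V" using p CH x by simp
    fix n
    have "d x (\<phi> (h [^] Suc n) (\<phi> p x)) \<le> d x (\<phi> h x) + d (\<phi> h x) (\<phi> (h [^] Suc n) (\<phi> p x))"
      using d_triangle[of x "\<phi> h x" "\<phi> (h [^] Suc n) (\<phi> p x)"] x h pV by (simp del: nat_pow_Suc)
    also have "d (\<phi> h x) (\<phi> (h [^] Suc n) (\<phi> p x)) = d x (\<phi> (h [^] n) (\<phi> p x))"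
      using act_isometry[of h x "\<phi> (h [^] n) (\<phi> p x)"] act_pow_Suc[OF h pV, of n] x h pV by simp
    also have "d x (\<phi> h x) = l" using ax[of 1] hc by simp
    finally show "f p (Suc n) \<le> f p n" by (simp add: f_def algebra_simps)
    have "d x (\<phi> (h [^] n) x) \<le> d x (\<phi> (h [^] n) (\<phi> p x)) + d (\<phi> (h [^] n) (\<phi> p x)) (\<phi> (h [^] n) x)"
      using d_triangle[of x "\<phi> (h [^] n) (\<phi> p x)" "\<phi> (h [^] n) x"] x h pV by simp
    then show "- d (\<phi> p x) x \<le> f p n"
      using act_isometry[of "h [^] n" "\<phi> p x" x] x h pV ax[of n] by (simp add: f_def)
  qed
  then obtain \<tau> N where \<tau>: "\<And>p n. p \<in> C \<Longrightarrow> N p \<le> n \<Longrightarrow> f p n = \<tau> p"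
    by metis
  have hom: "\<tau> (p \<otimes> q) = \<tau> p + \<tau> q" if p: "p \<in> C" and q: "q \<in> C" for p q
  proof -
    \<comment> \<open>The four points are \<open>x\<close> and its image under \<open>inv p\<close>,
      and, far along the axis, the images of \<open>x\<close> under \<open>h [^] n\<close> and
      \<open>h [^] n \<otimes> q\<close>. Of the three sums of opposite distances, one is
      \<open>D\<close> and the others are \<open>2 * (int n * l)\<close> plus
      \<open>\<tau> (p \<otimes> q)\<close> or \<open>\<tau> p + \<tau> q\<close>. As
      \<open>n\<close> makes \<open>D\<close> smaller than both, the two large sums must
      agree.\<close>
    define D where "D = d x (\<phi> (inv p) x) + d x (\<phi> q x)"
    define n where "n = N p + N q + N (p \<otimes> q) + nat (D + \<bar>\<tau> (p \<otimes> q)\<bar> + \<bar>\<tau> p + \<tau> q\<bar>) + 1"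
    have big: "D + \<bar>\<tau> (p \<otimes> q)\<bar> + \<bar>\<tau> p + \<tau> q\<bar> < int n * l"
    proof -
      have "int n * 1 \<le> int n * l" using l by (intro mult_left_mono) auto
      moreover have "D + \<bar>\<tau> (p \<otimes> q)\<bar> + \<bar>\<tau> p + \<tau> q\<bar> < int n" by (simp add: n_def)
      ultimately show ?thesis by linarith
    qed
    have fp: "f p n = \<tau> p" "f q n = \<tau> q" "f (p \<otimes> q) n = \<tau> (p \<otimes> q)"
      using p q Cmult by (auto intro!: \<tau> simp: n_def)
    let ?y = "\<phi> (inv p) x" and ?u = "\<phi> (h [^] n) x" and ?w = "\<phi> (h [^] n) (\<phi> q x)"
    have pH: "p \<in> H" "q \<in> H" using p q CH by auto
    have yV: "?y \<in> V" "?u \<in> V" "?w \<in> V" using pH x h by simp_all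
    have shift: "d ?y (\<phi> (h [^] n) z) = d x (\<phi> (h [^] n) (\<phi> p z))" if z: "z \<in> V" for z
    proof -
      have "d ?y (\<phi> (h [^] n) z) = d (\<phi> p ?y) (\<phi> p (\<phi> (h [^] n) z))"
        using act_isometry pH h z yV by simp
      also have "\<phi> p (\<phi> (h [^] n) z) = \<phi> (h [^] n) (\<phi> p z)"
        using comm[OF p, of n] pH h z by (simp add: act_mult [symmetric])
      finally show ?thesis using pH x by simp
    qed
    have yw: "d ?y ?w = int n * l + \<tau> (p \<otimes> q)"
      using shift[of "\<phi> q x"] fp(3) pH x by (simp add: f_def act_mult)
    have yu: "d ?y ?u = int n * l + \<tau> p" using shift[of x] fp(1) x by (simp add: f_def)
    have xw: "d x ?w = int n * l + \<tau> q" using fp(2) by (simp add: f_def)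
    have uw: "d ?u ?w = d x (\<phi> q x)" using act_isometry[of "h [^] n" x "\<phi> q x"] h x pH by simp
    have "d x ?u + d ?y ?w \<le> max (d x ?y + d ?u ?w) (d x ?w + d ?u ?y)"
      "d x ?w + d ?y ?u \<le> max (d x ?y + d ?w ?u) (d x ?u + d ?w ?y)"
      using d_four_point x yV by blast+
    then have "2 * (int n * l) + \<tau> (p \<otimes> q) \<le> max D (2 * (int n * l) + \<tau> p + \<tau> q)"
      "2 * (int n * l) + \<tau> p + \<tau> q \<le> max D (2 * (int n * l) + \<tau> (p \<otimes> q))"
      using yw yu xw uw ax[of n] d_sym[of ?u ?y] d_sym[of ?w ?u] d_sym[of ?w ?y]
      by (simp_all add: D_def algebra_simps)
    moreover have "0 \<le> int n * l" using l by simp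
    moreover have "D < int n * l + \<tau> (p \<otimes> q)" "D < int n * l + (\<tau> p + \<tau> q)" using big by linarith+
    ultimately show ?thesis unfolding le_max_iff_disj by linarith
  qed
  have "\<phi> p x = x" if p: "p \<in> C" and 0: "\<tau> p = 0" for p
  proof -
    have pH: "p \<in> H" using p CH by blast
    have "\<tau> (\<one> \<otimes> \<one>) = \<tau> \<one> + \<tau> \<one>" using hom Cone by blast
    then have one: "\<tau> \<one> = 0" by simp
    have "\<tau> (inv p \<otimes> p) = \<tau> (inv p) + \<tau> p" using hom p Cinv by blast
    then have \<tau>i: "\<tau> (inv p) = 0" using one 0 p CH by simp
    define n where "n = N p + N (inv p)"
    have fp: "f p n = 0" "f (inv p) n = 0"
      using p Cinv 0 \<tau>i \<tau>[of p n] \<tau>[of "inv p" n] by (auto simp: n_def)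
    let ?g = "h [^] n"
    have gH: "?g \<in> H" using h by simp
    \<comment> \<open>Both \<open>?u\<close> and \<open>?w\<close> have distance
      \<open>int n * l\<close> from each end of the segment from \<open>x\<close> to
      \<open>?t\<close>, of length \<open>2 * (int n * l)\<close>; so both are its midpoint. The
      distance from \<open>?w\<close> to \<open>?t\<close> comes from
      \<open>\<tau> (inv p) = 0\<close>.\<close>
    let ?u = "\<phi> ?g x" and ?w = "\<phi> ?g (\<phi> p x)" and ?t = "\<phi> ?g (\<phi> ?g x)"
    have V: "?u \<in> V" "?w \<in> V" "?t \<in> V" using gH x pH by simp_all
    have "d (\<phi> p x) ?u = d x (\<phi> (inv p) ?u)"
      using act_isometry[of p x "\<phi> (inv p) ?u"] pH x V by simp
    also have "\<phi> (inv p) ?u = \<phi> ?g (\<phi> (inv p) x)"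
      using comm[OF Cinv[OF p], of n] pH gH x by (simp add: act_mult [symmetric])
    finally have wt: "d ?w ?t = int n * l"
      using act_isometry[OF gH, of "\<phi> p x" ?u] fp(2) pH x V by (simp add: f_def)
    have ut: "d ?u ?t = int n * l" using act_isometry[OF gH x V(1)] ax[of n] by simp
    have "?t = \<phi> (h [^] (n + n)) x" using act_mult[OF gH gH x] hc by (simp add: nat_pow_mult)
    then have xt: "d x ?t = 2 * (int n * l)" using ax[of "n + n"] by (simp add: algebra_simps)
    have xw: "d x ?w = int n * l" using fp(1) by (simp add: f_def)
    have "d x ?t + d ?u ?w \<le> max (d x ?u + d ?t ?w) (d x ?w + d ?t ?u)"
      using d_four_point x V by blast
    then have "d ?u ?w \<le> 0"
      using ax[of n] wt ut xt xw d_sym[of ?t ?w] d_sym[of ?t ?u] by simp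
    then have "d x (\<phi> p x) \<le> 0" using act_isometry[OF gH, of x "\<phi> p x"] x pH by simp
    then show ?thesis using d_nonneg[of x "\<phi> p x"] d_0D[of x "\<phi> p x"] x pH by force
  qed
  then show thesis using that[of x \<tau>] x hom by blast
qed

end

section \<open>From actions on simplicial trees to isometries of the vertex metric\<close>

sublocale simplicial_tree_locale \<subseteq> tree_metric V "\<lambda>x y. int (graph_dist E x y)"
proof (rule tree_metric.intro)
  show "V \<noteq> {}" using tree by (simp add: simplicial_tree_def)
  show "dist x x = 0" for x by simp
qed (fact dist_0D dist_sym dist_triangle unit_step median four_point)+

text \<open>Maps preserving adjacency do not increase the length of walks; applied to an element and
  its inverse this gives an isometry.\<close>

lemma tree_isometries_of_action:
  assumes "group G" "subgroup H G" and T: "simplicial_tree V E"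
    and act: "tree_action (G\<lparr>carrier := H\<rparr>) V E \<phi>"
    and inv: "without_inversions (G\<lparr>carrier := H\<rparr>) E \<phi>"
  shows "tree_isometries V (\<lambda>x y. int (graph_dist E x y)) G H \<phi>"
proof -
  interpret T: simplicial_tree_locale V E by unfold_locales fact
  interpret G: group G by fact
  interpret \<phi>: group_action "G\<lparr>carrier := H\<rparr>" V \<phi> using act by (simp add: tree_action_def)
  note H = \<open>subgroup H G\<close>
  have cl: "\<phi> g x \<in> V" if "g \<in> H" "x \<in> V" for g x
    using \<phi>.element_image[of g x] that by simp
  have mult: "\<phi> (g \<otimes>\<^bsub>G\<^esub> h) x = \<phi> g (\<phi> h x)" if "g \<in> H" "h \<in> H" "x \<in> V" for g h x
    using \<phi>.composition_rule[of x g h] that by simp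
  have one: "\<phi> \<one>\<^bsub>G\<^esub> x = x" if "x \<in> V" for x
  proof -
    have "\<phi> \<one>\<^bsub>G\<^esub> = (\<lambda>x\<in>V. x)" using \<phi>.id_eq_one by simp
    then show ?thesis using that by simp
  qed
  have edge: "{\<phi> g u, \<phi> g v} \<in> E" if "g \<in> H" "{u, v} \<in> E" for g u v
    using act that T.edgeD[OF that(2)] by (simp add: tree_action_def)
  have relpow: "(\<phi> g x, \<phi> g y) \<in> T.R ^^ n" if g: "g \<in> H" and "(x, y) \<in> T.R ^^ n" for g x y n
    using that(2)
  proof (induction n arbitrary: y)
    case (Suc n)
    then obtain z where z: "(x, z) \<in> T.R ^^ n" "(z, y) \<in> T.R" by (meson relpow_Suc_E)
    have "(\<phi> g z, \<phi> g y) \<in> T.R" using edge[OF g] z(2) by simp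
    then show ?case using Suc.IH[OF z(1)] by (rule relpow_Suc_I[rotated])
  qed simp
  have le: "T.dist (\<phi> g x) (\<phi> g y) \<le> T.dist x y" if "g \<in> H" "x \<in> V" "y \<in> V" for g x y
    using T.dist_le[OF relpow[OF that(1) T.relpow_dist[OF that(2,3)]]] .
  have iso: "T.dist (\<phi> g x) (\<phi> g y) = T.dist x y" if g: "g \<in> H" and x: "x \<in> V" "y \<in> V" for g x y
  proof -
    have gi: "inv\<^bsub>G\<^esub> g \<in> H" using subgroup.m_inv_closed[OF H g] .
    have gc: "g \<in> carrier G" using subgroup.mem_carrier[OF H g] .
    have "\<phi> (inv\<^bsub>G\<^esub> g) (\<phi> g z) = z" if "z \<in> V" for z
      using mult[OF gi g that] gc one[OF that] by simp
    then show ?thesis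
      using le[OF g x] le[OF gi cl[OF g x(1)] cl[OF g x(2)]] x by simp
  qed
  have no_inv: "\<phi> g y \<noteq> x" if "g \<in> H" "x \<in> V" "y \<in> V" "T.dist x y = 1" "\<phi> g x = y" for g x y
    using inv T.edge_dist[OF that(2-4)] that(1,5) unfolding without_inversions_def by auto
  show ?thesis
    by (intro tree_isometries.intro tree_isometries_axioms.intro T.tree_metric_axioms
        G.group_axioms H cl mult one iso no_inv)
qed

section \<open>Subgroups of finite index\<close>

context group
begin

lemma coset_eqI:
  assumes "subgroup H G" "g \<in> carrier G" "h \<in> carrier G" "g \<otimes> inv h \<in> H"
  shows "H #> g = H #> h"
proof -
  have "g = g \<otimes> inv h \<otimes> h" using assms by (simp add: m_assoc)
  then have "g \<in> H #> h" using assms(4) unfolding r_coset_def by blast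
  then show ?thesis using repr_independence assms by blast
qed

lemma coset_eqD:
  assumes "subgroup H G" "g \<in> carrier G" "h \<in> carrier G" "H #> g = H #> h"
  shows "g \<otimes> inv h \<in> H"
proof -
  have "g \<in> H #> h" using rcos_self[OF assms(2,1)] assms(4) by simp
  then obtain k where "k \<in> H" "g = k \<otimes> h" unfolding r_coset_def by blast
  moreover have "k \<in> carrier G" using \<open>k \<in> H\<close> assms(1) subgroup.mem_carrier by metis
  ultimately show ?thesis using assms(3) by (simp add: m_assoc)
qed

text \<open>The form in which finite index is established below: an invariant \<open>f\<close> with
  finitely many values, each of which determines the coset.\<close>

lemma finite_rcosetsI:
  assumes H: "subgroup H G" and fin: "finite (f ` carrier G)"
    and eq: "\<And>g h. g \<in> carrier G \<Longrightarrow> h \<in> carrier G \<Longrightarrow> f g = f h \<Longrightarrow> g \<otimes> inv h \<in> H"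
  shows "finite (rcosets H)"
proof -
  define c where "c y = H #> (SOME g. g \<in> carrier G \<and> f g = y)" for y
  have "H #> g = c (f g)" if g: "g \<in> carrier G" for g
  proof -
    have "(SOME h. h \<in> carrier G \<and> f h = f g) \<in> carrier G \<and> f (SOME h. h \<in> carrier G \<and> f h = f g) = f g"
      by (rule someI[of _ g]) (use g in simp)
    then show ?thesis unfolding c_def using g eq by (intro coset_eqI[OF H]) simp_all
  qed
  then have "rcosets H \<subseteq> c ` f ` carrier G" unfolding RCOSETS_def by blast
  then show ?thesis using fin finite_subset by blast
qed

lemma finite_index_preimage:
  assumes \<pi>: "group_hom L G \<pi>" and H: "subgroup H G" and fin: "finite (rcosets H)"
  shows "subgroup {x \<in> carrier L. \<pi> x \<in> H} L" "finite (rcosets\<^bsub>L\<^esub> {x \<in> carrier L. \<pi> x \<in> H})"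
proof -
  interpret \<pi>: group_hom L G \<pi> by fact
  show sub: "subgroup {x \<in> carrier L. \<pi> x \<in> H} L"
    by (rule \<pi>.G.subgroupI)
      (use subgroup.one_closed[OF H] subgroup.m_closed[OF H] subgroup.m_inv_closed[OF H] in \<open>auto intro: \<pi>.G.one_closed\<close>)
  show "finite (rcosets\<^bsub>L\<^esub> {x \<in> carrier L. \<pi> x \<in> H})"
  proof (rule \<pi>.G.finite_rcosetsI[OF sub, of "\<lambda>x. H #> \<pi> x"])
    show "finite ((\<lambda>x. H #> \<pi> x) ` carrier L)"
      by (rule finite_subset[OF _ fin]) (auto intro!: rcosetsI subgroup.subset[OF H])
    fix g h assume "g \<in> carrier L" "h \<in> carrier L" "H #> \<pi> g = H #> \<pi> h"
    then show "g \<otimes>\<^bsub>L\<^esub> inv\<^bsub>L\<^esub> h \<in> {x \<in> carrier L. \<pi> x \<in> H}"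
      using coset_eqD[OF H, of "\<pi> g" "\<pi> h"] by simp
  qed
qed

lemma finite_index_infinite:
  assumes "subgroup H G" "finite (rcosets H)" "infinite (carrier G)"
  shows "infinite H"
proof
  assume "finite H"
  then have "finite C" if "C \<in> rcosets H" for C
    using that unfolding RCOSETS_def r_coset_def by auto
  then have "finite (\<Union>(rcosets H))" using assms(2) by blast
  then show False using rcosets_part_G[OF assms(1)] assms(3) by simp
qed

text \<open>Here \<open>K\<close> is the kernel of the action of \<open>G\<close> on the cosets of
  \<open>H\<close> by right multiplication, so the cosets of \<open>K\<close> are separated by
  permutations of a finite set.\<close>

lemma normal_core_finite_index:
  assumes H: "subgroup H G" and fin: "finite (rcosets H)"
  obtains K where "K \<lhd> G" "K \<subseteq> H" "finite (rcosets K)"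
proof -
  have Hc: "H \<subseteq> carrier G" using H subgroup.subset by blast
  define K where "K = {k \<in> carrier G. \<forall>C\<in>rcosets H. C #> k = C}"
  have Cc: "C \<subseteq> carrier G" if "C \<in> rcosets H" for C
    using rcosets_subset_PowG[OF H] that by blast
  have Cg: "C #> g \<in> rcosets H" if C: "C \<in> rcosets H" and g: "g \<in> carrier G" for C g
    using C g Hc by (auto simp: RCOSETS_def coset_mult_assoc)
  have inv: "C #> inv k = C" if "k \<in> K" "C \<in> rcosets H" for k C
  proof -
    have k: "k \<in> carrier G" "C #> k = C" using that by (simp_all add: K_def)
    have "C #> inv k = (C #> k) #> inv k" using k by simp
    also have "\<dots> = C" using k(1) Cc[OF that(2)] by (simp add: coset_mult_assoc)
    finally show ?thesis .
  qed
  have sub: "subgroup K G"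
  proof (rule subgroupI)
    show "K \<noteq> {}" using Cc by (auto simp: K_def intro!: exI[of _ \<one>])
    show "inv a \<in> K" if "a \<in> K" for a
      using inv[OF that] that by (simp add: K_def)
    show "a \<otimes> b \<in> K" if "a \<in> K" "b \<in> K" for a b
      using that Cc by (simp add: K_def coset_mult_assoc [symmetric])
  qed (simp add: K_def)
  have "x \<otimes> h \<otimes> inv x \<in> K" if x: "x \<in> carrier G" and h: "h \<in> K" for x h
  proof -
    have hc: "h \<in> carrier G" using h by (simp add: K_def)
    have "C #> (x \<otimes> h \<otimes> inv x) = C" if C: "C \<in> rcosets H" for C
    proof -
      have "C #> (x \<otimes> h \<otimes> inv x) = ((C #> x) #> h) #> inv x"
        using Cc[OF C] x hc by (simp add: coset_mult_assoc r_coset_subset_G m_assoc)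
      also have "(C #> x) #> h = C #> x" using h Cg[OF C x] by (simp add: K_def)
      also have "(C #> x) #> inv x = C" using Cc[OF C] x by (simp add: coset_mult_assoc)
      finally show ?thesis .
    qed
    then show ?thesis using x hc by (simp add: K_def)
  qed
  then have normal: "K \<lhd> G" using sub by (simp add: normal_inv_iff)
  have KH: "K \<subseteq> H"
  proof
    fix k assume k: "k \<in> K"
    have "H \<in> rcosets H" using rcosetsI[OF Hc one_closed] Hc by simp
    then have "H #> k = H" using k by (simp add: K_def)
    then show "k \<in> H" using coset_join1[OF _ _ H] k by (simp add: K_def)
  qed
  have "finite (rcosets K)"
  proof (rule finite_rcosetsI[OF sub, of "\<lambda>g. \<lambda>C\<in>rcosets H. C #> g"])
    show "finite ((\<lambda>g. \<lambda>C\<in>rcosets H. C #> g) ` carrier G)"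
      by (rule finite_subset[of _ "rcosets H \<rightarrow>\<^sub>E rcosets H"]) (use Cg fin in \<open>auto intro: finite_PiE\<close>)
    fix g h assume g: "g \<in> carrier G" and h: "h \<in> carrier G"
      and e: "(\<lambda>C\<in>rcosets H. C #> g) = (\<lambda>C\<in>rcosets H. C #> h)"
    have "C #> (g \<otimes> inv h) = C" if C: "C \<in> rcosets H" for C
    proof -
      have "C #> g = C #> h" using fun_cong[OF e, of C] C by simp
      then have "C #> (g \<otimes> inv h) = (C #> h) #> inv h"
        using Cc[OF C] g h by (simp add: coset_mult_assoc [symmetric])
      then show ?thesis using Cc[OF C] h by (simp add: coset_mult_assoc)
    qed
    then show "g \<otimes> inv h \<in> K" using g h by (simp add: K_def)
  qed
  then show thesis using that normal KH by blast
qed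

lemma normal_finite_index_exponent:
  assumes K: "K \<lhd> G" and fin: "finite (rcosets K)"
  obtains N where "0 < (N::nat)" "\<And>g. g \<in> carrier G \<Longrightarrow> g [^] N \<in> K"
proof -
  interpret K: normal K G by fact
  interpret Q: group "G Mod K" by (rule K.factorgroup_is_group)
  have fin': "finite (carrier (G Mod K))" using fin by (simp add: FactGroup_def)
  show thesis
  proof
    show "0 < order (G Mod K)" using fin' Q.order_gt_0_iff_finite by blast
    fix g assume g: "g \<in> carrier G"
    have "(K #> g) [^]\<^bsub>G Mod K\<^esub> order (G Mod K) = \<one>\<^bsub>G Mod K\<^esub>"
      using g by (intro Q.pow_order_eq_1) (simp add: carrier_FactGroup)
    then have "K #> (g [^] order (G Mod K)) = K" using g K.FactGroup_pow by simp
    then show "g [^] order (G Mod K) \<in> K"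
      using coset_join1 g K.subgroup_axioms by simp
  qed
qed

text \<open>The elements \<open>t C g\<close> measure how far the chosen coset representatives are
  from being carried to each other by \<open>g\<close>. The cocycle identity
  \<open>t C (g \<otimes> h) = t C g \<otimes> t (C #> g) h\<close> reduces them to those with
  \<open>g\<close> a generator or its inverse.\<close>

lemma Schreier:
  assumes S: "finite S" "S \<subseteq> carrier G" "generate G S = carrier G"
    and H: "subgroup H G" and fin: "finite (rcosets H)"
  obtains T where "finite T" "T \<subseteq> H" "generate G T = H"
proof -
  have Hc: "H \<subseteq> carrier G" using H subgroup.subset by blast
  have HH: "H \<in> rcosets H" using rcosetsI[OF Hc one_closed] Hc by simp
  \<comment> \<open>The coset \<open>H\<close> is represented by \<open>\<one>\<close>, which makes
    \<open>t H h = h\<close> for \<open>h\<close> in \<open>H\<close>.\<close>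
  define r where "r C = (if C = H then \<one> else SOME g. g \<in> C)" for C
  have Cc: "C \<subseteq> carrier G" if "C \<in> rcosets H" for C
    using rcosets_subset_PowG[OF H] that by blast
  have r: "r C \<in> carrier G \<and> H #> r C = C" if C: "C \<in> rcosets H" for C
  proof (cases "C = H")
    case False
    obtain g where g: "g \<in> carrier G" "C = H #> g" using C unfolding RCOSETS_def by blast
    then have "r C \<in> C" using rcos_self[OF g(1) H] False unfolding r_def by (auto intro: someI)
    then show ?thesis using repr_independence[of "r C" H g] g H Cc[OF C] by auto
  qed (use Hc in \<open>simp add: r_def\<close>)
  have Cg: "C #> g \<in> rcosets H" if C: "C \<in> rcosets H" and g: "g \<in> carrier G" for C g
    using C g Hc by (auto simp: RCOSETS_def coset_mult_assoc)
  define t where "t C g = r C \<otimes> g \<otimes> inv (r (C #> g))" for C g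
  have tH: "t C g \<in> H" if C: "C \<in> rcosets H" and g: "g \<in> carrier G" for C g
  proof -
    have "H #> (r C \<otimes> g) = H #> r (C #> g)"
      using r[OF C] r[OF Cg[OF C g]] g Hc by (simp add: coset_mult_assoc [symmetric])
    then show ?thesis unfolding t_def
      using r[OF C] r[OF Cg[OF C g]] g by (intro coset_eqD[OF H]) simp_all
  qed
  define T where "T = (\<lambda>(C, s). t C s) ` ((rcosets H) \<times> (S \<union> (\<lambda>s. inv s) ` S))"
  have TH: "T \<subseteq> H" using tH S(2) by (auto simp: T_def)
  have "t C g \<in> generate G T" if "g \<in> generate G S" "C \<in> rcosets H" for g C
    using that
  proof (induction arbitrary: C)
    case one
    then have "t C \<one> = \<one>" using r Cc by (simp add: t_def)
    then show ?case using generate.one by simp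
  next
    case (incl s)
    then show ?case by (intro generate.incl) (auto simp: T_def)
  next
    case (inv s)
    then show ?case by (intro generate.incl) (auto simp: T_def)
  next
    case (eng g h)
    have gh: "g \<in> carrier G" "h \<in> carrier G"
      using eng.hyps S generate_in_carrier by blast+
    have c: "r C \<in> carrier G" "r (C #> g) \<in> carrier G" "r (C #> (g \<otimes> h)) \<in> carrier G"
      using r Cg eng.prems gh by simp_all
    have "t C (g \<otimes> h) = t C g \<otimes> t (C #> g) h"
      using c gh Cc[OF eng.prems]
      by (simp add: t_def coset_mult_assoc m_assoc inv_solve_left)
    then show ?case using eng.IH eng.prems Cg gh generate.eng by metis
  qed
  then have "t H h \<in> generate G T" if "h \<in> H" for h
    using that HH S(3) Hc by blast
  moreover have "t H h = h" if h: "h \<in> H" for h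
    using that Hc coset_join2[OF _ H h] by (auto simp: t_def r_def)
  ultimately have "H \<subseteq> generate G T" by fastforce
  moreover have "generate G T \<subseteq> H" using generate_subgroup_incl[OF TH H] .
  moreover have "finite T" unfolding T_def using fin S(1) by blast
  ultimately show thesis using that TH by blast
qed

end

section \<open>Commutators with commuting corrections, and displacing elements\<close>

context group
begin

text \<open>The factors \<open>a\<close> and \<open>b\<close> commute with everything they must
  pass, so the commutator of \<open>u \<otimes> a\<close> and \<open>v \<otimes> b\<close> is that
  of \<open>u\<close> and \<open>v\<close>. It is multiplied out so that a homomorphism to an
  abelian group can be read off both sides.\<close>

lemma commutator_of_products:
  assumes c: "u \<in> carrier G" "v \<in> carrier G" "a \<in> carrier G" "b \<in> carrier G"
    and av: "a \<otimes> v = v \<otimes> a" and bu: "b \<otimes> u = u \<otimes> b" and ab: "a \<otimes> b = b \<otimes> a"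
  shows "(u \<otimes> v \<otimes> inv u \<otimes> inv v) \<otimes> ((v \<otimes> b) \<otimes> (u \<otimes> a)) = (u \<otimes> a) \<otimes> (v \<otimes> b)"
proof -
  have "(v \<otimes> b) \<otimes> (u \<otimes> a) = v \<otimes> (b \<otimes> u) \<otimes> a" using c by (simp add: m_assoc)
  also have "\<dots> = v \<otimes> u \<otimes> (b \<otimes> a)" unfolding bu using c by (simp add: m_assoc)
  finally have "(v \<otimes> b) \<otimes> (u \<otimes> a) = v \<otimes> u \<otimes> (a \<otimes> b)" unfolding ab .
  then have "(u \<otimes> v \<otimes> inv u \<otimes> inv v) \<otimes> ((v \<otimes> b) \<otimes> (u \<otimes> a)) =
      u \<otimes> v \<otimes> inv u \<otimes> (inv v \<otimes> v) \<otimes> u \<otimes> (a \<otimes> b)"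
    using c by (simp only: m_assoc m_closed inv_closed)
  also have "\<dots> = u \<otimes> v \<otimes> (inv u \<otimes> u) \<otimes> (a \<otimes> b)"
    using c by (simp only: l_inv r_one m_assoc m_closed inv_closed)
  also have "\<dots> = u \<otimes> (v \<otimes> a) \<otimes> b" using c by (simp add: m_assoc)
  also have "\<dots> = (u \<otimes> a) \<otimes> (v \<otimes> b)" unfolding av [symmetric] using c by (simp add: m_assoc)
  finally show ?thesis .
qed

lemma finite_nondisplacing:
  assumes "finite S" "finite T" "S \<subseteq> carrier G" "T \<subseteq> carrier G"
  shows "finite {b \<in> carrier G. (\<lambda>x. b \<otimes> x) ` S \<inter> T \<noteq> {}}"
proof (rule finite_subset)
  show "{b \<in> carrier G. (\<lambda>x. b \<otimes> x) ` S \<inter> T \<noteq> {}} \<subseteq> (\<lambda>(t, s). t \<otimes> inv s) ` (T \<times> S)"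
  proof
    fix b assume "b \<in> {b \<in> carrier G. (\<lambda>x. b \<otimes> x) ` S \<inter> T \<noteq> {}}"
    then obtain s where s: "b \<in> carrier G" "s \<in> S" "b \<otimes> s \<in> T" by blast
    then have "b = (b \<otimes> s) \<otimes> inv s" using assms(3) by (auto simp: m_assoc)
    then show "b \<in> (\<lambda>(t, s). t \<otimes> inv s) ` (T \<times> S)" using s by force
  qed
qed (use assms in blast)

end

section \<open>Homomorphisms to the integers\<close>

context comm_group
begin

lemma m_interchange:
  assumes "a \<in> carrier G" "b \<in> carrier G" "c \<in> carrier G"
    and "x \<in> carrier G" "y \<in> carrier G" "z \<in> carrier G"
  shows "(a \<otimes> b \<otimes> c) \<otimes> (x \<otimes> y \<otimes> z) = (a \<otimes> x) \<otimes> (b \<otimes> y) \<otimes> (c \<otimes> z)"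
  using assms by (simp add: m_ac)

lemma generate_insert_subgroup:
  assumes M: "subgroup M G" and s: "s \<in> carrier G" and g: "g \<in> generate G (insert s M)"
  shows "\<exists>m\<in>M. \<exists>i::int. g = m \<otimes> s [^] i"
  using g
proof induction
  have Mc: "M \<subseteq> carrier G" using M subgroup.subset by blast
  {
    case one
    show ?case using subgroup.one_closed[OF M] by (intro bexI[of _ \<one>] exI[of _ 0]) auto
  next
    case (incl h)
    then consider "h = s" | "h \<in> M" by blast
    then show ?case
    proof cases
      case 1
      then show ?thesis using s subgroup.one_closed[OF M]
        by (intro bexI[of _ \<one>] exI[of _ "1::int"]) simp_all
    next
      case 2
      then show ?thesis using Mc by (intro bexI[of _ h] exI[of _ "0::int"]) auto
    qed
  next
    case (inv h)
    then consider "h = s" | "h \<in> M" by blast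
    then show ?case
    proof cases
      case 1
      then show ?thesis using s subgroup.one_closed[OF M] int_pow_neg[of s 1]
        by (intro bexI[of _ \<one>] exI[of _ "-1::int"]) simp_all
    next
      case 2
      then show ?thesis using Mc subgroup.m_inv_closed[OF M]
        by (intro bexI[of _ "inv h"] exI[of _ "0::int"]) auto
    qed
  next
    case (eng g h)
    then obtain m n and i j :: int where m: "m \<in> M" "n \<in> M" "g = m \<otimes> s [^] i" "h = n \<otimes> s [^] j"
      by blast
    moreover have "m \<in> carrier G" "n \<in> carrier G" using m Mc by auto
    ultimately have "g \<otimes> h = (m \<otimes> n) \<otimes> s [^] (i + j)"
      using s by (simp add: int_pow_mult m_ac)
    then show ?case using m subgroup.m_closed[OF M] by blast
  }
qed

text \<open>Generators are added to \<open>M\<close> until the index becomes finite. For the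
  generator \<open>s\<close> that causes this, \<open>M1\<close> modulo \<open>M\<close> is infinite
  cyclic; a power \<open>N\<close> takes all of \<open>G\<close> into \<open>M1\<close>, and the
  exponent of \<open>s\<close> there is the homomorphism.\<close>

lemma infinite_index_int_hom:
  assumes "finite S" "S \<subseteq> carrier G" "subgroup M G" "generate G (M \<union> S) = carrier G"
    and "infinite (rcosets M)"
  shows "\<exists>\<tau>. (\<forall>x\<in>carrier G. \<forall>y\<in>carrier G. \<tau> (x \<otimes> y) = \<tau> x + \<tau> y) \<and> (\<exists>x\<in>carrier G. \<tau> x \<noteq> (0::int))"
  using assms
proof (induction S arbitrary: M rule: finite_induct)
  case empty
  have "carrier G \<subseteq> M"
    using generate_subgroup_incl[OF subset_refl empty.prems(2)] empty.prems(3) by simp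
  then have "M = carrier G" using subgroup.subset[OF empty.prems(2)] by blast
  then have "rcosets M \<subseteq> {carrier G}" using empty.prems(2) by (auto simp: RCOSETS_def coset_join2)
  then show ?case using empty.prems(4) finite_subset by blast
next
  case (insert s S)
  have Mc: "M \<subseteq> carrier G" using insert.prems subgroup.subset by blast
  have s: "s \<in> carrier G" using insert.prems by blast
  define M1 where "M1 = generate G (insert s M)"
  have M1: "subgroup M1 G" unfolding M1_def using Mc s by (intro generate_is_subgroup) blast
  have M1i: "insert s M \<subseteq> M1" unfolding M1_def by (intro subsetI generate.incl)
  show ?case
  proof (cases "finite (rcosets M1)")
    case False
    have "carrier G \<subseteq> generate G (M1 \<union> S)"
      unfolding insert.prems(3) [symmetric] using M1i by (intro mono_generate) blast
    moreover have "generate G (M1 \<union> S) \<subseteq> carrier G"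
      using subgroup.subset[OF M1] insert.prems(1) by (intro generate_incl) blast
    ultimately show ?thesis using insert.IH[of M1] insert.prems(1) M1 False by blast
  next
    case True
    note M = insert.prems(2)
    have no_pow: "s [^] k \<notin> M" if k: "0 < (k::nat)" for k
    proof
      assume sk: "s [^] k \<in> M"
      define r where "r C = (SOME x. x \<in> carrier G \<and> M1 #> x = C)" for C
      have r: "r (M1 #> g) \<in> carrier G \<and> M1 #> r (M1 #> g) = M1 #> g" if "g \<in> carrier G" for g
        unfolding r_def by (rule someI[of _ g]) (use that in simp)
      have "\<exists>m i. m \<in> M \<and> g = m \<otimes> s [^] (i::int) \<otimes> r (M1 #> g)" if g: "g \<in> carrier G" for g
      proof -
        have "g \<otimes> inv (r (M1 #> g)) \<in> M1" using coset_eqD[OF M1] r[OF g] g by metis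
        then obtain m and i :: int where "m \<in> M" "g \<otimes> inv (r (M1 #> g)) = m \<otimes> s [^] i"
          using generate_insert_subgroup[OF M s] unfolding M1_def by blast
        moreover have "g = g \<otimes> inv (r (M1 #> g)) \<otimes> r (M1 #> g)" using g r[OF g] by (simp add: m_assoc)
        ultimately show ?thesis by metis
      qed
      then obtain m i where mi: "\<And>g. g \<in> carrier G \<Longrightarrow> m g \<in> M"
        "\<And>g. g \<in> carrier G \<Longrightarrow> g = m g \<otimes> s [^] (i g :: int) \<otimes> r (M1 #> g)"
        by metis
      \<comment> \<open>If \<open>s [^] k\<close> were in \<open>M\<close>, the coset modulo
        \<open>M1\<close> and the exponent of \<open>s\<close> modulo \<open>k\<close> would
        determine the coset modulo \<open>M\<close>.\<close>
      have "finite (rcosets M)"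
      proof (rule finite_rcosetsI[OF M, of "\<lambda>g. (M1 #> g, i g mod int k)"])
        show "finite ((\<lambda>g. (M1 #> g, i g mod int k)) ` carrier G)"
          by (rule finite_subset[of _ "(rcosets M1) \<times> {0..<int k}"])
            (use k True in \<open>auto simp: RCOSETS_def\<close>)
        fix g h assume g: "g \<in> carrier G" and h: "h \<in> carrier G"
          and e: "(M1 #> g, i g mod int k) = (M1 #> h, i h mod int k)"
        then have "int k dvd i g - i h" by (simp add: mod_eq_dvd_iff)
        then obtain q where q: "i g - i h = int k * q" by blast
        have "s [^] (i g - i h) = (s [^] k) [^] q"
          unfolding q using int_pow_pow[OF s, of "int k" q] by (simp add: int_pow_int)
        also have "\<dots> \<in> M" using sk M subgroup_int_pow_closed by blast
        finally have sM: "s [^] (i g - i h) \<in> M" .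
        define \<rho> where "\<rho> = r (M1 #> h)"
        have \<rho>: "\<rho> \<in> carrier G" using r[OF h] by (simp add: \<rho>_def)
        have mc: "m g \<in> carrier G" "m h \<in> carrier G" using mi g h Mc by auto
        have ge: "g = m g \<otimes> s [^] i g \<otimes> \<rho>" and he: "h = m h \<otimes> s [^] i h \<otimes> \<rho>"
          using mi(2)[OF g] mi(2)[OF h] e by (simp_all add: \<rho>_def)
        have "inv h = inv (m h) \<otimes> inv (s [^] i h) \<otimes> inv \<rho>"
          using mc \<rho> s by (subst he) (simp add: inv_mult)
        then have "g \<otimes> inv h = (m g \<otimes> s [^] i g \<otimes> \<rho>) \<otimes> (inv (m h) \<otimes> inv (s [^] i h) \<otimes> inv \<rho>)"
          using ge by simp
        also have "\<dots> = m g \<otimes> inv (m h) \<otimes> (s [^] i g \<otimes> inv (s [^] i h)) \<otimes> (\<rho> \<otimes> inv \<rho>)"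
          using mc \<rho> s by (intro m_interchange) simp_all
        also have "\<dots> = m g \<otimes> inv (m h) \<otimes> s [^] (i g - i h)"
          using mc \<rho> s by (simp add: int_pow_diff)
        also have "\<dots> \<in> M"
          using mi(1) g h sM M by (simp add: subgroup.m_closed subgroup.m_inv_closed)
        finally show "g \<otimes> inv h \<in> M" .
      qed
      then show False using insert.prems(4) by blast
    qed
    have no_int_pow: "i = 0" if "s [^] (i::int) \<in> M" for i
    proof (rule ccontr)
      assume "i \<noteq> 0"
      then consider k where "0 < k" "i = int k" | k where "0 < k" "i = - int k"
        by (metis int_cases2 neq0_conv of_nat_0 neg_0_equal_iff_equal)
      then show False
      proof cases
        case 1
        then show ?thesis using that no_pow by (simp add: int_pow_int)
      next
        case 2
        then have "inv (s [^] k) \<in> M" using that int_pow_neg_int[OF s, of k] by simp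
        then have "inv (inv (s [^] k)) \<in> M" using M subgroup.m_inv_closed by metis
        then show ?thesis using no_pow 2 s by simp
      qed
    qed
    have unique: "i = j" if "m \<in> M" "n \<in> M" "m \<otimes> s [^] i = n \<otimes> s [^] j" for m n and i j :: int
    proof -
      have mn: "m \<in> carrier G" "n \<in> carrier G" using that Mc by auto
      have "s [^] (i - j) = inv m \<otimes> (m \<otimes> s [^] i) \<otimes> inv (s [^] j)"
        using mn s by (simp add: int_pow_diff m_assoc [symmetric])
      also have "\<dots> = inv m \<otimes> n" unfolding that(3) using mn s by (simp add: m_assoc)
      also have "\<dots> \<in> M" using that M by (simp add: subgroup.m_closed subgroup.m_inv_closed)
      finally show ?thesis using no_int_pow by fastforce
    qed
    \<comment> \<open>The value \<open>\<tau> g\<close> is the exponent of \<open>s\<close> in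
      \<open>g [^] N\<close>, determined because no nontrivial power of \<open>s\<close> lies in
      \<open>M\<close>. It is nonzero at \<open>s\<close>, where it equals \<open>N\<close>.\<close>
    have "M1 \<lhd> G" using M1 by (rule subgroup_imp_normal)
    then obtain N where N: "0 < N" "\<And>g. g \<in> carrier G \<Longrightarrow> g [^] (N::nat) \<in> M1"
      using normal_finite_index_exponent True by blast
    have "\<exists>i m. m \<in> M \<and> g [^] N = m \<otimes> s [^] (i::int)" if g: "g \<in> carrier G" for g
      using generate_insert_subgroup[OF M s, of "g [^] N"] N(2)[OF g] unfolding M1_def by blast
    then obtain \<tau> m where \<tau>: "\<And>g. g \<in> carrier G \<Longrightarrow> m g \<in> M"
      "\<And>g. g \<in> carrier G \<Longrightarrow> g [^] N = m g \<otimes> s [^] (\<tau> g :: int)"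
      by metis
    have "\<tau> (g \<otimes> h) = \<tau> g + \<tau> h" if g: "g \<in> carrier G" and h: "h \<in> carrier G" for g h
    proof (rule unique[of "m (g \<otimes> h)" "m g \<otimes> m h"])
      have mc: "m g \<in> carrier G" "m h \<in> carrier G" using \<tau>(1) g h Mc by auto
      have "m (g \<otimes> h) \<otimes> s [^] \<tau> (g \<otimes> h) = g [^] N \<otimes> h [^] N"
        using \<tau>(2)[of "g \<otimes> h"] g h by (simp add: nat_pow_distrib)
      also have "\<dots> = m g \<otimes> m h \<otimes> s [^] (\<tau> g + \<tau> h)"
        unfolding \<tau>(2)[OF g] \<tau>(2)[OF h] using mc s by (simp add: int_pow_mult m_ac)
      finally show "m (g \<otimes> h) \<otimes> s [^] \<tau> (g \<otimes> h) = m g \<otimes> m h \<otimes> s [^] (\<tau> g + \<tau> h)" .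
    qed (use \<tau>(1) g h subgroup.m_closed[OF M] in auto)
    moreover have "\<tau> s = int N"
    proof (rule unique[of "m s" \<one>])
      show "m s \<otimes> s [^] \<tau> s = \<one> \<otimes> s [^] int N" using \<tau>(2)[OF s, symmetric] s by (simp add: int_pow_int)
    qed (use \<tau>(1) s subgroup.one_closed[OF M] in auto)
    ultimately show ?thesis using s N(1) by (intro exI[of _ \<tau>]) force
  qed
qed

end

lemma infinite_abelianisation_int_hom:
  fixes A :: "('a, 'c) monoid_scheme"
  assumes "finitely_generated_group A" and inf: "infinite (carrier (abelianisation A))"
  obtains \<tau> :: "'a \<Rightarrow> int" where
    "\<And>x y. x \<in> carrier A \<Longrightarrow> y \<in> carrier A \<Longrightarrow> \<tau> (x \<otimes>\<^bsub>A\<^esub> y) = \<tau> x + \<tau> y"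
    "\<exists>x\<in>carrier A. \<tau> x \<noteq> 0"
proof -
  interpret A: group A using assms(1) by (simp add: finitely_generated_group_def)
  obtain S where S: "finite S" "S \<subseteq> carrier A" "generate A S = carrier A"
    using assms(1) by (auto simp: finitely_generated_group_def)
  define D where "D = derived A (carrier A)"
  define Q where "Q = A Mod D"
  interpret Q: comm_group Q unfolding Q_def D_def by (rule A.derived_quot_is_comm_group)
  interpret D: normal D A unfolding D_def by (rule A.derived_is_normal[OF A.normal_self])
  define \<pi> where "\<pi> = (\<lambda>x. D #>\<^bsub>A\<^esub> x)"
  have \<pi>: "\<pi> \<in> hom A Q" unfolding \<pi>_def Q_def by (rule D.r_coset_hom_Mod)
  interpret \<pi>: group_hom A Q \<pi> using \<pi> by unfold_locales
  have surj: "\<pi> ` carrier A = carrier Q" by (simp add: \<pi>_def Q_def carrier_FactGroup)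
  have gen: "generate Q (\<pi> ` S) = carrier Q"
    using \<pi>.generate_img[OF S(2)] S(3) surj by simp
  have \<pi>S: "finite (\<pi> ` S)" "\<pi> ` S \<subseteq> carrier Q" using S(1,2) by auto
  have triv: "subgroup {\<one>\<^bsub>Q\<^esub>} Q" by (rule Q.triv_subgroup)
  have "infinite (rcosets\<^bsub>Q\<^esub> {\<one>\<^bsub>Q\<^esub>})"
  proof
    assume f: "finite (rcosets\<^bsub>Q\<^esub> {\<one>\<^bsub>Q\<^esub>})"
    have "infinite (carrier Q)" using inf by (simp add: abelianisation_def Q_def D_def)
    from Q.finite_index_infinite[OF triv f this] show False by simp
  qed
  moreover have "generate Q ({\<one>\<^bsub>Q\<^esub>} \<union> \<pi> ` S) = carrier Q"
  proof
    show "generate Q ({\<one>\<^bsub>Q\<^esub>} \<union> \<pi> ` S) \<subseteq> carrier Q"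
      using S(2) by (intro Q.generate_incl) auto
    show "carrier Q \<subseteq> generate Q ({\<one>\<^bsub>Q\<^esub>} \<union> \<pi> ` S)"
      unfolding gen [symmetric] by (rule Q.mono_generate) blast
  qed
  ultimately obtain \<tau> :: "'a set \<Rightarrow> int" where
    \<tau>: "\<forall>x\<in>carrier Q. \<forall>y\<in>carrier Q. \<tau> (x \<otimes>\<^bsub>Q\<^esub> y) = \<tau> x + \<tau> y" "\<exists>x\<in>carrier Q. \<tau> x \<noteq> 0"
    using Q.infinite_index_int_hom[OF \<pi>S triv] by blast
  show thesis
  proof (rule that[of "\<lambda>x. \<tau> (\<pi> x)"])
    show "\<exists>x\<in>carrier A. \<tau> (\<pi> x) \<noteq> 0" using \<tau>(2) unfolding surj [symmetric] by simp
  qed (use \<tau>(1) in simp)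
qed

section \<open>Property (FA) for quotients and actions on a line\<close>

lemma property_FA_quotient:
  assumes \<pi>: "group_hom L G \<pi>" and surj: "\<pi> ` carrier L = carrier G"
    and FA: "property_FA TYPE('v) L"
  shows "property_FA TYPE('v) G"
  unfolding property_FA_def
proof (intro allI impI, elim conjE)
  fix V :: "'v set" and E \<phi>
  assume T: "simplicial_tree V E" and act: "tree_action G V E \<phi>" and inv: "without_inversions G E \<phi>"
  interpret \<pi>: group_hom L G \<pi> by fact
  interpret \<phi>: group_action G V \<phi> using act by (simp add: tree_action_def)
  have "\<phi> \<circ> \<pi> \<in> hom L (BijGroup V)"
    using \<pi>.homh \<phi>.group_hom group_hom.homh hom_compose by blast
  then have "group_action L V (\<phi> \<circ> \<pi>)"
    by (intro group_action.intro group_hom.intro group_hom_axioms.intro \<pi>.G.group_axioms group_BijGroup)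
  then have "tree_action L V E (\<phi> \<circ> \<pi>)" using act by (simp add: tree_action_def)
  moreover have "without_inversions L E (\<phi> \<circ> \<pi>)"
    using inv \<pi>.hom_closed unfolding without_inversions_def comp_def by blast
  ultimately obtain v where "v \<in> V" "\<forall>g\<in>carrier L. (\<phi> \<circ> \<pi>) g v = v"
    using FA T unfolding property_FA_def by blast
  then show "\<exists>v\<in>V. \<forall>g\<in>carrier G. \<phi> g v = v" unfolding surj [symmetric] by auto
qed

lemma simplicial_tree_line:
  fixes \<iota> :: "int \<Rightarrow> 'v"
  assumes "inj \<iota>"
  defines "E \<equiv> {{\<iota> k, \<iota> (k + 1)} | k. True}"
  shows "simplicial_tree (range \<iota>) E"
    and "{\<iota> i, \<iota> j} \<in> E \<longleftrightarrow> \<bar>i - j\<bar> = 1"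
proof -
  have inj: "\<iota> i = \<iota> j \<longleftrightarrow> i = j" for i j using assms(1) by (auto dest: injD)
  show edge: "{\<iota> i, \<iota> j} \<in> E \<longleftrightarrow> \<bar>i - j\<bar> = 1" for i j
  proof
    assume "{\<iota> i, \<iota> j} \<in> E"
    then show "\<bar>i - j\<bar> = 1" by (auto simp: E_def doubleton_eq_iff inj)
  next
    assume "\<bar>i - j\<bar> = 1"
    then have "j = i + 1 \<or> i = j + 1" by linarith
    then show "{\<iota> i, \<iota> j} \<in> E" by (auto simp: E_def insert_commute)
  qed
  have up: "(\<iota> i, \<iota> (i + int n)) \<in> {(x, y). {x, y} \<in> E}\<^sup>*" for i n
  proof (induction n)
    case (Suc n)
    have "(\<iota> (i + int n), \<iota> (i + int (Suc n))) \<in> {(x, y). {x, y} \<in> E}" by (simp add: edge)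
    then show ?case using Suc.IH by (rule rtrancl_into_rtrancl[rotated])
  qed simp
  have "sym ({(x, y). {x, y} \<in> E}\<^sup>*)"
    by (rule sym_rtrancl) (simp add: sym_def insert_commute)
  then have conn: "(\<iota> i, \<iota> j) \<in> {(x, y). {x, y} \<in> E}\<^sup>*" for i j
    using up[of i "nat (j - i)"] up[of j "nat (i - j)"] by (cases "i \<le> j") (auto dest: symD)
  have acyc: "\<not> graph_cycle E xs" for xs
  proof
    assume c: "graph_cycle E xs"
    define n where "n = length xs"
    have n: "3 \<le> n" and dist: "distinct xs"
      and e: "\<And>i. i < n \<Longrightarrow> {xs ! i, xs ! ((i + 1) mod n)} \<in> E"
      using c by (auto simp: graph_cycle_def n_def)
    have "\<exists>k. xs ! i = \<iota> k" if "i < n" for i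
      using e[OF that] by (auto simp: E_def doubleton_eq_iff)
    then obtain p where p: "\<And>i. i < n \<Longrightarrow> xs ! i = \<iota> (p i)" by metis
    have p_inj: "p i \<noteq> p j" if "i < n" "j < n" "i \<noteq> j" for i j
      using p that dist nth_eq_iff_index_eq[of xs i j] n_def by metis
    \<comment> \<open>On a cycle, both neighbours of a vertex with the largest coordinate would have
      to be the vertex just below it. The indices \<open>j\<close> and \<open>k\<close> are its
      cyclic successor and predecessor, different because the length is at least 3.\<close>
    have "Max (p ` {..<n}) \<in> p ` {..<n}" 
    proof (rule Max_in)
      show "p ` {..<n} \<noteq> {}" using n by (simp add: lessThan_empty_iff)
    qed simp
    then obtain i where i: "i < n" "p i = Max (p ` {..<n})" by auto
    have max: "p j \<le> p i" if "j < n" for j using that i by simp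
    define j where "j = (i + 1) mod n"
    define k where "k = (i + (n - 1)) mod n"
    have jk: "j < n" "k < n" using n by (auto simp: j_def k_def)
    have ki: "(k + 1) mod n = i"
    proof -
      have "(k + 1) mod n = (i + (n - 1) + 1) mod n" unfolding k_def by (simp add: mod_simps)
      also have "i + (n - 1) + 1 = i + n" using n by simp
      finally show ?thesis using i by simp
    qed
    have "j \<noteq> i" "k \<noteq> i"
      using n i by (auto simp: j_def k_def mod_if)
    moreover have "j \<noteq> k"
    proof
      assume "j = k"
      then have "((i + 1) mod n + 1) mod n = i" using ki by (simp add: j_def)
      then have "(i + 2) mod n = i" by (simp add: mod_Suc_eq)
      then show False using n i by (auto simp: mod_if split: if_splits)
    qed
    moreover have "\<bar>p i - p j\<bar> = 1" using e[OF i(1)] p i jk edge by (simp add: j_def)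
    moreover have "\<bar>p k - p i\<bar> = 1" using e[OF jk(2)] p i jk edge ki by simp
    ultimately show False using max[OF jk(1)] max[OF jk(2)] p_inj[OF jk] by linarith
  qed
  have "E \<subseteq> {{u, v} | u v. u \<in> range \<iota> \<and> v \<in> range \<iota> \<and> u \<noteq> v}"
  proof
    fix e assume "e \<in> E"
    then obtain k where "e = {\<iota> k, \<iota> (k + 1)}" by (auto simp: E_def)
    moreover have "\<iota> k \<noteq> \<iota> (k + 1)" by (simp add: inj)
    ultimately show "e \<in> {{u, v} | u v. u \<in> range \<iota> \<and> v \<in> range \<iota> \<and> u \<noteq> v}" by blast
  qed
  then show "simplicial_tree (range \<iota>) E"
    using conn acyc by (auto simp: simplicial_tree_def)
qed

text \<open>The group acts by translations on a line whose vertices are copied into the infinite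
  type \<open>'v\<close>. A translation never swaps two adjacent vertices, and it fixes a vertex
  only if it is trivial.\<close>

lemma not_FA_if_int_hom:
  assumes "group G" and inf: "infinite (UNIV :: 'v set)"
    and hom: "\<And>x y. x \<in> carrier G \<Longrightarrow> y \<in> carrier G \<Longrightarrow> \<tau> (x \<otimes>\<^bsub>G\<^esub> y) = \<tau> x + (\<tau> y :: int)"
    and nz: "\<exists>x\<in>carrier G. \<tau> x \<noteq> 0"
  shows "\<not> property_FA TYPE('v) G"
proof
  assume FA: "property_FA TYPE('v) G"
  interpret group G by fact
  obtain f :: "nat \<Rightarrow> 'v" where f: "inj f" using infinite_countable_subset[OF inf] by blast
  define \<iota> where "\<iota> k = f (to_nat (k :: int))" for k
  have inj: "inj \<iota>" unfolding \<iota>_def by (rule injI) (use f in \<open>auto dest!: injD\<close>)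
  have inj_iff: "\<iota> i = \<iota> j \<longleftrightarrow> i = j" for i j using inj by (auto dest: injD)
  define E where "E = {{\<iota> k, \<iota> (k + 1)} | k. True}"
  define V where "V = range \<iota>"
  note line = simplicial_tree_line[OF inj, folded E_def V_def]
  \<comment> \<open>Restricted to \<open>V\<close>, since elements of \<open>BijGroup V\<close> are
    extensional functions.\<close>
  define \<phi> where "\<phi> g = (\<lambda>v\<in>V. \<iota> (inv_into UNIV \<iota> v + \<tau> g))" for g
  have \<phi>: "\<phi> g (\<iota> k) = \<iota> (k + \<tau> g)" for g k
    using inj by (simp add: \<phi>_def V_def)
  have Bij: "\<phi> g \<in> Bij V" for g
  proof -
    have "inj_on (\<phi> g) V" by (auto simp: inj_on_def V_def \<phi> inj_iff)
    moreover have "\<phi> g ` V = V"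
    proof
      show "V \<subseteq> \<phi> g ` V"
      proof
        fix v assume "v \<in> V"
        then obtain k where "v = \<iota> k" by (auto simp: V_def)
        then have "v = \<phi> g (\<iota> (k - \<tau> g))" by (simp add: \<phi>)
        then show "v \<in> \<phi> g ` V" by (simp add: V_def)
      qed
    qed (auto simp: V_def \<phi>)
    ultimately show ?thesis by (simp add: Bij_def bij_betw_def \<phi>_def)
  qed
  have "\<phi> (g \<otimes>\<^bsub>G\<^esub> h) = compose V (\<phi> g) (\<phi> h)" if "g \<in> carrier G" "h \<in> carrier G" for g h
  proof (rule extensionalityI[of _ V])
    fix v assume "v \<in> V"
    then obtain k where "v = \<iota> k" by (auto simp: V_def)
    then show "\<phi> (g \<otimes>\<^bsub>G\<^esub> h) v = compose V (\<phi> g) (\<phi> h) v"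
      using that \<open>v \<in> V\<close> by (simp add: \<phi> compose_eq hom algebra_simps)
  qed (simp_all add: \<phi>_def)
  then have "\<phi> \<in> hom G (BijGroup V)"
    using Bij by (auto simp: hom_def BijGroup_def)
  then have "group_action G V \<phi>"
    by (intro group_action.intro group_hom.intro group_hom_axioms.intro group_axioms group_BijGroup)
  moreover have "\<forall>g\<in>carrier G. \<forall>u\<in>V. \<forall>v\<in>V. ({\<phi> g u, \<phi> g v} \<in> E) = ({u, v} \<in> E)"
    by (auto simp: V_def \<phi> line(2))
  ultimately have "tree_action G V E \<phi>" by (simp add: tree_action_def)
  moreover have "without_inversions G E \<phi>"
    unfolding without_inversions_def
  proof (intro notI, elim bexE exE conjE)
    fix g u v assume uv: "{u, v} \<in> E" "\<phi> g u = v" "\<phi> g v = u"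
    obtain i j where "u = \<iota> i" "v = \<iota> j" using uv(1) by (auto simp: E_def doubleton_eq_iff)
    then show False using uv by (auto simp: \<phi> line(2) inj_iff)
  qed
  ultimately obtain v where "v \<in> V" "\<forall>g\<in>carrier G. \<phi> g v = v"
    using FA line(1) unfolding property_FA_def by blast
  moreover then obtain k where "v = \<iota> k" by (auto simp: V_def)
  ultimately have "\<forall>g\<in>carrier G. \<tau> g = 0" by (simp add: \<phi> inj_iff)
  then show False using nz by blast
qed

section \<open>Wreath products\<close>

locale wreath = A: group A + B: group B
  for A :: "('a, 'c) monoid_scheme" and B :: "('b, 'd) monoid_scheme"
begin

abbreviation W where "W \<equiv> wreath_product A B"

sublocale W: group W
  by (rule group_wreath_product) unfold_locales

definition supp :: "('b \<Rightarrow> 'a) \<Rightarrow> 'b set" where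
  "supp f = {x \<in> carrier B. f x \<noteq> \<one>\<^bsub>A\<^esub>}"

definition top :: "'b \<Rightarrow> ('b \<Rightarrow> 'a) \<times> 'b" where
  "top b = (\<lambda>x\<in>carrier B. \<one>\<^bsub>A\<^esub>, b)"

definition single :: "'b \<Rightarrow> 'a \<Rightarrow> ('b \<Rightarrow> 'a) \<times> 'b" where
  "single y a = (\<lambda>x\<in>carrier B. if x = y then a else \<one>\<^bsub>A\<^esub>, \<one>\<^bsub>B\<^esub>)"

text \<open>The case \<open>S = carrier B\<close> is the whole base group. Supports stay finite even
  for infinite \<open>S\<close>, by membership in \<open>W\<close>.\<close>

definition base :: "'b set \<Rightarrow> (('b \<Rightarrow> 'a) \<times> 'b) set" where
  "base S = {(f, \<one>\<^bsub>B\<^esub>) | f. (f, \<one>\<^bsub>B\<^esub>) \<in> carrier W \<and> supp f \<subseteq> S}"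

lemma carrier_W: "(f, b) \<in> carrier W \<longleftrightarrow>
    f \<in> (\<Pi>\<^sub>E x\<in>carrier B. carrier A) \<and> finite (supp f) \<and> b \<in> carrier B"
  using A.group_axioms
  by (auto simp: wreath_product_def Let_def carrier_sum_group supp_def)

lemma mult_W: "(f, b) \<otimes>\<^bsub>W\<^esub> (g, c) = (\<lambda>x\<in>carrier B. f x \<otimes>\<^bsub>A\<^esub> g (inv\<^bsub>B\<^esub> b \<otimes>\<^bsub>B\<^esub> x), b \<otimes>\<^bsub>B\<^esub> c)"
  by (auto simp: wreath_product_def Let_def shift_def fun_eq_iff)

lemma one_W: "\<one>\<^bsub>W\<^esub> = (\<lambda>x\<in>carrier B. \<one>\<^bsub>A\<^esub>, \<one>\<^bsub>B\<^esub>)"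
  by (simp add: wreath_product_def Let_def)

lemma top_closed: "b \<in> carrier B \<Longrightarrow> top b \<in> carrier W"
  by (auto simp: top_def carrier_W supp_def)

lemma single_closed: "a \<in> carrier A \<Longrightarrow> single y a \<in> carrier W"
proof -
  assume a: "a \<in> carrier A"
  have "supp (\<lambda>x\<in>carrier B. if x = y then a else \<one>\<^bsub>A\<^esub>) \<subseteq> {y}" by (auto simp: supp_def)
  then have "finite (supp (\<lambda>x\<in>carrier B. if x = y then a else \<one>\<^bsub>A\<^esub>))" using finite_subset by blast
  then show ?thesis using a by (auto simp: single_def carrier_W)
qed

lemma single_base: "a \<in> carrier A \<Longrightarrow> y \<in> S \<Longrightarrow> single y a \<in> base S"
  using single_closed[of a y] by (auto simp: single_def base_def supp_def)

lemma group_hom_top: "group_hom B W top"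
  by unfold_locales (auto simp: hom_def top_closed, auto simp: top_def mult_W fun_eq_iff)

sublocale top: group_hom B W top by (rule group_hom_top)

lemma group_hom_single: "group_hom A W (single y)"
proof unfold_locales
  have "single y (a \<otimes>\<^bsub>A\<^esub> c) = single y a \<otimes>\<^bsub>W\<^esub> single y c" if "a \<in> carrier A" "c \<in> carrier A" for a c
    using that by (auto simp: single_def mult_W fun_eq_iff)
  then show "single y \<in> hom A W" by (auto simp: hom_def single_closed)
qed

lemma group_hom_snd: "group_hom W B snd"
  by unfold_locales (auto simp: hom_def carrier_W mult_W)

lemma top_single:
  assumes "b \<in> carrier B" "y \<in> carrier B" "a \<in> carrier A"
  shows "top b \<otimes>\<^bsub>W\<^esub> single y a \<otimes>\<^bsub>W\<^esub> inv\<^bsub>W\<^esub> top b = single (b \<otimes>\<^bsub>B\<^esub> y) a"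
proof -
  have "(inv\<^bsub>B\<^esub> b \<otimes>\<^bsub>B\<^esub> x = y) = (x = b \<otimes>\<^bsub>B\<^esub> y)" if "x \<in> carrier B" for x
    using that assms B.inv_solve_left by metis
  then have "top b \<otimes>\<^bsub>W\<^esub> single y a = single (b \<otimes>\<^bsub>B\<^esub> y) a \<otimes>\<^bsub>W\<^esub> top b"
    using assms by (auto simp: single_def top_def mult_W fun_eq_iff)
  then show ?thesis using assms by (simp add: single_closed top_closed W.m_assoc)
qed

lemma base_mono: "S \<subseteq> T \<Longrightarrow> base S \<subseteq> base T"
  by (auto simp: base_def)

lemma base_iff: "(f, b) \<in> base S \<longleftrightarrow> b = \<one>\<^bsub>B\<^esub> \<and> (f, b) \<in> carrier W \<and> supp f \<subseteq> S"
  by (auto simp: base_def)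

lemma inv_base:
  assumes "(f, \<one>\<^bsub>B\<^esub>) \<in> carrier W"
  shows "inv\<^bsub>W\<^esub> (f, \<one>\<^bsub>B\<^esub>) = (\<lambda>x\<in>carrier B. inv\<^bsub>A\<^esub> f x, \<one>\<^bsub>B\<^esub>)"
    and "supp (\<lambda>x\<in>carrier B. inv\<^bsub>A\<^esub> f x) = supp f"
proof -
  have f: "f x \<in> carrier A" if "x \<in> carrier B" for x using assms that by (auto simp: carrier_W)
  show s: "supp (\<lambda>x\<in>carrier B. inv\<^bsub>A\<^esub> f x) = supp f"
    using f by (auto simp: supp_def)
  have c: "(\<lambda>x\<in>carrier B. inv\<^bsub>A\<^esub> f x, \<one>\<^bsub>B\<^esub>) \<in> carrier W"
    using assms f s by (auto simp: carrier_W)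
  have "(\<lambda>x\<in>carrier B. inv\<^bsub>A\<^esub> f x, \<one>\<^bsub>B\<^esub>) \<otimes>\<^bsub>W\<^esub> (f, \<one>\<^bsub>B\<^esub>) = \<one>\<^bsub>W\<^esub>"
    using f by (auto simp: mult_W one_W fun_eq_iff)
  then show "inv\<^bsub>W\<^esub> (f, \<one>\<^bsub>B\<^esub>) = (\<lambda>x\<in>carrier B. inv\<^bsub>A\<^esub> f x, \<one>\<^bsub>B\<^esub>)"
    using W.inv_equality assms c by blast
qed

lemma subgroup_base: "subgroup (base S) W"
proof (rule W.subgroupI)
  show "base S \<noteq> {}" using W.one_closed by (auto simp: base_def one_W supp_def)
  fix p assume "p \<in> base S"
  then obtain f where p: "p = (f, \<one>\<^bsub>B\<^esub>)" "p \<in> carrier W" "supp f \<subseteq> S" by (auto simp: base_def)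
  then show "inv\<^bsub>W\<^esub> p \<in> base S"
    using W.inv_closed[OF p(2)] inv_base[of f] by (auto simp: base_def)
  fix q assume "q \<in> base S"
  then obtain g where q: "q = (g, \<one>\<^bsub>B\<^esub>)" "q \<in> carrier W" "supp g \<subseteq> S" by (auto simp: base_def)
  let ?h = "\<lambda>x\<in>carrier B. f x \<otimes>\<^bsub>A\<^esub> g x"
  have pq: "p \<otimes>\<^bsub>W\<^esub> q = (?h, \<one>\<^bsub>B\<^esub>)" using p q by (auto simp: mult_W fun_eq_iff)
  have "x \<in> S" if x: "x \<in> supp ?h" for x
  proof (rule ccontr)
    assume "x \<notin> S"
    then have "f x = \<one>\<^bsub>A\<^esub>" "g x = \<one>\<^bsub>A\<^esub>" using x p q by (auto simp: supp_def)
    then show False using x by (auto simp: supp_def)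
  qed
  then show "p \<otimes>\<^bsub>W\<^esub> q \<in> base S"
    using W.m_closed[OF p(2) q(2)] pq by (auto simp: base_iff)
qed (auto simp: base_def)

lemma base_commute:
  assumes "p \<in> base S" "q \<in> base T" "S \<inter> T = {}"
  shows "p \<otimes>\<^bsub>W\<^esub> q = q \<otimes>\<^bsub>W\<^esub> p"
proof -
  obtain f g where f: "p = (f, \<one>\<^bsub>B\<^esub>)" "p \<in> carrier W" "supp f \<subseteq> S"
    and g: "q = (g, \<one>\<^bsub>B\<^esub>)" "q \<in> carrier W" "supp g \<subseteq> T"
    using assms by (auto simp: base_def)
  have "f x \<otimes>\<^bsub>A\<^esub> g x = g x \<otimes>\<^bsub>A\<^esub> f x" if x: "x \<in> carrier B" for x
  proof -
    have "f x \<in> carrier A" "g x \<in> carrier A" using x f g by (auto simp: carrier_W)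
    moreover have "f x = \<one>\<^bsub>A\<^esub> \<or> g x = \<one>\<^bsub>A\<^esub>" using x f g assms(3) by (auto simp: supp_def)
    ultimately show ?thesis by auto
  qed
  then show ?thesis using f g by (auto simp: mult_W fun_eq_iff)
qed

lemma top_base:
  assumes b: "b \<in> carrier B" and p: "p \<in> base S"
  shows "top b \<otimes>\<^bsub>W\<^esub> p \<otimes>\<^bsub>W\<^esub> inv\<^bsub>W\<^esub> top b \<in> base ((\<lambda>x. b \<otimes>\<^bsub>B\<^esub> x) ` S)"
proof -
  obtain f where f: "p = (f, \<one>\<^bsub>B\<^esub>)" "p \<in> carrier W" "supp f \<subseteq> S"
    using p by (auto simp: base_def)
  have fc: "f x \<in> carrier A" if "x \<in> carrier B" for x using that f by (auto simp: carrier_W)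
  let ?q = "(\<lambda>x\<in>carrier B. f (inv\<^bsub>B\<^esub> b \<otimes>\<^bsub>B\<^esub> x), \<one>\<^bsub>B\<^esub>)"
  have "supp (fst ?q) \<subseteq> (\<lambda>x. b \<otimes>\<^bsub>B\<^esub> x) ` supp f"
  proof
    fix x assume "x \<in> supp (fst ?q)"
    then have x: "x \<in> carrier B" "inv\<^bsub>B\<^esub> b \<otimes>\<^bsub>B\<^esub> x \<in> supp f" using b by (auto simp: supp_def)
    have "x = b \<otimes>\<^bsub>B\<^esub> (inv\<^bsub>B\<^esub> b \<otimes>\<^bsub>B\<^esub> x)" using x(1) b by (simp add: B.m_assoc [symmetric])
    then show "x \<in> (\<lambda>x. b \<otimes>\<^bsub>B\<^esub> x) ` supp f" using x(2) by blast
  qed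
  moreover have "finite (supp f)" using f by (simp add: carrier_W)
  ultimately have q: "?q \<in> carrier W" "supp (fst ?q) \<subseteq> (\<lambda>x. b \<otimes>\<^bsub>B\<^esub> x) ` S"
    using f(3) fc b by (auto simp: carrier_W intro: finite_subset)
  have "top b \<otimes>\<^bsub>W\<^esub> p = ?q \<otimes>\<^bsub>W\<^esub> top b"
    using b fc f(1) by (auto simp: top_def mult_W fun_eq_iff)
  then have "top b \<otimes>\<^bsub>W\<^esub> p \<otimes>\<^bsub>W\<^esub> inv\<^bsub>W\<^esub> top b = ?q"
    using q(1) b by (simp add: W.m_assoc top_closed)
  then show ?thesis using q by (simp add: base_iff)
qed

lemma decompose:
  assumes "g \<in> carrier W"
  obtains n b S where "finite S" "S \<subseteq> carrier B" "n \<in> base S" "b \<in> carrier B" "g = n \<otimes>\<^bsub>W\<^esub> top b"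
proof -
  obtain f b where g: "g = (f, b)" by fastforce
  have fc: "f x \<in> carrier A" if "x \<in> carrier B" for x using that g assms by (auto simp: carrier_W)
  have "(f, \<one>\<^bsub>B\<^esub>) \<otimes>\<^bsub>W\<^esub> top b = g"
  proof -
    have "f \<in> extensional (carrier B)" using assms g by (auto simp: carrier_W PiE_def)
    then show ?thesis using g assms fc
      by (auto simp: top_def mult_W carrier_W fun_eq_iff extensional_def)
  qed
  then show thesis
    using that[of "supp f" "(f, \<one>\<^bsub>B\<^esub>)" b] assms g by (auto simp: carrier_W base_iff supp_def)
qed

text \<open>An element of the base group is the product of its finitely many coordinates, split off
  one at a time.\<close>

lemma base_in_subgroup:
  assumes L: "subgroup L W" and "finite S" "S \<subseteq> carrier B"
    and "(f, \<one>\<^bsub>B\<^esub>) \<in> base S" "\<And>y. y \<in> S \<Longrightarrow> single y (f y) \<in> L"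
  shows "(f, \<one>\<^bsub>B\<^esub>) \<in> L"
  using assms(2-)
proof (induction S arbitrary: f rule: finite_induct)
  case empty
  then have "(f, \<one>\<^bsub>B\<^esub>) = \<one>\<^bsub>W\<^esub>"
    by (auto simp: base_iff one_W supp_def carrier_W fun_eq_iff PiE_def extensional_def)
  then show ?case using subgroup.one_closed[OF L] by simp
next
  case (insert y S)
  have y: "y \<in> carrier B" using insert.prems by blast
  have f: "f \<in> (\<Pi>\<^sub>E x\<in>carrier B. carrier A)" "finite (supp f)" "supp f \<subseteq> insert y S"
    using insert.prems(2) by (auto simp: base_iff carrier_W)
  let ?g = "f(y := \<one>\<^bsub>A\<^esub>)"
  have "supp ?g \<subseteq> supp f" "supp ?g \<subseteq> S" using f(3) by (auto simp: supp_def)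
  moreover have "?g \<in> (\<Pi>\<^sub>E x\<in>carrier B. carrier A)"
    using f(1) y by (auto simp: PiE_def extensional_def)
  ultimately have g: "(?g, \<one>\<^bsub>B\<^esub>) \<in> base S"
    using f(2) finite_subset by (auto simp: base_iff carrier_W)
  have "(?g, \<one>\<^bsub>B\<^esub>) \<in> L"
  proof (rule insert.IH[OF _ g])
    fix z assume "z \<in> S"
    then show "single z (?g z) \<in> L" using insert.prems(3)[of z] insert.hyps(2) by auto
  qed (use insert.prems(1) in blast)
  moreover have "single y (f y) \<in> L" using insert.prems(3) by blast
  moreover have "(f, \<one>\<^bsub>B\<^esub>) = single y (f y) \<otimes>\<^bsub>W\<^esub> (?g, \<one>\<^bsub>B\<^esub>)"
    using f(1) y by (auto simp: single_def mult_W fun_eq_iff PiE_def extensional_def Pi_def)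
  ultimately show ?case using subgroup.m_closed[OF L] by simp
qed

lemma base_pow:
  assumes "(f, \<one>\<^bsub>B\<^esub>) \<in> carrier W"
  shows "(f, \<one>\<^bsub>B\<^esub>) [^]\<^bsub>W\<^esub> (n::nat) = (\<lambda>x\<in>carrier B. f x [^]\<^bsub>A\<^esub> n, \<one>\<^bsub>B\<^esub>)"
  by (induction n) (auto simp: one_W mult_W fun_eq_iff)

text \<open>The coordinates of the power lie in the derived subgroup of \<open>A\<close>, hence are
  products of commutators and their inverses, which \<open>L\<close> contains at every
  \<open>y\<close> in \<open>S\<close>.\<close>

lemma base_pow_in_subgroup:
  assumes L: "subgroup L W" and S: "finite S" "S \<subseteq> carrier B" and q: "q \<in> base S"
    and e: "\<And>a. a \<in> carrier A \<Longrightarrow> a [^]\<^bsub>A\<^esub> (e::nat) \<in> derived A (carrier A)"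
    and comm: "\<And>y a c. y \<in> S \<Longrightarrow> a \<in> carrier A \<Longrightarrow> c \<in> carrier A \<Longrightarrow>
      single y (a \<otimes>\<^bsub>A\<^esub> c \<otimes>\<^bsub>A\<^esub> inv\<^bsub>A\<^esub> a \<otimes>\<^bsub>A\<^esub> inv\<^bsub>A\<^esub> c) \<in> L"
  shows "q [^]\<^bsub>W\<^esub> e \<in> L"
proof -
  obtain f where f: "q = (f, \<one>\<^bsub>B\<^esub>)" "q \<in> carrier W"
    using q by (auto simp: base_def)
  have "q [^]\<^bsub>W\<^esub> e \<in> base S"
    using q by (induction e) (simp_all add: subgroup.one_closed[OF subgroup_base] subgroup.m_closed[OF subgroup_base])
  then have pow: "(\<lambda>x\<in>carrier B. f x [^]\<^bsub>A\<^esub> e, \<one>\<^bsub>B\<^esub>) \<in> base S"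
    using base_pow[of f e] f by simp
  have "(\<lambda>x\<in>carrier B. f x [^]\<^bsub>A\<^esub> e, \<one>\<^bsub>B\<^esub>) \<in> L"
  proof (rule base_in_subgroup[OF L S pow])
    fix y assume y: "y \<in> S"
    interpret s: group_hom A W "single y" by (rule group_hom_single)
    have "f y [^]\<^bsub>A\<^esub> e \<in> derived A (carrier A)" using e f S(2) y by (auto simp: carrier_W)
    then have "single y (f y [^]\<^bsub>A\<^esub> e) \<in> single y ` generate A (derived_set A (carrier A))"
      unfolding derived_def by blast
    also have "\<dots> = generate W (single y ` derived_set A (carrier A))"
      by (rule s.generate_img [symmetric]) (rule A.derived_set_in_carrier, simp)
    also have "\<dots> \<subseteq> L"
      by (rule W.generate_subgroup_incl[OF _ L]) (use comm[OF y] in blast)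
    finally show "single y ((\<lambda>x\<in>carrier B. f x [^]\<^bsub>A\<^esub> e) y) \<in> L" using y S(2) by auto
  qed
  then show ?thesis using base_pow[of f e] f by simp
qed

text \<open>Conjugation by \<open>top y\<close> carries the copy of \<open>A\<close> at the identity
  to the copy at \<open>y\<close>, so generators for that one copy suffice.\<close>

lemma fg_wreath:
  assumes "finite S" "S \<subseteq> carrier A" "generate A S = carrier A"
    and "finite T" "T \<subseteq> carrier B" "generate B T = carrier B"
  obtains U where "finite U" "U \<subseteq> carrier W" "generate W U = carrier W"
proof
  let ?U = "top ` T \<union> single \<one>\<^bsub>B\<^esub> ` S"
  show "finite ?U" using assms by blast
  show U: "?U \<subseteq> carrier W" using assms single_closed top_closed by auto
  have sub: "subgroup (generate W ?U) W" by (rule W.generate_is_subgroup[OF U])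
  interpret s: group_hom A W "single \<one>\<^bsub>B\<^esub>" by (rule group_hom_single)
  have top: "top b \<in> generate W ?U" if "b \<in> carrier B" for b
  proof -
    have "top b \<in> generate W (top ` T)" using that assms top.generate_img[of T] by auto
    then show ?thesis using W.mono_generate[of "top ` T" ?U] by blast
  qed
  have single1: "single \<one>\<^bsub>B\<^esub> a \<in> generate W ?U" if "a \<in> carrier A" for a
  proof -
    have "single \<one>\<^bsub>B\<^esub> a \<in> generate W (single \<one>\<^bsub>B\<^esub> ` S)" using that assms s.generate_img[of S] by auto
    then show ?thesis using W.mono_generate[of "single \<one>\<^bsub>B\<^esub> ` S" ?U] by blast
  qed
  have single: "single y a \<in> generate W ?U" if "y \<in> carrier B" "a \<in> carrier A" for y a
  proof -
    have "single y a = top y \<otimes>\<^bsub>W\<^esub> single \<one>\<^bsub>B\<^esub> a \<otimes>\<^bsub>W\<^esub> inv\<^bsub>W\<^esub> top y"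
      using top_single[of y "\<one>\<^bsub>B\<^esub>" a] that by simp
    also have "\<dots> \<in> generate W ?U"
      by (intro subgroup.m_closed[OF sub] subgroup.m_inv_closed[OF sub] top single1 that)
    finally show ?thesis .
  qed
  have "g \<in> generate W ?U" if g: "g \<in> carrier W" for g
  proof -
    obtain n b S' where n: "finite S'" "S' \<subseteq> carrier B" "n \<in> base S'" "b \<in> carrier B" "g = n \<otimes>\<^bsub>W\<^esub> top b"
      by (rule decompose[OF g])
    obtain f where f: "n = (f, \<one>\<^bsub>B\<^esub>)" "n \<in> carrier W" using n(3) by (auto simp: base_def)
    have "n \<in> generate W ?U"
      unfolding f(1)
    proof (rule base_in_subgroup[OF sub n(1,2)])
      show "(f, \<one>\<^bsub>B\<^esub>) \<in> base S'" using n(3) f(1) by simp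
      fix y assume "y \<in> S'"
      then have "y \<in> carrier B" "f y \<in> carrier A" using n(2) f by (auto simp: carrier_W)
      then show "single y (f y) \<in> generate W ?U" by (rule single)
    qed
    then show ?thesis using top[OF n(4)] n(5) subgroup.m_closed[OF sub] by simp
  qed
  then show "generate W ?U = carrier W" using W.generate_incl[OF U] by blast
qed

end

section \<open>Finite-index subgroups of the wreath product and their fixed vertices\<close>

context wreath
begin

lemma base_carrier: "n \<in> base S \<Longrightarrow> n \<in> carrier W"
  by (auto simp: base_def)

lemma base_supp:
  assumes "n \<in> base S"
  shows "finite (supp (fst n))" "supp (fst n) \<subseteq> carrier B" "n \<in> base (supp (fst n))"
  using assms by (auto simp: base_def carrier_W supp_def)

lemma normal_conj_base:
  assumes "b \<in> carrier B" "n \<in> base (carrier B)"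
  shows "top b \<otimes>\<^bsub>W\<^esub> n \<otimes>\<^bsub>W\<^esub> inv\<^bsub>W\<^esub> top b \<in> base (carrier B)"
  using top_base[OF assms] base_mono[of "(\<lambda>x. b \<otimes>\<^bsub>B\<^esub> x) ` carrier B" "carrier B"] assms(1) by auto

text \<open>A finite-index normal subgroup need not be a semidirect product along
  the splitting of \<open>W\<close>, but it contains a finite-index subgroup that is one.\<close>

lemma split_subgroup_finite_index:
  assumes K: "K \<lhd> W" and fin: "finite (rcosets\<^bsub>W\<^esub> K)"
  defines "K' \<equiv> {n \<otimes>\<^bsub>W\<^esub> top b | n b. n \<in> K \<inter> base (carrier B) \<and> b \<in> carrier B \<and> top b \<in> K}"
  shows "subgroup K' W" "finite (rcosets\<^bsub>W\<^esub> K')"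
proof -
  interpret K: normal K W by fact
  have NK: "subgroup (K \<inter> base (carrier B)) W"
    using W.subgroups_Inter_pair K.subgroup_axioms subgroup_base by blast
  note NKm = subgroup.m_closed[OF NK] and NKi = subgroup.m_inv_closed[OF NK]
  have conj: "top b \<otimes>\<^bsub>W\<^esub> n \<otimes>\<^bsub>W\<^esub> inv\<^bsub>W\<^esub> top b \<in> K \<inter> base (carrier B)"
    if "b \<in> carrier B" "n \<in> K \<inter> base (carrier B)" for b n
    using that normal_conj_base K.inv_op_closed2 top_closed by blast
  show sub: "subgroup K' W"
  proof (rule W.subgroupI)
    show "K' \<subseteq> carrier W" using base_carrier top_closed by (auto simp: K'_def)
    have "top \<one>\<^bsub>B\<^esub> \<in> K" by simp
    then have "\<one>\<^bsub>W\<^esub> \<otimes>\<^bsub>W\<^esub> top \<one>\<^bsub>B\<^esub> \<in> K'"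
      unfolding K'_def using subgroup.one_closed[OF NK] B.one_closed by blast
    then show "K' \<noteq> {}" by blast
  next
    fix g assume "g \<in> K'"
    then obtain n b where n: "n \<in> K \<inter> base (carrier B)" "b \<in> carrier B" "top b \<in> K" "g = n \<otimes>\<^bsub>W\<^esub> top b"
      by (auto simp: K'_def)
    have nc: "n \<in> carrier W" using n base_carrier by blast
    have "inv\<^bsub>W\<^esub> g = (top (inv\<^bsub>B\<^esub> b) \<otimes>\<^bsub>W\<^esub> inv\<^bsub>W\<^esub> n \<otimes>\<^bsub>W\<^esub> inv\<^bsub>W\<^esub> top (inv\<^bsub>B\<^esub> b)) \<otimes>\<^bsub>W\<^esub> top (inv\<^bsub>B\<^esub> b)"
      using n nc top_closed[OF n(2)] by (simp add: W.inv_mult_group W.m_assoc)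
    moreover have "top (inv\<^bsub>B\<^esub> b) \<in> K" using n K.m_inv_closed by simp
    ultimately show "inv\<^bsub>W\<^esub> g \<in> K'"
      unfolding K'_def using conj[of "inv\<^bsub>B\<^esub> b" "inv\<^bsub>W\<^esub> n"] n NKi by blast
    fix h assume "h \<in> K'"
    then obtain m c where m: "m \<in> K \<inter> base (carrier B)" "c \<in> carrier B" "top c \<in> K" "h = m \<otimes>\<^bsub>W\<^esub> top c"
      by (auto simp: K'_def)
    have mc: "m \<in> carrier W" using m base_carrier by blast
    have "g \<otimes>\<^bsub>W\<^esub> h = n \<otimes>\<^bsub>W\<^esub> (top b \<otimes>\<^bsub>W\<^esub> m \<otimes>\<^bsub>W\<^esub> inv\<^bsub>W\<^esub> top b) \<otimes>\<^bsub>W\<^esub> top (b \<otimes>\<^bsub>B\<^esub> c)"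
    proof -
      have "inv\<^bsub>W\<^esub> top b \<otimes>\<^bsub>W\<^esub> (top b \<otimes>\<^bsub>W\<^esub> top c) = top c"
        using top_closed n(2) m(2) by (simp add: W.m_assoc [symmetric])
      then show ?thesis using n m nc mc top_closed by (simp add: W.m_assoc)
    qed
    moreover have "top (b \<otimes>\<^bsub>B\<^esub> c) \<in> K" using n m K.m_closed by simp
    moreover have "n \<otimes>\<^bsub>W\<^esub> (top b \<otimes>\<^bsub>W\<^esub> m \<otimes>\<^bsub>W\<^esub> inv\<^bsub>W\<^esub> top b) \<in> K \<inter> base (carrier B)"
      using NKm n(1) conj[OF n(2) m(1)] by blast
    ultimately show "g \<otimes>\<^bsub>W\<^esub> h \<in> K'"
      unfolding K'_def using B.m_closed[OF n(2) m(2)] by blast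
  qed
  have "\<exists>n b. n \<in> base (carrier B) \<and> b \<in> carrier B \<and> g = n \<otimes>\<^bsub>W\<^esub> top b" if g: "g \<in> carrier W" for g
    using base_mono by (rule_tac decompose[OF g]) blast
  then obtain \<nu> \<beta> where \<nu>: "\<And>g. g \<in> carrier W \<Longrightarrow> \<nu> g \<in> base (carrier B)"
    "\<And>g. g \<in> carrier W \<Longrightarrow> \<beta> g \<in> carrier B"
    "\<And>g. g \<in> carrier W \<Longrightarrow> g = \<nu> g \<otimes>\<^bsub>W\<^esub> top (\<beta> g)"
    by metis
  \<comment> \<open>Invariant for the cosets of \<open>K'\<close>: the cosets modulo
    \<open>K\<close> of the base part and of the top part, taken separately.\<close>
  show "finite (rcosets\<^bsub>W\<^esub> K')"
  proof (rule W.finite_rcosetsI[OF sub, of "\<lambda>g. (K #>\<^bsub>W\<^esub> \<nu> g, K #>\<^bsub>W\<^esub> top (\<beta> g))"])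
    show "finite ((\<lambda>g. (K #>\<^bsub>W\<^esub> \<nu> g, K #>\<^bsub>W\<^esub> top (\<beta> g))) ` carrier W)"
    proof (rule finite_subset)
      show "(\<lambda>g. (K #>\<^bsub>W\<^esub> \<nu> g, K #>\<^bsub>W\<^esub> top (\<beta> g))) ` carrier W \<subseteq> (rcosets\<^bsub>W\<^esub> K) \<times> (rcosets\<^bsub>W\<^esub> K)"
        by (intro image_subsetI SigmaI W.rcosetsI K.subset base_carrier[OF \<nu>(1)] top_closed[OF \<nu>(2)])
    qed (use fin in blast)
    fix g h assume g: "g \<in> carrier W" and h: "h \<in> carrier W"
      and e: "(K #>\<^bsub>W\<^esub> \<nu> g, K #>\<^bsub>W\<^esub> top (\<beta> g)) = (K #>\<^bsub>W\<^esub> \<nu> h, K #>\<^bsub>W\<^esub> top (\<beta> h))"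
    let ?n = "\<nu> g" and ?m = "\<nu> h" and ?b = "\<beta> g" and ?c = "\<beta> h"
    let ?d = "?b \<otimes>\<^bsub>B\<^esub> inv\<^bsub>B\<^esub> ?c"
    have nm: "?n \<in> carrier W" "?m \<in> carrier W" using base_carrier \<nu>(1)[OF g] \<nu>(1)[OF h] by blast+
    have bc: "?b \<in> carrier B" "?c \<in> carrier B" "?d \<in> carrier B"
      using \<nu>(2)[OF g] \<nu>(2)[OF h] by simp_all
    have nK: "?n \<otimes>\<^bsub>W\<^esub> inv\<^bsub>W\<^esub> ?m \<in> K"
      using W.coset_eqD[OF K.subgroup_axioms nm] e by simp
    have dK: "top ?d \<in> K"
      using W.coset_eqD[OF K.subgroup_axioms top_closed top_closed] bc e by simp
    let ?p = "?n \<otimes>\<^bsub>W\<^esub> (top ?d \<otimes>\<^bsub>W\<^esub> inv\<^bsub>W\<^esub> ?m \<otimes>\<^bsub>W\<^esub> inv\<^bsub>W\<^esub> top ?d)"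
    note tc = top_closed[OF bc(1)] top_closed[OF bc(2)] top_closed[OF bc(3)]
    have td: "top ?d = top ?b \<otimes>\<^bsub>W\<^esub> inv\<^bsub>W\<^esub> top ?c" using bc by simp
    have "g \<otimes>\<^bsub>W\<^esub> inv\<^bsub>W\<^esub> h = (?n \<otimes>\<^bsub>W\<^esub> top ?b) \<otimes>\<^bsub>W\<^esub> inv\<^bsub>W\<^esub> (?m \<otimes>\<^bsub>W\<^esub> top ?c)"
      using \<nu>(3)[OF g] \<nu>(3)[OF h] by simp
    also have "\<dots> = ?n \<otimes>\<^bsub>W\<^esub> top ?d \<otimes>\<^bsub>W\<^esub> inv\<^bsub>W\<^esub> ?m"
      unfolding td using nm tc(1,2) by (simp add: W.inv_mult_group W.m_assoc)
    also have "\<dots> = ?p \<otimes>\<^bsub>W\<^esub> top ?d"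
      using nm tc(3) by (simp add: W.m_assoc del: top.hom_mult top.hom_inv)
    finally have gh: "g \<otimes>\<^bsub>W\<^esub> inv\<^bsub>W\<^esub> h = ?p \<otimes>\<^bsub>W\<^esub> top ?d" .
    have "?p \<in> base (carrier B)"
      using \<nu>(1)[OF g] \<nu>(1)[OF h] normal_conj_base[OF bc(3)] subgroup.m_closed[OF subgroup_base]
        subgroup.m_inv_closed[OF subgroup_base] by blast
    \<comment> \<open>This form shows that \<open>?p\<close>, the base part of the quotient of
      \<open>g\<close> by \<open>h\<close>, lies in \<open>K\<close>: a conjugate of
      \<open>top ?d\<close>, the quotient of the base parts, and the inverse of
      \<open>top ?d\<close> are all in \<open>K\<close>.\<close>
    moreover have "?p = (?n \<otimes>\<^bsub>W\<^esub> top ?d \<otimes>\<^bsub>W\<^esub> inv\<^bsub>W\<^esub> ?n) \<otimes>\<^bsub>W\<^esub> (?n \<otimes>\<^bsub>W\<^esub> inv\<^bsub>W\<^esub> ?m) \<otimes>\<^bsub>W\<^esub> inv\<^bsub>W\<^esub> top ?d"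
    proof -
      have "inv\<^bsub>W\<^esub> ?n \<otimes>\<^bsub>W\<^esub> (?n \<otimes>\<^bsub>W\<^esub> x) = x" if "x \<in> carrier W" for x
        using that nm by (simp add: W.m_assoc [symmetric])
      then show ?thesis using nm tc(3) by (simp add: W.m_assoc del: top.hom_mult top.hom_inv)
    qed
    moreover have "?n \<otimes>\<^bsub>W\<^esub> top ?d \<otimes>\<^bsub>W\<^esub> inv\<^bsub>W\<^esub> ?n \<in> K" using K.inv_op_closed2 nm dK by blast
    ultimately have "?p \<in> K \<inter> base (carrier B)"
      using nK dK K.m_closed K.m_inv_closed by (metis IntI)
    then show "g \<otimes>\<^bsub>W\<^esub> inv\<^bsub>W\<^esub> h \<in> K'" unfolding gh K'_def using bc(3) dK by blast
  qed
qed

lemma displacing_element: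
  assumes "B0 \<subseteq> carrier B" "infinite B0" "finite S" "finite T" "S \<subseteq> carrier B" "T \<subseteq> carrier B"
  obtains b where "b \<in> B0" "(\<lambda>x. b \<otimes>\<^bsub>B\<^esub> x) ` S \<inter> T = {}"
proof -
  have "\<not> B0 \<subseteq> {b \<in> carrier B. (\<lambda>x. b \<otimes>\<^bsub>B\<^esub> x) ` S \<inter> T \<noteq> {}}"
    using B.finite_nondisplacing[OF assms(3-6)] assms(2) finite_subset by blast
  then show thesis using that assms(1) by blast
qed

text \<open>If \<open>h\<close> is hyperbolic, everything in \<open>K\<close> supported off \<open>S\<close> commutes with \<open>h\<close>, hence
  acts on the axis of \<open>h\<close> through \<open>\<tau>\<close>. For \<open>y \<notin> S\<close> the copy of \<open>[a, c]\<close> at \<open>y\<close>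
  is a commutator of two elements of \<open>K\<close> of this kind, even if \<open>a\<close> and \<open>c\<close> at \<open>y\<close> are
  not in \<open>K\<close>. So \<open>\<tau>\<close> vanishes on a power of the displaced conjugate of \<open>h\<close>, which
  therefore has a fixed vertex.\<close>

lemma elliptic_of_finite_support:
  assumes \<phi>: "tree_isometries V d W H \<phi>" and K: "K \<lhd> W" "K \<subseteq> H"
    and B0: "B0 \<subseteq> carrier B" "infinite B0" "\<And>b. b \<in> B0 \<Longrightarrow> top b \<in> K"
    and ab: "finite (carrier (abelianisation A))"
    and S: "finite S" "S \<subseteq> carrier B" and h: "h \<in> K" "h \<in> base S"
  shows "tree_isometries.fixset V \<phi> {h} \<noteq> {}"
proof
  interpret \<phi>: tree_isometries V d W H \<phi> by fact
  interpret K: normal K W by fact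
  assume nofix: "\<phi>.fixset {h} = {}"
  have hH: "h \<in> H" using h K by blast
  define C where "C = {p \<in> H. p \<otimes>\<^bsub>W\<^esub> h = h \<otimes>\<^bsub>W\<^esub> p}"
  obtain x and \<tau> :: "_ \<Rightarrow> int" where x: "x \<in> V"
    and \<tau>_mult: "\<And>p q. p \<in> C \<Longrightarrow> q \<in> C \<Longrightarrow> \<tau> (p \<otimes>\<^bsub>W\<^esub> q) = \<tau> p + \<tau> q"
    and \<tau>_fix: "\<And>p. p \<in> C \<Longrightarrow> \<tau> p = 0 \<Longrightarrow> \<phi> p x = x"
    by (rule \<phi>.translation_hom[OF hH nofix, folded C_def]) (rule that; blast)
  have C: "subgroup C W"
    unfolding C_def using W.subgroup_centralizer[OF \<phi>.subgroup] h(2) base_carrier by blast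
  note Cm = subgroup.m_closed[OF C] and Ci = subgroup.m_inv_closed[OF C]
    and C1 = subgroup.one_closed[OF C]
  have in_C: "p \<in> C" if "p \<in> K" "p \<in> base T" "T \<inter> S = {}" for p T
    using that K(2) base_commute[OF that(2) h(2) that(3)] by (auto simp: C_def)
  have "\<tau> (\<one>\<^bsub>W\<^esub> \<otimes>\<^bsub>W\<^esub> \<one>\<^bsub>W\<^esub>) = \<tau> \<one>\<^bsub>W\<^esub> + \<tau> \<one>\<^bsub>W\<^esub>" using \<tau>_mult[OF C1 C1] .
  then have \<tau>_one: "\<tau> \<one>\<^bsub>W\<^esub> = 0" by simp
  have CW: "p \<in> carrier W" if "p \<in> C" for p using subgroup.mem_carrier[OF C that] .
  define L where "L = {p \<in> C. \<tau> p = 0}"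
  have L: "subgroup L W"
  proof (rule W.subgroupI)
    show "L \<subseteq> carrier W" using CW by (auto simp: L_def)
    show "L \<noteq> {}" unfolding L_def using C1 \<tau>_one by blast
    show "inv\<^bsub>W\<^esub> p \<in> L" if "p \<in> L" for p
      using that \<tau>_mult[of "inv\<^bsub>W\<^esub> p" p] CW[of p] Ci[of p] \<tau>_one by (auto simp: L_def)
    show "p \<otimes>\<^bsub>W\<^esub> q \<in> L" if "p \<in> L" "q \<in> L" for p q
      using that \<tau>_mult[of p q] Cm by (auto simp: L_def)
  qed
  have comm: "single y (a \<otimes>\<^bsub>A\<^esub> c \<otimes>\<^bsub>A\<^esub> inv\<^bsub>A\<^esub> a \<otimes>\<^bsub>A\<^esub> inv\<^bsub>A\<^esub> c) \<in> L"
    if y: "y \<in> carrier B" "y \<notin> S" and ac: "a \<in> carrier A" "c \<in> carrier A" for y a c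
  proof -
    interpret s: group_hom A W "single y" by (rule group_hom_single)
    obtain b1 where b1: "b1 \<in> B0" "(\<lambda>x. b1 \<otimes>\<^bsub>B\<^esub> x) ` {y} \<inter> insert y S = {}"
      using displacing_element[OF B0(1,2), of "{y}" "insert y S"] y S by blast
    have b1c: "b1 \<in> carrier B" using b1 B0 by blast
    \<comment> \<open>Avoiding also the position chosen with \<open>b1\<close> makes the corrections
      \<open>\<alpha>\<close> and \<open>\<gamma>\<close> commute with each other; avoiding
      \<open>y\<close> makes them commute with both \<open>single y a\<close> and
      \<open>single y c\<close>.\<close>
    obtain b2 where b2: "b2 \<in> B0"
      "(\<lambda>x. b2 \<otimes>\<^bsub>B\<^esub> x) ` {y} \<inter> insert (b1 \<otimes>\<^bsub>B\<^esub> y) (insert y S) = {}"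
      using displacing_element[OF B0(1,2), of "{y}" "insert (b1 \<otimes>\<^bsub>B\<^esub> y) (insert y S)"] y S b1c by blast
    have b2c: "b2 \<in> carrier B" using b2 B0 by blast
    \<comment> \<open>The product is the commutator of \<open>single y e\<close> and
      \<open>top b\<close>, which lies in the normal subgroup \<open>K\<close> because
      \<open>top b\<close> does.\<close>
    have copy: "\<exists>\<alpha>. \<alpha> \<in> base {b \<otimes>\<^bsub>B\<^esub> y} \<and> single y e \<otimes>\<^bsub>W\<^esub> \<alpha> \<in> K" if b: "b \<in> B0" and e: "e \<in> carrier A" for b e
    proof -
      have bc: "b \<in> carrier B" using b B0 by blast
      note cl = top_closed[OF bc] single_closed[OF e, of y]
      let ?\<alpha> = "inv\<^bsub>W\<^esub> (top b \<otimes>\<^bsub>W\<^esub> single y e \<otimes>\<^bsub>W\<^esub> inv\<^bsub>W\<^esub> top b)"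
      have "?\<alpha> \<in> base {b \<otimes>\<^bsub>B\<^esub> y}"
        unfolding top_single[OF bc y(1) e]
        by (intro subgroup.m_inv_closed[OF subgroup_base] single_base e) simp
      moreover have "single y e \<otimes>\<^bsub>W\<^esub> ?\<alpha> = (single y e \<otimes>\<^bsub>W\<^esub> top b \<otimes>\<^bsub>W\<^esub> inv\<^bsub>W\<^esub> single y e) \<otimes>\<^bsub>W\<^esub> inv\<^bsub>W\<^esub> top b"
        using cl by (simp add: W.inv_mult_group W.m_assoc del: top.hom_inv)
      moreover have "\<dots> \<in> K"
        using K.m_closed[OF K.inv_op_closed2[OF cl(2) B0(3)[OF b]] K.m_inv_closed[OF B0(3)[OF b]]] .
      ultimately show ?thesis by metis
    qed
    let ?u = "single y a" and ?v = "single y c"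
    obtain \<alpha> where \<alpha>: "\<alpha> \<in> base {b1 \<otimes>\<^bsub>B\<^esub> y}" "?u \<otimes>\<^bsub>W\<^esub> \<alpha> \<in> K" using copy[OF b1(1) ac(1)] by blast
    obtain \<gamma> where \<gamma>: "\<gamma> \<in> base {b2 \<otimes>\<^bsub>B\<^esub> y}" "?v \<otimes>\<^bsub>W\<^esub> \<gamma> \<in> K" using copy[OF b2(1) ac(2)] by blast
    have u: "?u \<in> base {y}" and v: "?v \<in> base {y}" using ac single_base by auto
    have prod: "p \<otimes>\<^bsub>W\<^esub> q \<in> base {y, z}" if "p \<in> base {y}" "q \<in> base {z}" for p q z
      using that base_mono[of "{y}" "{y, z}"] base_mono[of "{z}" "{y, z}"]
      by (intro subgroup.m_closed[OF subgroup_base]) auto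
    have uC: "?u \<otimes>\<^bsub>W\<^esub> \<alpha> \<in> C" using in_C[OF \<alpha>(2) prod[OF u \<alpha>(1)]] y(2) b1(2) by auto
    have vC: "?v \<otimes>\<^bsub>W\<^esub> \<gamma> \<in> C" using in_C[OF \<gamma>(2) prod[OF v \<gamma>(1)]] y(2) b2(2) by auto
    have cl: "?u \<in> carrier W" "?v \<in> carrier W" "\<alpha> \<in> carrier W" "\<gamma> \<in> carrier W"
      using base_carrier u v \<alpha> \<gamma> by blast+
    have "\<alpha> \<otimes>\<^bsub>W\<^esub> ?v = ?v \<otimes>\<^bsub>W\<^esub> \<alpha>" "\<gamma> \<otimes>\<^bsub>W\<^esub> ?u = ?u \<otimes>\<^bsub>W\<^esub> \<gamma>" "\<alpha> \<otimes>\<^bsub>W\<^esub> \<gamma> = \<gamma> \<otimes>\<^bsub>W\<^esub> \<alpha>"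
      using base_commute[OF \<alpha>(1) v] base_commute[OF \<gamma>(1) u] base_commute[OF \<alpha>(1) \<gamma>(1)] b1(2) b2(2)
      by auto
    then have eq: "(?u \<otimes>\<^bsub>W\<^esub> ?v \<otimes>\<^bsub>W\<^esub> inv\<^bsub>W\<^esub> ?u \<otimes>\<^bsub>W\<^esub> inv\<^bsub>W\<^esub> ?v) \<otimes>\<^bsub>W\<^esub> ((?v \<otimes>\<^bsub>W\<^esub> \<gamma>) \<otimes>\<^bsub>W\<^esub> (?u \<otimes>\<^bsub>W\<^esub> \<alpha>))
        = (?u \<otimes>\<^bsub>W\<^esub> \<alpha>) \<otimes>\<^bsub>W\<^esub> (?v \<otimes>\<^bsub>W\<^esub> \<gamma>)"
      using W.commutator_of_products cl by blast
    \<comment> \<open>Both products are in the centralizer, so their quotient \<open>?k\<close> is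
      as well; \<open>\<tau>\<close> agrees on the two products because addition of integers is
      commutative.\<close>
    let ?k = "?u \<otimes>\<^bsub>W\<^esub> ?v \<otimes>\<^bsub>W\<^esub> inv\<^bsub>W\<^esub> ?u \<otimes>\<^bsub>W\<^esub> inv\<^bsub>W\<^esub> ?v"
    let ?X = "(?u \<otimes>\<^bsub>W\<^esub> \<alpha>) \<otimes>\<^bsub>W\<^esub> (?v \<otimes>\<^bsub>W\<^esub> \<gamma>)" and ?Y = "(?v \<otimes>\<^bsub>W\<^esub> \<gamma>) \<otimes>\<^bsub>W\<^esub> (?u \<otimes>\<^bsub>W\<^esub> \<alpha>)"
    have XY: "?X \<in> C" "?Y \<in> C" using uC vC Cm by auto
    have kc: "?k \<in> carrier W" using cl by simp
    have "?k = ?X \<otimes>\<^bsub>W\<^esub> inv\<^bsub>W\<^esub> ?Y"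
      using W.inv_solve_right[OF kc CW[OF XY(1)] CW[OF XY(2)]] eq by simp
    then have kC: "?k \<in> C" using XY Cm Ci by simp
    have "\<tau> ?k + \<tau> ?Y = \<tau> ?X" using \<tau>_mult[OF kC XY(2)] eq by simp
    then have "\<tau> ?k = 0" using \<tau>_mult[OF uC vC] \<tau>_mult[OF vC uC] by simp
    then show ?thesis using kC ac by (simp add: L_def)
  qed
  obtain b where b: "b \<in> B0" "(\<lambda>x. b \<otimes>\<^bsub>B\<^esub> x) ` S \<inter> S = {}"
    using displacing_element[OF B0(1,2) S(1,1) S(2,2)] by blast
  have bc: "b \<in> carrier B" and tb: "top b \<in> K" "top b \<in> H" using b B0 K by auto
  define q where "q = top b \<otimes>\<^bsub>W\<^esub> h \<otimes>\<^bsub>W\<^esub> inv\<^bsub>W\<^esub> top b"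
  let ?S = "(\<lambda>x. b \<otimes>\<^bsub>B\<^esub> x) ` S"
  have q: "q \<in> base ?S" "q \<in> K"
    unfolding q_def using top_base[OF bc h(2)] K.inv_op_closed2[OF top_closed[OF bc] h(1)] .
  have qC: "q \<in> C" using in_C[OF q(2,1) b(2)] .
  obtain e where e: "0 < (e::nat)" "\<And>a. a \<in> carrier A \<Longrightarrow> a [^]\<^bsub>A\<^esub> e \<in> derived A (carrier A)"
    using A.normal_finite_index_exponent[OF A.derived_is_normal[OF A.normal_self]] ab
    by (auto simp: abelianisation_def FactGroup_def)
  have "q [^]\<^bsub>W\<^esub> e \<in> L"
  proof (rule base_pow_in_subgroup[OF L _ _ q(1) e(2)])
    show "finite ?S" using S by blast
    show "?S \<subseteq> carrier B" using S bc by auto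
    fix y assume "y \<in> ?S"
    then have "y \<in> carrier B" "y \<notin> S" using S bc b(2) by auto
    then show "single y (a \<otimes>\<^bsub>A\<^esub> c \<otimes>\<^bsub>A\<^esub> inv\<^bsub>A\<^esub> a \<otimes>\<^bsub>A\<^esub> inv\<^bsub>A\<^esub> c) \<in> L"
      if "a \<in> carrier A" "c \<in> carrier A" for a c
      using comm that by blast
  qed
  moreover have "q [^]\<^bsub>W\<^esub> n \<in> C \<and> \<tau> (q [^]\<^bsub>W\<^esub> n) = int n * \<tau> q" for n :: nat
    by (induction n) (use C1 \<tau>_one Cm qC \<tau>_mult in \<open>auto simp: algebra_simps\<close>)
  \<comment> \<open>Integers have no torsion, so \<open>\<tau> q\<close> vanishes. The vertex
    \<open>x\<close> fixed by the conjugate \<open>q\<close> is moved by the inverse of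
    \<open>top b\<close> to a vertex fixed by \<open>h\<close>.\<close>
  ultimately have "int e * \<tau> q = 0" by (auto simp: L_def)
  then have "\<phi> q x = x" using \<tau>_fix[OF qC] e(1) by simp
  then have "\<phi> (inv\<^bsub>W\<^esub> top b) (\<phi> (top b) (\<phi> h (\<phi> (inv\<^bsub>W\<^esub> top b) x))) = \<phi> (inv\<^bsub>W\<^esub> top b) x"
    using tb hH x by (simp add: q_def \<phi>.act_mult del: \<phi>.act_inv \<phi>.act_inv' top.hom_inv)
  then have "\<phi> h (\<phi> (inv\<^bsub>W\<^esub> top b) x) = \<phi> (inv\<^bsub>W\<^esub> top b) x"
    using tb hH x by (simp del: top.hom_inv)
  moreover have "\<phi> (inv\<^bsub>W\<^esub> top b) x \<in> V" using tb x by (simp del: top.hom_inv)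
  ultimately show False using nofix unfolding \<phi>.fixset_def by blast
qed

text \<open>Property (FA) enters only through \<open>FA\<close>, a fixed vertex for the given action
  restricted along \<open>top\<close>; this keeps the geometric argument free of quantification over
  trees.\<close>

lemma fixed_vertex:
  assumes \<phi>: "tree_isometries V d W H \<phi>" and fin: "finite (rcosets\<^bsub>W\<^esub> H)"
    and fg: "finite U" "U \<subseteq> carrier W" "generate W U = carrier W"
    and B: "infinite (carrier B)" and ab: "finite (carrier (abelianisation A))"
    and FA: "\<And>B0. subgroup B0 B \<Longrightarrow> finite (rcosets\<^bsub>B\<^esub> B0) \<Longrightarrow> (\<And>b. b \<in> B0 \<Longrightarrow> top b \<in> H) \<Longrightarrow>
      \<exists>v\<in>V. \<forall>b\<in>B0. \<phi> (top b) v = v"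
  shows "\<exists>v\<in>V. \<forall>g\<in>H. \<phi> g v = v"
proof -
  interpret \<phi>: tree_isometries V d W H \<phi> by fact
  obtain K where K: "K \<lhd> W" "K \<subseteq> H" "finite (rcosets\<^bsub>W\<^esub> K)"
    using W.normal_core_finite_index[OF \<phi>.subgroup fin] by blast
  interpret K: normal K W by fact
  define B0 where "B0 = {b \<in> carrier B. top b \<in> K}"
  have B0: "subgroup B0 B" "finite (rcosets\<^bsub>B\<^esub> B0)"
    unfolding B0_def using W.finite_index_preimage[OF group_hom_top K.subgroup_axioms K(3)] .
  have B0c: "B0 \<subseteq> carrier B" and B0K: "\<And>b. b \<in> B0 \<Longrightarrow> top b \<in> K" by (auto simp: B0_def)
  have B0H: "top b \<in> H" if "b \<in> B0" for b using B0K that K(2) by blast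
  have B0inf: "infinite B0" using B.finite_index_infinite[OF B0 B] .
  define K' where "K' = {n \<otimes>\<^bsub>W\<^esub> top b | n b. n \<in> K \<inter> base (carrier B) \<and> b \<in> carrier B \<and> top b \<in> K}"
  have K': "subgroup K' W" "finite (rcosets\<^bsub>W\<^esub> K')"
    unfolding K'_def by (rule split_subgroup_finite_index[OF K(1,3)])+
  obtain Y where Y: "finite Y" "Y \<subseteq> K'" "generate W Y = K'"
    using W.Schreier[OF fg K'] by blast
  have "\<exists>n b. n \<in> K \<inter> base (carrier B) \<and> b \<in> B0 \<and> g = n \<otimes>\<^bsub>W\<^esub> top b" if "g \<in> Y" for g
    using that Y(2) unfolding K'_def B0_def by blast
  then obtain \<nu> \<beta> where \<nu>: "\<And>g. g \<in> Y \<Longrightarrow> \<nu> g \<in> K" "\<And>g. g \<in> Y \<Longrightarrow> \<nu> g \<in> base (carrier B)"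
    "\<And>g. g \<in> Y \<Longrightarrow> \<beta> g \<in> B0" "\<And>g. g \<in> Y \<Longrightarrow> g = \<nu> g \<otimes>\<^bsub>W\<^esub> top (\<beta> g)"
    by (metis IntE)
  define S where "S = (\<Union>g\<in>Y. supp (fst (\<nu> g)))"
  have S: "finite S" "S \<subseteq> carrier B"
    unfolding S_def using Y(1) base_supp(1,2)[OF \<nu>(2)] by (intro finite_UN_I UN_least; blast)+
  have \<nu>S: "\<nu> g \<in> base S" if "g \<in> Y" for g
    using base_supp(3)[OF \<nu>(2)[OF that]] base_mono[of "supp (fst (\<nu> g))" S] that by (auto simp: S_def)
  have \<nu>H: "\<nu> ` Y \<subseteq> H" using \<nu>(1) K(2) by blast
  define Q where "Q = generate W (\<nu> ` Y)"
  have QK: "Q \<subseteq> K" unfolding Q_def by (rule W.generate_subgroup_incl[OF _ K.subgroup_axioms]) (use \<nu> in blast)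
  have QS: "Q \<subseteq> base S" unfolding Q_def by (rule W.generate_subgroup_incl[OF _ subgroup_base]) (use \<nu>S in blast)
  have QH: "Q \<subseteq> H" using QK K(2) by blast
  have "\<phi>.fixset Q \<noteq> {}"
    unfolding Q_def
  proof (rule \<phi>.fixed_point_of_elliptic_fg[OF _ \<nu>H])
    fix g assume "g \<in> generate W (\<nu> ` Y)"
    then show "\<phi>.fixset {g} \<noteq> {}"
      using elliptic_of_finite_support[OF \<phi> K(1,2) B0c B0inf B0K ab S, of g] QK QS by (auto simp: Q_def)
  qed (use Y(1) in blast)
  moreover obtain v where v: "v \<in> V" "\<And>b. b \<in> B0 \<Longrightarrow> \<phi> (top b) v = v"
    using FA[OF B0 B0H] by blast
  ultimately obtain p where p: "p \<in> \<phi>.fixset Q" "\<And>w. w \<in> \<phi>.fixset Q \<Longrightarrow> d v w = d v p + d p w"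
    using \<phi>.gate_exists[OF \<phi>.fixset_convex[OF QH], of v] by metis
  have pV: "p \<in> V" using p(1) by (simp add: \<phi>.fixset_def)
  have displacing: "\<phi> (top b) p = p" if b: "b \<in> B0" "(\<lambda>x. b \<otimes>\<^bsub>B\<^esub> x) ` S \<inter> S = {}" for b
  proof (rule \<phi>.gate_fixed_by_displacing[OF QH B0H[OF b(1)] v(1) v(2)[OF b(1)] p])
    fix q r assume qr: "q \<in> Q" "r \<in> Q"
    have "b \<in> carrier B" "q \<in> base S" "r \<in> base S" using b qr QS B0c by auto
    then show "(top b \<otimes>\<^bsub>W\<^esub> q \<otimes>\<^bsub>W\<^esub> inv\<^bsub>W\<^esub> top b) \<otimes>\<^bsub>W\<^esub> r = r \<otimes>\<^bsub>W\<^esub> (top b \<otimes>\<^bsub>W\<^esub> q \<otimes>\<^bsub>W\<^esub> inv\<^bsub>W\<^esub> top b)"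
      using base_commute[OF top_base _ b(2)] by blast
  qed
  have B0_fix: "\<phi> (top b) p = p" if b: "b \<in> B0" for b
  proof -
    let ?bad = "{c \<in> carrier B. (\<lambda>x. c \<otimes>\<^bsub>B\<^esub> x) ` S \<inter> S \<noteq> {}}"
    have bc: "b \<in> carrier B" using b B0c by blast
    have bad: "finite ?bad" by (rule B.finite_nondisplacing[OF S(1,1) S(2,2)])
    \<comment> \<open>An element \<open>b\<close> that displaces nothing is still a product of
      \<open>c\<close> and \<open>?c'\<close>, both displacing: leaving out \<open>?bad\<close>
      handles \<open>c\<close>, and leaving out the second set handles \<open>?c'\<close>.\<close>
    then have "finite (?bad \<union> (\<lambda>c. b \<otimes>\<^bsub>B\<^esub> inv\<^bsub>B\<^esub> c) ` ?bad)" by blast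
    then obtain c where c: "c \<in> B0" "c \<notin> ?bad" "c \<notin> (\<lambda>c. b \<otimes>\<^bsub>B\<^esub> inv\<^bsub>B\<^esub> c) ` ?bad"
      using B0inf by (meson Un_iff finite_subset subsetI)
    have cc: "c \<in> carrier B" using c(1) B0c by blast
    let ?c' = "inv\<^bsub>B\<^esub> c \<otimes>\<^bsub>B\<^esub> b"
    have c': "?c' \<in> B0" using c(1) b subgroup.m_closed[OF B0(1)] subgroup.m_inv_closed[OF B0(1)] by blast
    have "c = b \<otimes>\<^bsub>B\<^esub> inv\<^bsub>B\<^esub> ?c'" using bc cc by (simp add: B.inv_mult_group B.m_assoc [symmetric])
    then have "?c' \<notin> ?bad" using c(3) by blast
    then have f: "\<phi> (top c) p = p" "\<phi> (top ?c') p = p"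
      using displacing[OF c(1)] displacing[OF c'] c(2) cc bc by auto
    have "top b = top c \<otimes>\<^bsub>W\<^esub> top ?c'"
    proof -
      have "b = c \<otimes>\<^bsub>B\<^esub> ?c'" using bc cc by (simp add: B.m_assoc [symmetric])
      then show ?thesis using top.hom_mult[of c ?c'] bc cc by simp
    qed
    then show ?thesis using \<phi>.act_mult[OF B0H[OF c(1)] B0H[OF c'] pV] f by simp
  qed
  have K'K: "K' \<subseteq> K" using K.m_closed by (auto simp: K'_def)
  have "\<phi> g p = p" if g: "g \<in> Y" for g
  proof -
    have "\<nu> g \<in> Q" using g unfolding Q_def by (intro generate.incl) blast
    then have "\<phi> (\<nu> g) p = p" "\<nu> g \<in> H" using p(1) QH by (auto simp: \<phi>.fixset_def)
    then show ?thesis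
      using \<phi>.act_mult[OF _ B0H[OF \<nu>(3)[OF g]] pV, of "\<nu> g"] B0_fix[OF \<nu>(3)[OF g]] \<nu>(4)[OF g] by simp
  qed
  then have "p \<in> \<phi>.fixset Y" using pV by (simp add: \<phi>.fixset_def)
  then have pK': "p \<in> \<phi>.fixset K'" using \<phi>.fixset_generate[of Y] Y K'K K(2) by blast
  obtain Z where Z: "finite Z" "Z \<subseteq> H" "generate W Z = H"
    using W.Schreier[OF fg \<phi>.subgroup fin] by blast
  \<comment> \<open>The uniform exponent \<open>N\<close> comes from a finite quotient group, hence
    from a normal subgroup inside \<open>K'\<close>.\<close>
  obtain K2 where K2: "K2 \<lhd> W" "K2 \<subseteq> K'" "finite (rcosets\<^bsub>W\<^esub> K2)"
    using W.normal_core_finite_index[OF K'] by blast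
  obtain N where N: "0 < (N::nat)" "\<And>g. g \<in> carrier W \<Longrightarrow> g [^]\<^bsub>W\<^esub> N \<in> K2"
    using W.normal_finite_index_exponent[OF K2(1,3)] by blast
  have "\<phi>.fixset (generate W Z) \<noteq> {}"
  proof (rule \<phi>.fixed_point_of_elliptic_fg[OF Z(1,2)])
    fix g assume "g \<in> generate W Z"
    then have g: "g \<in> H" using Z(3) by simp
    have "g [^]\<^bsub>W\<^esub> N \<in> K'" using N(2)[OF \<phi>.H_carrier[OF g]] K2(2) by blast
    then have "p \<in> \<phi>.fixset {g [^]\<^bsub>W\<^esub> N}" using pK' by (simp add: \<phi>.fixset_def)
    then show "\<phi>.fixset {g} \<noteq> {}" using \<phi>.elliptic_if_power_elliptic[OF g N(1)] by blast
  qed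
  then show ?thesis unfolding Z(3) by (auto simp: \<phi>.fixset_def)
qed

section \<open>The two directions of the equivalence\<close>

lemma hereditary_FA_wreath:
  assumes "finitely_generated_group A" "finitely_generated_group B" "infinite (carrier B)"
    and FA: "hereditary_FA TYPE('v) B" and ab: "finite (carrier (abelianisation A))"
  shows "hereditary_FA TYPE('v) W"
proof -
  obtain U where U: "finite U" "U \<subseteq> carrier W" "generate W U = carrier W"
    using assms(1,2) fg_wreath unfolding finitely_generated_group_def by metis
  have main: "property_FA TYPE('v) (W\<lparr>carrier := H\<rparr>)"
    if H: "subgroup H W" and fin: "finite (rcosets\<^bsub>W\<^esub> H)" for H
    unfolding property_FA_def
  proof (intro allI impI, elim conjE)
    fix V :: "'v set" and E \<phi>
    assume T: "simplicial_tree V E" and act: "tree_action (W\<lparr>carrier := H\<rparr>) V E \<phi>"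
      and inv: "without_inversions (W\<lparr>carrier := H\<rparr>) E \<phi>"
    interpret \<phi>: group_action "W\<lparr>carrier := H\<rparr>" V \<phi> using act by (simp add: tree_action_def)
    have "\<exists>v\<in>V. \<forall>b\<in>B0. \<phi> (top b) v = v"
      if B0: "subgroup B0 B" "finite (rcosets\<^bsub>B\<^esub> B0)" and B0H: "\<And>b. b \<in> B0 \<Longrightarrow> top b \<in> H" for B0
    proof -
      have B0c: "B0 \<subseteq> carrier B" using subgroup.subset[OF B0(1)] .
      have "top \<in> hom (B\<lparr>carrier := B0\<rparr>) (W\<lparr>carrier := H\<rparr>)"
        using B0H B0c by (auto simp: hom_def subset_iff)
      then have "\<phi> \<circ> top \<in> hom (B\<lparr>carrier := B0\<rparr>) (BijGroup V)"
        using \<phi>.group_hom group_hom.homh hom_compose by blast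
      then have "group_action (B\<lparr>carrier := B0\<rparr>) V (\<phi> \<circ> top)"
        by (intro group_action.intro group_hom.intro group_hom_axioms.intro group_BijGroup
            B.subgroup_imp_group B0(1))
      then have "tree_action (B\<lparr>carrier := B0\<rparr>) V E (\<phi> \<circ> top)"
        using act B0H by (simp add: tree_action_def)
      moreover have "without_inversions (B\<lparr>carrier := B0\<rparr>) E (\<phi> \<circ> top)"
        using inv B0H unfolding without_inversions_def by fastforce
      moreover have "property_FA TYPE('v) (B\<lparr>carrier := B0\<rparr>)"
        using FA B0 by (simp add: hereditary_FA_def)
      ultimately show ?thesis using T unfolding property_FA_def by fastforce
    qed
    then show "\<exists>v\<in>V. \<forall>g\<in>carrier (W\<lparr>carrier := H\<rparr>). \<phi> g v = v"
      using fixed_vertex[OF tree_isometries_of_action[OF W.group_axioms H T act inv] fin U assms(3) ab]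
      by simp
  qed
  have "rcosets\<^bsub>W\<^esub> (carrier W) \<subseteq> {carrier W}"
    using W.coset_join2[OF _ W.subgroup_self] by (auto simp: RCOSETS_def)
  then have "property_FA TYPE('v) W"
    using main[OF W.subgroup_self] finite_subset by fastforce
  then show ?thesis using main by (simp add: hereditary_FA_def)
qed

text \<open>A finite-index subgroup of \<open>B\<close> is the image under \<open>snd\<close> of its
  preimage, which has finite index in \<open>W\<close>.\<close>

lemma hereditary_FA_top:
  assumes FA: "hereditary_FA TYPE('v) W"
  shows "hereditary_FA TYPE('v) B"
proof -
  interpret s: group_hom W B snd by (rule group_hom_snd)
  have surj: "snd ` {g \<in> carrier W. snd g \<in> H} = H" if "H \<subseteq> carrier B" for H
  proof
    show "H \<subseteq> snd ` {g \<in> carrier W. snd g \<in> H}"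
    proof
      fix b assume "b \<in> H"
      then have "top b \<in> {g \<in> carrier W. snd g \<in> H}" "snd (top b) = b"
        using that top_closed by (auto simp: top_def)
      then show "b \<in> snd ` {g \<in> carrier W. snd g \<in> H}" by force
    qed
  qed auto
  have "property_FA TYPE('v) B"
  proof (rule property_FA_quotient[OF group_hom_snd])
    show "snd ` carrier W = carrier B" using surj[of "carrier B"] s.hom_closed by force
  qed (use FA in \<open>simp add: hereditary_FA_def\<close>)
  moreover have "property_FA TYPE('v) (B\<lparr>carrier := H\<rparr>)"
    if H: "subgroup H B" "finite (rcosets\<^bsub>B\<^esub> H)" for H
  proof -
    let ?P = "{g \<in> carrier W. snd g \<in> H}"
    note P = B.finite_index_preimage[OF group_hom_snd H]
    have "group_hom (W\<lparr>carrier := ?P\<rparr>) (B\<lparr>carrier := H\<rparr>) snd"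
      by (intro group_hom.intro group_hom_axioms.intro W.subgroup_imp_group P B.subgroup_imp_group H)
        (auto simp: hom_def)
    then show ?thesis
    proof (rule property_FA_quotient)
      show "snd ` carrier (W\<lparr>carrier := ?P\<rparr>) = carrier (B\<lparr>carrier := H\<rparr>)"
        using surj[OF subgroup.subset[OF H(1)]] by simp
      show "property_FA TYPE('v) (W\<lparr>carrier := ?P\<rparr>)" using FA P by (simp add: hereditary_FA_def)
    qed
  qed
  ultimately show ?thesis by (simp add: hereditary_FA_def)
qed

text \<open>The shift by an element of \<open>B\<close> merely permutes the summands of
  \<open>F\<close>, which makes \<open>F\<close> a homomorphism on all of \<open>W\<close>. It is
  nonzero on a single copy of \<open>A\<close>.\<close>

lemma finite_abelianisation_if_FA:
  assumes fg: "finitely_generated_group A" and inf: "infinite (UNIV :: 'v set)"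
    and FA: "property_FA TYPE('v) W"
  shows "finite (carrier (abelianisation A))"
proof (rule ccontr)
  assume "infinite (carrier (abelianisation A))"
  then obtain \<tau> :: "'a \<Rightarrow> int" where
    \<tau>: "\<And>x y. x \<in> carrier A \<Longrightarrow> y \<in> carrier A \<Longrightarrow> \<tau> (x \<otimes>\<^bsub>A\<^esub> y) = \<tau> x + \<tau> y"
    and nz: "\<exists>x\<in>carrier A. \<tau> x \<noteq> 0"
    using infinite_abelianisation_int_hom[OF fg] by blast
  have \<tau>1: "\<tau> \<one>\<^bsub>A\<^esub> = 0" using \<tau>[of "\<one>\<^bsub>A\<^esub>" "\<one>\<^bsub>A\<^esub>"] by simp
  define F where "F g = (\<Sum>x\<in>supp (fst g). \<tau> (fst g x))" for g :: "('b \<Rightarrow> 'a) \<times> 'b"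
  have F: "F (f, b) = (\<Sum>x\<in>T. \<tau> (f x))" if "finite T" "supp f \<subseteq> T" "T \<subseteq> carrier B" for f b T
    unfolding F_def fst_conv
    by (rule sum.mono_neutral_left) (use that \<tau>1 in \<open>auto simp: supp_def\<close>)
  have "F (p \<otimes>\<^bsub>W\<^esub> q) = F p + F q" if pq: "p \<in> carrier W" "q \<in> carrier W" for p q
  proof -
    obtain f b g c where p: "p = (f, b)" and q: "q = (g, c)" by fastforce
    have f: "f x \<in> carrier A" "g x \<in> carrier A" if "x \<in> carrier B" for x
      using that pq p q by (auto simp: carrier_W)
    have b: "b \<in> carrier B" and fin: "finite (supp f)" "finite (supp g)"
      using pq p q by (auto simp: carrier_W)
    have sc: "supp h \<subseteq> carrier B" for h by (auto simp: supp_def)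
    let ?g = "\<lambda>x. g (inv\<^bsub>B\<^esub> b \<otimes>\<^bsub>B\<^esub> x)"
    let ?M = "(\<lambda>x. b \<otimes>\<^bsub>B\<^esub> x) ` supp g"
    have inj: "inj_on (\<lambda>x. b \<otimes>\<^bsub>B\<^esub> x) (supp g)"
      using b sc by (auto simp: inj_on_def subset_iff)
    have cancel: "inv\<^bsub>B\<^esub> b \<otimes>\<^bsub>B\<^esub> (b \<otimes>\<^bsub>B\<^esub> x) = x" "b \<otimes>\<^bsub>B\<^esub> (inv\<^bsub>B\<^esub> b \<otimes>\<^bsub>B\<^esub> x) = x" if "x \<in> carrier B" for x
      using that b by (simp_all add: B.m_assoc [symmetric])
    let ?T = "supp f \<union> ?M"
    have T: "finite ?T" "?T \<subseteq> carrier B" using fin sc b by (auto simp: subset_iff)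
    let ?h = "\<lambda>x\<in>carrier B. f x \<otimes>\<^bsub>A\<^esub> ?g x"
    have gM: "?g x = \<one>\<^bsub>A\<^esub>" if "x \<in> carrier B" "x \<notin> ?M" for x
    proof (rule ccontr)
      assume "?g x \<noteq> \<one>\<^bsub>A\<^esub>"
      then have "inv\<^bsub>B\<^esub> b \<otimes>\<^bsub>B\<^esub> x \<in> supp g" using that b by (simp add: supp_def)
      then have "b \<otimes>\<^bsub>B\<^esub> (inv\<^bsub>B\<^esub> b \<otimes>\<^bsub>B\<^esub> x) \<in> ?M" by blast
      then show False using that cancel by simp
    qed
    have "supp ?h \<subseteq> ?T"
    proof (rule subsetI, rule ccontr)
      fix x assume x: "x \<in> supp ?h" "x \<notin> ?T"
      then have "x \<in> carrier B" "f x = \<one>\<^bsub>A\<^esub>" "?g x = \<one>\<^bsub>A\<^esub>" using gM by (auto simp: supp_def)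
      then show False using x(1) by (simp add: supp_def)
    qed
    then have "F (p \<otimes>\<^bsub>W\<^esub> q) = (\<Sum>x\<in>?T. \<tau> (?h x))"
      unfolding p q mult_W using T by (intro F)
    also have "\<dots> = (\<Sum>x\<in>?T. \<tau> (f x) + \<tau> (?g x))"
      by (rule sum.cong) (use T(2) f b \<tau> in \<open>auto simp: subset_iff\<close>)
    also have "\<dots> = (\<Sum>x\<in>?T. \<tau> (f x)) + (\<Sum>x\<in>?T. \<tau> (?g x))" by (rule sum.distrib)
    also have "(\<Sum>x\<in>?T. \<tau> (f x)) = F p" unfolding p using T by (intro F[symmetric]) auto
    also have "(\<Sum>x\<in>?T. \<tau> (?g x)) = (\<Sum>x\<in>?M. \<tau> (?g x))"
      by (rule sum.mono_neutral_right) (use T gM \<tau>1 in auto)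
    also have "\<dots> = (\<Sum>x\<in>supp g. \<tau> (g (inv\<^bsub>B\<^esub> b \<otimes>\<^bsub>B\<^esub> (b \<otimes>\<^bsub>B\<^esub> x))))" by (simp add: sum.reindex[OF inj])
    also have "\<dots> = F q" unfolding q F_def fst_conv
      by (rule sum.cong) (use cancel sc in \<open>auto simp: subset_iff\<close>)
    finally show ?thesis .
  qed
  moreover have "\<exists>g\<in>carrier W. F g \<noteq> 0"
  proof -
    obtain a where a: "a \<in> carrier A" "\<tau> a \<noteq> 0" using nz by blast
    have "F (single \<one>\<^bsub>B\<^esub> a) = (\<Sum>x\<in>{\<one>\<^bsub>B\<^esub>}. \<tau> ((\<lambda>x\<in>carrier B. if x = \<one>\<^bsub>B\<^esub> then a else \<one>\<^bsub>A\<^esub>) x))"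
      unfolding single_def by (rule F) (auto simp: supp_def)
    then show ?thesis using a single_closed[of a "\<one>\<^bsub>B\<^esub>"] by force
  qed
  ultimately have "\<not> property_FA TYPE('v) W"
    using not_FA_if_int_hom[OF W.group_axioms inf, of F] by blast
  then show False using FA by blast
qed

end

theorem theorem1p6:
  fixes A :: "('a, 'c) monoid_scheme" and B :: "('b, 'd) monoid_scheme"
  assumes "finitely_generated_group A"
    and "finitely_generated_group B"
    and "infinite (carrier B)"
    and "infinite (UNIV :: 'v set)"
  shows "hereditary_FA TYPE('v) (wreath_product A B) \<longleftrightarrow>
         hereditary_FA TYPE('v) B \<and> finite (carrier (abelianisation A))"
proof -
  interpret wreath A B
    using assms(1,2) by (simp add: wreath_def finitely_generated_group_def)
  show ?thesis
    using hereditary_FA_wreath[OF assms(1-3)] hereditary_FA_top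
      finite_abelianisation_if_FA[OF assms(1,4)]
    unfolding hereditary_FA_def[of _ "wreath_product A B"] by blast
qed

end
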